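(* Let $(\mathcal M,g)$ be a two charge microstate geometry. There is a constant $C>0$, depending only on the parameters of the geometry, such that for every smooth solution $u$ of the wave equation $\Box_g u=0$ on $\mathcal M$ with compactly supported initial data on $\Sigma_0$ and for all $t\ge 0$, $$\int_{\Sigma_t}|\partial u|^2\,\mathrm{dvol}_{\underline g}\ \le\ C\int_{\Sigma_0}\left(|\partial u|^2+|\partial\Phi u|^2\right)\mathrm{dvol}_{\underline g}.$$
   Context: Two charge microstate geometry: fix $Q_1,Q_2,R_z>0$ and put $a=\sqrt{Q_1Q_2}/R_z$, $f=r^2+a^2\cos^2\theta$, $h=\sqrt{(1+Q_1/f)(1+Q_2/f)}$ (so $hf=\sqrt{(f+Q_1)(f+Q_2)}$). The manifold $\mathcal M$ is diffeomorphic to $\mathbb R\times\mathbb S^3\times\mathbb R^2$, with coordinates $t\in\mathbb R$, $r\ge 0$, $\theta\in[0,\pi/2]$, $\phi,\psi$ periodic with period $2\pi$, $z$ periodic with period $2\pi R_z$, and metric $$g=-\tfrac1h(dt^2-dz^2)+hf\Big(d\theta^2+\tfrac{dr^2}{r^2+a^2}\Big)-\tfrac{2a\sqrt{Q_1Q_2}}{hf}(\cos^2\theta\,dz\,d\psi+\sin^2\theta\,dt\,d\phi)+h\Big(\big(r^2+\tfrac{a^2Q_1Q_2\cos^2\theta}{h^2f^2}\big)\cos^2\theta\,d\psi^2+\big(r^2+a^2-\tfrac{a^2Q_1Q_2\sin^2\theta}{h^2f^2}\big)\sin^2\theta\,d\phi^2\Big).$$ The loci $r=0$, $\theta=0$,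 $\theta=\pi/2$ are coordinate singularities; $g$ extends smoothly across them to a globally hyperbolic Lorentzian metric. Notation: $T=\partial_t$ and $\Phi=\partial_\phi$ are coordinate (Killing) vector fields. $\Sigma_{t_1}=\{t=t_1\}$ (spacelike), with induced metric $\underline g$ and volume form $\mathrm{dvol}_{\underline g}$. At each point, with $\{X_1,\dots,X_5\}$ a $\underline g$-orthonormal basis of the tangent space of $\Sigma_t$, $|\partial u|^2:=|Tu|^2+\sum_{A=1}^5|X_Au|^2$. *)

theory Defs
  imports "HOL-Analysis.Analysis"
begin

section \<open>Smooth maps\<close>

primrec Ck_on :: "nat \<Rightarrow> 'a::real_normed_vector set \<Rightarrow> ('a \<Rightarrow> 'b::real_normed_vector) \<Rightarrow> bool" where
  "Ck_on 0 S f \<longleftrightarrow> continuous_on S f"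
| "Ck_on (Suc k) S f \<longleftrightarrow> (\<forall>x\<in>S. f differentiable (at x)) \<and>
     (\<forall>v. Ck_on k S (\<lambda>x. frechet_derivative f (at x) v))"

text \<open>Used for open sets \<^term>\<open>S\<close> only.\<close>

definition smooth_on :: "'a::real_normed_vector set \<Rightarrow> ('a \<Rightarrow> 'b::real_normed_vector) \<Rightarrow> bool" where
  "smooth_on S f \<longleftrightarrow> (\<forall>k. Ck_on k S f)"

text \<open>Smoothness on an embedded submanifold of a Euclidean space: local existence of
  smooth extensions. It depends only on the values of the function on the submanifold.\<close>

definition smooth_on_submanifold ::
    "'a::real_normed_vector set \<Rightarrow> ('a \<Rightarrow> 'b::real_normed_vector) \<Rightarrow> bool" where
  "smooth_on_submanifold M u \<longleftrightarrow>
     (\<forall>p\<in>M. \<exists>W F. open W \<and> p \<in> W \<and> smooth_on W F \<and> (\<forall>y\<in>W \<inter> M. F y = u y))"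

definition partial :: "'n::finite \<Rightarrow> (real^'n \<Rightarrow> 'b::real_normed_vector) \<Rightarrow> real^'n \<Rightarrow> 'b" where
  "partial i F q = frechet_derivative F (at q) (axis i 1)"

section \<open>The wave operator in local coordinates\<close>

definition wave_operator ::
    "(real^'n::finite \<Rightarrow> real^'n^'n) \<Rightarrow> (real^'n \<Rightarrow> real) \<Rightarrow> real^'n \<Rightarrow> real" where
  "wave_operator G F q =
     (\<Sum>i\<in>UNIV. partial i (\<lambda>y. sqrt \<bar>det (G y)\<bar> *
        (\<Sum>j\<in>UNIV. matrix_inv (G y) $ i $ j * partial j F y)) q) / sqrt \<bar>det (G q)\<bar>"

section \<open>The manifold and its coordinates\<close>

datatype space_ix = Rad | Theta | Phi | Psi | Zed
datatype ix = Time | Space space_ix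

lemma UNIV_space_ix: "(UNIV :: space_ix set) = {Rad, Theta, Phi, Psi, Zed}"
  by (auto intro: space_ix.exhaust)

lemma UNIV_ix: "(UNIV :: ix set) = {Time, Space Rad, Space Theta, Space Phi, Space Psi, Space Zed}"
proof -
  have "x \<in> insert Time (range Space)" for x by (cases x) auto
  then have "UNIV = insert Time (range Space)" by blast
  then show ?thesis by (simp add: UNIV_space_ix)
qed

instance space_ix :: finite
  by standard (simp add: UNIV_space_ix)

instance ix :: finite
  by standard (simp add: UNIV_ix)

text \<open>The manifold is \<^term>\<open>UNIV \<times> sphere 0 1 \<times> UNIV\<close>, that is, the product of the line, the
  unit sphere of \<^typ>\<open>complex \<times> complex\<close> and the plane \<^typ>\<open>complex\<close>.\<close>

type_synonym point = "real \<times> (complex \<times> complex) \<times> complex"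

definition spacetime :: "point set" where
  "spacetime = UNIV \<times> sphere 0 1 \<times> UNIV"

text \<open>At \<^term>\<open>r = 0\<close> the kernel of the metric is spanned by
  \<^term>\<open>Rz\<close> times the \<open>z\<close> coordinate field plus the \<open>\<psi>\<close> coordinate field. So it is the orbit of that
  field which shrinks to a point there; \<open>z/Rz\<close> is the polar angle of the plane factor, and
  \<open>\<psi> - z/Rz\<close>, which is constant along the field, is an angle of the sphere.\<close>

definition coord_map :: "real \<Rightarrow> real^ix \<Rightarrow> point" where
  "coord_map Rz q =
     (let t = q $ Time; r = q $ Space Rad; \<theta> = q $ Space Theta;
          \<phi> = q $ Space Phi; \<psi> = q $ Space Psi; z = q $ Space Zed
      in (t, (of_real (sin \<theta>) * cis \<phi>, of_real (cos \<theta>) * cis (\<psi> - z / Rz)),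
          of_real r * cis (z / Rz)))"

definition sym_prod :: "ix \<Rightarrow> ix \<Rightarrow> real^ix \<Rightarrow> real^ix \<Rightarrow> real" where
  "sym_prod i j v w = (v $ i * w $ j + v $ j * w $ i) / 2"

text \<open>The line element, as a bilinear form on the coordinate tangent space at \<^term>\<open>q\<close>.\<close>

definition metric_form ::
    "real \<Rightarrow> real \<Rightarrow> real \<Rightarrow> real^ix \<Rightarrow> real^ix \<Rightarrow> real^ix \<Rightarrow> real" where
  "metric_form Q1 Q2 Rz q v w =
     (let a = sqrt (Q1 * Q2) / Rz;
          r = q $ Space Rad; \<theta> = q $ Space Theta;
          f = r\<^sup>2 + a\<^sup>2 * (cos \<theta>)\<^sup>2;
          h = sqrt ((1 + Q1 / f) * (1 + Q2 / f));
          d = (\<lambda>i j. sym_prod i j v w)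
      in - (1 / h) * (d Time Time - d (Space Zed) (Space Zed))
         + h * f * (d (Space Theta) (Space Theta) + d (Space Rad) (Space Rad) / (r\<^sup>2 + a\<^sup>2))
         - 2 * a * sqrt (Q1 * Q2) / (h * f) *
             ((cos \<theta>)\<^sup>2 * d (Space Zed) (Space Psi) + (sin \<theta>)\<^sup>2 * d Time (Space Phi))
         + h * ((r\<^sup>2 + a\<^sup>2 * Q1 * Q2 * (cos \<theta>)\<^sup>2 / (h\<^sup>2 * f\<^sup>2)) * (cos \<theta>)\<^sup>2
                  * d (Space Psi) (Space Psi)
              + (r\<^sup>2 + a\<^sup>2 - a\<^sup>2 * Q1 * Q2 * (sin \<theta>)\<^sup>2 / (h\<^sup>2 * f\<^sup>2)) * (sin \<theta>)\<^sup>2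
                  * d (Space Phi) (Space Phi)))"

text \<open>The metric is a smooth tensor on the whole manifold whose coordinate expression off the
  loci \<open>r = 0\<close>, \<open>\<theta> = 0\<close>, \<open>\<theta> = \<pi>/2\<close> is \<^const>\<open>metric_form\<close>. By density this fixes it on tangent
  vectors of \<^const>\<open>spacetime\<close>; its values on other vectors of the ambient space are immaterial.
  Existence is \<open>two_charge_metric_exists\<close> below.\<close>

definition two_charge_metric ::
    "real \<Rightarrow> real \<Rightarrow> real \<Rightarrow> (point \<Rightarrow> point \<Rightarrow> point \<Rightarrow> real) \<Rightarrow> bool" where
  "two_charge_metric Q1 Q2 Rz g \<longleftrightarrow>
     (\<forall>p\<in>spacetime. bilinear (g p)) \<and>
     (\<forall>v w. smooth_on_submanifold spacetime (\<lambda>p. g p v w)) \<and>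
     (\<forall>q v w. q $ Space Rad > 0 \<longrightarrow> q $ Space Theta \<in> {0<..<pi/2} \<longrightarrow>
        g (coord_map Rz q) (frechet_derivative (coord_map Rz) (at q) v)
          (frechet_derivative (coord_map Rz) (at q) w) = metric_form Q1 Q2 Rz q v w)"

section \<open>Solutions of the wave equation\<close>

text \<open>Local parametrizations of the six-dimensional manifold, that is, immersions of open
  sets. Injectivity is not required: equal dimensions make them local diffeomorphisms.\<close>

definition local_param :: "(real^ix) set \<Rightarrow> (real^ix \<Rightarrow> point) \<Rightarrow> bool" where
  "local_param V \<sigma> \<longleftrightarrow> open V \<and> smooth_on V \<sigma> \<and> \<sigma> ` V \<subseteq> spacetime \<and>
     (\<forall>q\<in>V. inj (frechet_derivative \<sigma> (at q)))"

definition pullback_matrix ::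
    "(point \<Rightarrow> point \<Rightarrow> point \<Rightarrow> real) \<Rightarrow> (real^ix \<Rightarrow> point) \<Rightarrow> real^ix \<Rightarrow> real^ix^ix" where
  "pullback_matrix g \<sigma> q = (\<chi> i j. g (\<sigma> q) (partial i \<sigma> q) (partial j \<sigma> q))"

definition smooth_wave_solution ::
    "(point \<Rightarrow> point \<Rightarrow> point \<Rightarrow> real) \<Rightarrow> (point \<Rightarrow> real) \<Rightarrow> bool" where
  "smooth_wave_solution g u \<longleftrightarrow> smooth_on_submanifold spacetime u \<and>
     (\<forall>V \<sigma>. local_param V \<sigma> \<longrightarrow>
        (\<forall>q\<in>V. wave_operator (pullback_matrix g \<sigma>) (u \<circ> \<sigma>) q = 0))"

text \<open>The initial data of \<^term>\<open>u\<close> are \<^term>\<open>u\<close> and its time derivative on the slice of time zero.\<close>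

definition compactly_supported_data :: "(point \<Rightarrow> real) \<Rightarrow> bool" where
  "compactly_supported_data u \<longleftrightarrow>
     (\<exists>K. compact K \<and> K \<subseteq> sphere 0 1 \<times> UNIV \<and>
        (\<forall>y \<in> sphere 0 1 \<times> UNIV - K. u (0, y) = 0 \<and> deriv (\<lambda>s. u (s, y)) 0 = 0))"

section \<open>Energies\<close>

definition induced_metric ::
    "real \<Rightarrow> real \<Rightarrow> real \<Rightarrow> real^ix \<Rightarrow> real^space_ix^space_ix" where
  "induced_metric Q1 Q2 Rz q =
     (\<chi> i j. metric_form Q1 Q2 Rz q (axis (Space i) 1) (axis (Space j) 1))"

definition orthonormal_frame ::
    "real \<Rightarrow> real \<Rightarrow> real \<Rightarrow> real^ix \<Rightarrow> (space_ix \<Rightarrow> real^ix) \<Rightarrow> bool" where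
  "orthonormal_frame Q1 Q2 Rz q X \<longleftrightarrow>
     (\<forall>A. X A $ Time = 0) \<and> (\<forall>A B. metric_form Q1 Q2 Rz q (X A) (X B) = of_bool (A = B))"

text \<open>The choice of the frame does not affect the value of the next definition. Here \<^term>\<open>U\<close> is a
  function of the coordinates.\<close>

definition energy_density ::
    "real \<Rightarrow> real \<Rightarrow> real \<Rightarrow> (real^ix \<Rightarrow> real) \<Rightarrow> real^ix \<Rightarrow> real" where
  "energy_density Q1 Q2 Rz U q =
     (let X = (SOME X. orthonormal_frame Q1 Q2 Rz q X)
      in (partial Time U q)\<^sup>2 + (\<Sum>A\<in>UNIV. (frechet_derivative U (at q) (X A))\<^sup>2))"

definition coords :: "real \<Rightarrow> real \<times> real \<times> real \<times> real \<times> real \<Rightarrow> real^ix" where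
  "coords t x = (case x of (r, \<theta>, \<phi>, \<psi>, z) \<Rightarrow>
     (\<chi> i. case i of Time \<Rightarrow> t
        | Space k \<Rightarrow> (case k of Rad \<Rightarrow> r | Theta \<Rightarrow> \<theta> | Phi \<Rightarrow> \<phi> | Psi \<Rightarrow> \<psi> | Zed \<Rightarrow> z)))"

text \<open>Integration over the slice of time \<^term>\<open>t\<close> against the Riemannian volume of the induced
  metric. The coordinates cover the slice up to a null set. The integral takes values in
  \<^typ>\<open>ennreal\<close>, so that a bound on it includes its finiteness.\<close>

definition slice_integral ::
    "real \<Rightarrow> real \<Rightarrow> real \<Rightarrow> real \<Rightarrow> (real^ix \<Rightarrow> real) \<Rightarrow> ennreal" where
  "slice_integral Q1 Q2 Rz t F =
     (\<integral>\<^sup>+ x \<in> {0<..} \<times> {0<..<pi/2} \<times> {0<..<2*pi} \<times> {0<..<2*pi} \<times> {0<..<2*pi*Rz}.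
        ennreal (F (coords t x) * sqrt (det (induced_metric Q1 Q2 Rz (coords t x)))) \<partial>lborel)"

section \<open>Existence of the metric\<close>

lemma Ck_on_Suc_imp: "Ck_on (Suc k) S f \<Longrightarrow> Ck_on k S f"
proof (induction k arbitrary: f)
  case 0
  then show ?case
    by (auto intro!: continuous_at_imp_continuous_on differentiable_imp_continuous_within)
next
  case (Suc k)
  then show ?case by simp
qed

lemma Ck_on_cong:
  assumes S: "open S"
  shows "(\<And>x. x \<in> S \<Longrightarrow> f x = g x) \<Longrightarrow> Ck_on k S f \<Longrightarrow> Ck_on k S g"
proof (induction k arbitrary: f g)
  case 0
  then show ?case using continuous_on_cong by force
next
  case (Suc k)
  have d: "(g has_derivative frechet_derivative f (at x)) (at x)" if "x \<in> S" for x
  proof -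
    have "(f has_derivative frechet_derivative f (at x)) (at x)"
      using Suc.prems(2) that frechet_derivative_works by auto
    then show ?thesis
      by (rule has_derivative_transform_within_open[OF _ S that]) (simp add: Suc.prems(1))
  qed
  have e: "frechet_derivative f (at x) v = frechet_derivative g (at x) v" if "x \<in> S" for x v
    using frechet_derivative_at[OF d[OF that]] by simp
  show ?case
    using d e Suc.prems(2)
    by (auto simp: differentiable_def intro: Suc.IH[of "\<lambda>x. frechet_derivative f (at x) _"])
qed

lemma Ck_on_SucI:
  assumes S: "open S"
    and d: "\<And>x. x \<in> S \<Longrightarrow> (f has_derivative D x) (at x)"
    and k: "\<And>v. Ck_on k S (\<lambda>x. D x v)"
  shows "Ck_on (Suc k) S f"
proof -
  have e: "D x v = frechet_derivative f (at x) v" if "x \<in> S" for x v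
    using frechet_derivative_at[OF d[OF that]] by simp
  show ?thesis
    using d by (auto simp: differentiable_def intro: Ck_on_cong[OF S e k])
qed

lemma Ck_on_SucD:
  assumes "Ck_on (Suc k) S f" "x \<in> S"
  shows "(f has_derivative frechet_derivative f (at x)) (at x)"
  using assms frechet_derivative_works by auto

lemma Ck_on_const: "open S \<Longrightarrow> Ck_on k S (\<lambda>x. c)"
  by (induction k arbitrary: c) (auto intro!: Ck_on_SucI derivative_eq_intros simp del: Ck_on.simps(2))

lemma Ck_on_linear: "open S \<Longrightarrow> bounded_linear f \<Longrightarrow> Ck_on k S f"
  by (cases k) (auto intro!: Ck_on_SucI[where D="\<lambda>_. f"] bounded_linear_imp_has_derivative
      Ck_on_const linear_continuous_on simp del: Ck_on.simps(2))

lemma Ck_on_add: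
  assumes S: "open S"
  shows "Ck_on k S f \<Longrightarrow> Ck_on k S g \<Longrightarrow> Ck_on k S (\<lambda>x. f x + g x)"
proof (induction k arbitrary: f g)
  case 0
  then show ?case by (simp add: continuous_on_add)
next
  case (Suc k)
  show ?case
    by (rule Ck_on_SucI[OF S has_derivative_add[OF Ck_on_SucD Ck_on_SucD]])
       (use Suc in auto)
qed

lemma Ck_on_mult:
  fixes f g :: "'a::real_normed_vector \<Rightarrow> real"
  assumes S: "open S"
  shows "Ck_on k S f \<Longrightarrow> Ck_on k S g \<Longrightarrow> Ck_on k S (\<lambda>x. f x * g x)"
proof (induction k arbitrary: f g)
  case 0
  then show ?case by (simp add: continuous_on_mult)
next
  case (Suc k)
  show ?case
    by (rule Ck_on_SucI[OF S has_derivative_mult[OF Ck_on_SucD Ck_on_SucD]])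
       (use Suc Ck_on_Suc_imp[OF Suc.prems(1)] Ck_on_Suc_imp[OF Suc.prems(2)]
         in \<open>auto intro!: Ck_on_add[OF S]\<close>)
qed

lemma Ck_on_powr:
  fixes f :: "'a::real_normed_vector \<Rightarrow> real"
  assumes S: "open S" and pos: "\<And>x. x \<in> S \<Longrightarrow> f x > 0"
  shows "Ck_on k S f \<Longrightarrow> Ck_on k S (\<lambda>x. f x powr b)"
proof (induction k arbitrary: b)
  case 0
  then show ?case using pos by (auto intro!: continuous_on_powr simp: less_imp_neq[symmetric])
next
  case (Suc k)
  have f: "Ck_on k S f" using Ck_on_Suc_imp Suc.prems by blast
  show ?case
  proof (rule Ck_on_SucI[OF S])
    fix x assume x: "x \<in> S"
    show "((\<lambda>x. f x powr b) has_derivative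
        (\<lambda>v. (b * f x powr (b - 1)) * frechet_derivative f (at x) v)) (at x)"
      using has_derivative_compose[OF Ck_on_SucD[OF Suc.prems x]
          has_real_derivative_powr[OF pos[OF x], of b, unfolded has_field_derivative_def]]
      by simp
  next
    show "Ck_on k S (\<lambda>x. (b * f x powr (b - 1)) * frechet_derivative f (at x) v)" for v
      using Suc f by (auto intro!: Ck_on_mult[OF S] Ck_on_const[OF S])
  qed
qed

text \<open>With \<open>w1, w2\<close> and \<open>x\<close> the complex coordinates of the sphere and of the plane, and
  \<open>P = Q1 + Q2 + f\<close>, \<open>K = h f\<close>, rewriting the line element gives
  \<open>- (f/K) dt\<^sup>2 + K |dw|\<^sup>2 + K |dx|\<^sup>2 / (|x|\<^sup>2 + a\<^sup>2)
    + (P/K) (a\<^sup>2 l1\<^sup>2 - a\<^sup>2 l2\<^sup>2 + 2 m l2) + (Rz\<^sup>2 - |w1|\<^sup>2 P) / (K (|x|\<^sup>2 + a\<^sup>2)) m\<^sup>2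
    - (2 a sqrt (Q1 Q2) / K) l1 dt\<close>,
  where \<open>l1 = |w1|\<^sup>2 d (arg w1)\<close>, \<open>l2 = |w2|\<^sup>2 d (arg w2)\<close>, \<open>m = |x|\<^sup>2 d (arg x)\<close> are smooth.\<close>

definition angular :: "complex \<Rightarrow> complex \<Rightarrow> real" where
  "angular w v = Re w * Im v - Im w * Re v"

definition sq_abs :: "complex \<Rightarrow> real" where
  "sq_abs w = Re w * Re w + Im w * Im w"

definition radial_f :: "real \<Rightarrow> point \<Rightarrow> real" where
  "radial_f b p = sq_abs (snd (snd p)) + b * sq_abs (snd (fst (snd p)))"

definition extended_form ::
    "real \<Rightarrow> real \<Rightarrow> real \<Rightarrow> point \<Rightarrow> point \<Rightarrow> point \<Rightarrow> real" where
  "extended_form Q1 Q2 Rz p v w =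
     (let b = Q1 * Q2 / Rz\<^sup>2;
          w1 = fst (fst (snd p)); w2 = snd (fst (snd p)); x = snd (snd p);
          f = radial_f b p; P = f + (Q1 + Q2); KK = (f + Q1) * (f + Q2);
          K = KK powr (1/2); K' = KK powr (-(1/2)); D = (sq_abs x + b) powr (-1);
          l1 = (\<lambda>v. angular w1 (fst (fst (snd v))));
          l2 = (\<lambda>v. angular w2 (snd (fst (snd v))));
          m = (\<lambda>v. angular x (snd (snd v)))
      in (-1) * (f * K' * (fst v * fst w)) + K * inner (fst (snd v)) (fst (snd w))
       + K * D * inner (snd (snd v)) (snd (snd w))
       + P * K' * (b * (l1 v * l1 w) + (-b) * (l2 v * l2 w) + (m v * l2 w + m w * l2 v))
       + (Rz\<^sup>2 + (-1) * (sq_abs w1 * P)) * (K' * D) * (m v * m w)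
       + (-(Q1 * Q2 / Rz)) * (K' * (l1 v * fst w + l1 w * fst v)))"

lemma smooth_extended_form:
  assumes "Q1 > 0" "Q2 > 0" "Rz > 0"
  shows "smooth_on UNIV (\<lambda>p. extended_form Q1 Q2 Rz p v w)"
proof -
  define b where "b = Q1 * Q2 / Rz\<^sup>2"
  have b: "b > 0" using assms by (simp add: b_def)
  have nn: "sq_abs z \<ge> 0" for z by (simp add: sq_abs_def)
  have f: "radial_f b p \<ge> 0" for p using nn b by (simp add: radial_f_def)
  have pos: "sq_abs z + b > 0" "(radial_f b p + Q1) * (radial_f b p + Q2) > 0" for z p
    using nn[of z] f[of p] b assms by (auto intro!: add_nonneg_pos mult_pos_pos)
  note sm = Ck_on_add[OF open_UNIV] Ck_on_mult[OF open_UNIV] Ck_on_const[OF open_UNIV]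
    Ck_on_powr[OF open_UNIV]
  have lin: "Ck_on k UNIV (\<lambda>p::point. Re (fst (fst (snd p))))"
    "Ck_on k UNIV (\<lambda>p::point. Im (fst (fst (snd p))))"
    "Ck_on k UNIV (\<lambda>p::point. Re (snd (fst (snd p))))"
    "Ck_on k UNIV (\<lambda>p::point. Im (snd (fst (snd p))))"
    "Ck_on k UNIV (\<lambda>p::point. Re (snd (snd p)))"
    "Ck_on k UNIV (\<lambda>p::point. Im (snd (snd p)))" for k
    by (intro Ck_on_linear[OF open_UNIV] bounded_linear_compose[OF bounded_linear_Re]
        bounded_linear_compose[OF bounded_linear_Im] bounded_linear_compose[OF bounded_linear_fst]
        bounded_linear_compose[OF bounded_linear_snd] bounded_linear_fst bounded_linear_snd)+
  have sq: "Ck_on k UNIV (\<lambda>p::point. sq_abs (fst (fst (snd p))))"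
    "Ck_on k UNIV (\<lambda>p::point. sq_abs (snd (fst (snd p))))"
    "Ck_on k UNIV (\<lambda>p::point. sq_abs (snd (snd p)))" for k
    unfolding sq_abs_def by (intro sm lin)+
  have rf: "Ck_on k UNIV (radial_f b)" for k
    unfolding radial_f_def by (intro sm sq)
  have ang: "Ck_on k UNIV (\<lambda>p::point. angular (fst (fst (snd p))) z)"
    "Ck_on k UNIV (\<lambda>p::point. angular (snd (fst (snd p))) z)"
    "Ck_on k UNIV (\<lambda>p::point. angular (snd (snd p)) z)" for k z
    unfolding angular_def diff_conv_add_uminus mult_minus_right[symmetric] by (intro sm lin)+
  show ?thesis
    unfolding smooth_on_def extended_form_def Let_def b_def[symmetric]
    by (intro allI sm sq rf ang pos)
qed

lemma has_derivative_Complex: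
  assumes "(f has_derivative f') F" "(g has_derivative g') F"
  shows "((\<lambda>y. Complex (f y) (g y)) has_derivative (\<lambda>y. Complex (f' y) (g' y))) F"
  unfolding Complex_eq
  by (intro has_derivative_add has_derivative_mult_right
      bounded_linear.has_derivative[OF bounded_linear_of_real] assms)

lemma coord_map_derivative:
  fixes q v :: "real^ix"
  assumes Rz: "Rz > 0"
  shows "frechet_derivative (coord_map Rz) (at q) v =
     (v $ Time,
      (Complex (cos (q $ Space Theta) * v $ Space Theta) (sin (q $ Space Theta) * v $ Space Phi)
         * cis (q $ Space Phi),
       Complex (- sin (q $ Space Theta) * v $ Space Theta)
           (cos (q $ Space Theta) * (v $ Space Psi - v $ Space Zed / Rz))
         * cis (q $ Space Psi - q $ Space Zed / Rz)),
      Complex (v $ Space Rad) (q $ Space Rad * (v $ Space Zed / Rz)) * cis (q $ Space Zed / Rz))"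
    (is "_ = ?D v")
proof -
  have n: "((\<lambda>q::real^ix. q $ i) has_derivative (\<lambda>v. v $ i)) (at q)" for i
    by (rule bounded_linear_imp_has_derivative) (rule bounded_linear_vec_nth)
  have z: "((\<lambda>q::real^ix. q $ Space Zed / Rz) has_derivative (\<lambda>v. v $ Space Zed / Rz)) (at q)"
    using has_derivative_mult_right[OF n, of "1 / Rz"] by simp
  have p: "((\<lambda>q::real^ix. q $ Space Psi - q $ Space Zed / Rz) has_derivative
      (\<lambda>v. v $ Space Psi - v $ Space Zed / Rz)) (at q)"
    by (intro has_derivative_diff n z)
  have c: "coord_map Rz = (\<lambda>q. (q $ Time,
     (Complex (sin (q $ Space Theta) * cos (q $ Space Phi)) (sin (q $ Space Theta) * sin (q $ Space Phi)),
      Complex (cos (q $ Space Theta) * cos (q $ Space Psi - q $ Space Zed / Rz))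
              (cos (q $ Space Theta) * sin (q $ Space Psi - q $ Space Zed / Rz))),
      Complex (q $ Space Rad * cos (q $ Space Zed / Rz)) (q $ Space Rad * sin (q $ Space Zed / Rz))))"
    by (rule ext) (simp add: coord_map_def Let_def complex_eq_iff)
  have "(coord_map Rz has_derivative ?D) (at q)"
    unfolding c
    by (rule has_derivative_eq_rhs,
        (rule has_derivative_Pair has_derivative_Complex has_derivative_mult
          has_derivative_sin has_derivative_cos n z p)+)
       (simp add: fun_eq_iff complex_eq_iff algebra_simps)
  from fun_cong[OF frechet_derivative_at[OF this], of v] show ?thesis by (rule sym)
qed

lemma angular_polar: "angular (of_real s * cis \<alpha>) (Complex x y * cis \<alpha>) = s * y"
  by (simp add: angular_def, use sin_cos_squared_add[of \<alpha>] in algebra)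

lemma sq_abs_polar: "sq_abs (of_real s * cis \<alpha>) = s\<^sup>2"
  by (simp add: sq_abs_def, use sin_cos_squared_add[of \<alpha>] in algebra)

lemma inner_polar:
  "inner (Complex x y * cis \<alpha>) (Complex x' y' * cis \<alpha>) = x * x' + y * y'"
  by (simp add: inner_complex_def, use sin_cos_squared_add[of \<alpha>] in algebra)

lemma extended_form_pullback:
  fixes q v w :: "real^ix"
  assumes Q: "Q1 > 0" "Q2 > 0" and Rz: "Rz > 0"
    and r: "q $ Space Rad > 0" and \<theta>: "q $ Space Theta \<in> {0<..<pi/2}"
  shows "extended_form Q1 Q2 Rz (coord_map Rz q) (frechet_derivative (coord_map Rz) (at q) v)
          (frechet_derivative (coord_map Rz) (at q) w) = metric_form Q1 Q2 Rz q v w"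
proof -
  define b where "b = Q1 * Q2 / Rz\<^sup>2"
  define r where "r = q $ Space Rad"
  define s where "s = sin (q $ Space Theta)"
  define c where "c = cos (q $ Space Theta)"
  define f where "f = r\<^sup>2 + b * c\<^sup>2"
  define KK where "KK = (f + Q1) * (f + Q2)"
  define K where "K = sqrt KK"
  define h where "h = sqrt ((1 + Q1 / f) * (1 + Q2 / f))"
  have b: "b > 0" using assms by (simp add: b_def)
  have rp: "r > 0" using r by (simp add: r_def)
  have f: "f > 0" using b rp by (simp add: f_def add_pos_nonneg)
  have KK: "KK > 0" using f Q by (simp add: KK_def)
  have K: "K > 0" "K\<^sup>2 = KK" using KK by (simp_all add: K_def)
  have Kp: "KK powr (1/2) = K" "KK powr (-(1/2)) = 1 / K"
    using KK by (simp_all add: K_def powr_half_sqrt powr_minus_divide)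
  have "(1 + Q1 / f) * (1 + Q2 / f) = KK / f\<^sup>2"
    using f by (simp add: KK_def field_simps power2_eq_square)
  then have h: "h = K / f" using f by (simp add: h_def K_def real_sqrt_divide)
  have a2: "(sqrt (Q1 * Q2) / Rz)\<^sup>2 = b"
    using Q by (simp add: b_def power_divide)
  have aQ: "sqrt (Q1 * Q2) / Rz * sqrt (Q1 * Q2) = Q1 * Q2 / Rz"
    using Q by (simp add: field_simps)
  have sc: "s\<^sup>2 = 1 - c\<^sup>2" by (simp add: s_def c_def sin_squared_eq)
  have QQ: "Q1 * Q2 = b * Rz\<^sup>2" using Rz by (simp add: b_def)
  define P where "P = f + (Q1 + Q2)"
  define D where "D = r\<^sup>2 + b"
  have D: "D > 0" using b by (simp add: D_def add_nonneg_pos)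
  have PK: "KK = P * f + b * Rz\<^sup>2"
    unfolding KK_def P_def QQ[symmetric] by algebra
  define vx where "vx = v $ Space Zed / Rz"
  define wx where "wx = w $ Space Zed / Rz"
  have vz: "v $ Space Zed = Rz * vx" "w $ Space Zed = Rz * wx"
    using Rz by (simp_all add: vx_def wx_def)
  define vt where "vt = v $ Time"
  define wt where "wt = w $ Time"
  define vr where "vr = v $ Space Rad"
  define wr where "wr = w $ Space Rad"
  define vh where "vh = v $ Space Theta"
  define wh where "wh = w $ Space Theta"
  define vp where "vp = v $ Space Phi"
  define wp where "wp = w $ Space Phi"
  define vs where "vs = v $ Space Psi"
  define ws where "ws = w $ Space Psi"
  note comp = vt_def wt_def vr_def wr_def vh_def wh_def vp_def wp_def vs_def ws_def
  have rf: "radial_f b (coord_map Rz q) = f"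
    by (simp add: radial_f_def coord_map_def Let_def sq_abs_polar f_def r_def c_def)
  have Dp: "(r\<^sup>2 + b) powr (-1) = 1 / D"
    using D by (simp add: D_def powr_minus_divide)
  have L: "extended_form Q1 Q2 Rz (coord_map Rz q) (frechet_derivative (coord_map Rz) (at q) v)
          (frechet_derivative (coord_map Rz) (at q) w) =
      (-1) * (f * (1 / K) * (vt * wt))
      + K * ((c * vh * (c * wh) + s * vp * (s * wp))
           + (- s * vh * (- s * wh) + c * (vs - vx) * (c * (ws - wx))))
      + K * (1 / D) * (vr * wr + r * vx * (r * wx))
      + P * (1 / K) * (b * (s * (s * vp) * (s * (s * wp)))
           + (-b) * (c * (c * (vs - vx)) * (c * (c * (ws - wx))))
           + (r * (r * vx) * (c * (c * (ws - wx))) + r * (r * wx) * (c * (c * (vs - vx)))))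
      + (Rz\<^sup>2 + (-1) * (s\<^sup>2 * P)) * (1 / K * (1 / D)) * (r * (r * vx) * (r * (r * wx)))
      + (-(Q1 * Q2 / Rz)) * (1 / K * (s * (s * vp) * wt + s * (s * wp) * vt))"
    unfolding extended_form_def Let_def b_def[symmetric] rf KK_def[symmetric] Kp P_def[symmetric]
    unfolding coord_map_derivative[OF Rz] coord_map_def Let_def fst_conv snd_conv angular_polar sq_abs_polar
      inner_Pair inner_polar Dp r_def[symmetric] s_def[symmetric] c_def[symmetric]
      comp[symmetric] vx_def[symmetric] wx_def[symmetric]
    by (rule refl)
  have hf: "h * f = K" "1 / h = f / K" "h\<^sup>2 * f\<^sup>2 = KK"
    using f K by (simp_all add: h field_simps power2_eq_square)
  have R: "metric_form Q1 Q2 Rz q v w =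
      - (f / K) * (vt * wt - Rz * vx * (Rz * wx)) + K * (vh * wh + vr * wr / D)
      - 2 * (b * Rz) / K * (c\<^sup>2 * ((Rz * vx * ws + vs * (Rz * wx)) / 2) + s\<^sup>2 * ((vt * wp + vp * wt) / 2))
      + K / f * ((r\<^sup>2 + b * (b * Rz\<^sup>2) * c\<^sup>2 / KK) * c\<^sup>2 * (vs * ws)
           + (r\<^sup>2 + b - b * (b * Rz\<^sup>2) * s\<^sup>2 / KK) * s\<^sup>2 * (vp * wp))"
  proof -
    have m: "2 * (sqrt (Q1 * Q2) / Rz) * sqrt (Q1 * Q2) = 2 * (b * Rz)"
    proof -
      have "Q1 * Q2 / Rz = b * Rz" using QQ Rz by (simp add: power2_eq_square)
      then show ?thesis unfolding mult.assoc aQ by simp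
    qed
    have m': "b * Q1 * Q2 = b * (b * Rz\<^sup>2)" using QQ by simp
    show ?thesis
      unfolding metric_form_def Let_def a2 r_def[symmetric] c_def[symmetric] s_def[symmetric]
        f_def[symmetric] h_def[symmetric] hf m m' sym_prod_def comp[symmetric] vz D_def[symmetric]
        h[symmetric]
      by (simp add: algebra_simps)
  qed
  have nz: "K \<noteq> 0" "f \<noteq> 0" "D \<noteq> 0" "K * K = KK" "KK \<noteq> 0"
    using K f D KK by (simp_all add: power2_eq_square)
  have KP: "K * K = P * f + b * Rz\<^sup>2" using nz(4) PK by simp
  have fD: "f = D - b * s\<^sup>2" "f = r\<^sup>2 + b * c\<^sup>2" by (simp_all add: f_def D_def sc algebra_simps)
  have phi: "K * s\<^sup>2 + P * b * s\<^sup>2 * s\<^sup>2 / K = K / f * (r\<^sup>2 + b - b * (b * Rz\<^sup>2) * s\<^sup>2 / KK) * s\<^sup>2"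
  proof -
    have "(K * K + P * b * s\<^sup>2) * f = K * K * D - b * (b * Rz\<^sup>2) * s\<^sup>2"
      unfolding KP fD(1) by algebra
    then show ?thesis
      unfolding nz(4)[symmetric] D_def[symmetric] using nz(1-3) by (simp add: divide_simps) algebra
  qed
  have psi: "K * c\<^sup>2 - P * b * c\<^sup>2 * c\<^sup>2 / K = K / f * (r\<^sup>2 + b * (b * Rz\<^sup>2) * c\<^sup>2 / KK) * c\<^sup>2"
  proof -
    have "(K * K - P * b * c\<^sup>2) * f = K * K * r\<^sup>2 + b * (b * Rz\<^sup>2) * c\<^sup>2"
      unfolding KP fD(2) by algebra
    then show ?thesis
      unfolding nz(4)[symmetric] using nz(1-3) by (simp add: divide_simps) algebra
  qed
  have mix: "- K * c\<^sup>2 + P * b * c\<^sup>2 * c\<^sup>2 / K + P * r\<^sup>2 * c\<^sup>2 / K = - (b * Rz\<^sup>2 * c\<^sup>2 / K)"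
  proof -
    have "- (K * K) * c\<^sup>2 + P * b * c\<^sup>2 * c\<^sup>2 + P * r\<^sup>2 * c\<^sup>2 = - (b * Rz\<^sup>2 * c\<^sup>2)"
      unfolding KP fD(2) by algebra
    then show ?thesis
      using nz(1) by (simp add: divide_simps) algebra
  qed
  have zed: "K * c\<^sup>2 - P * b * c\<^sup>2 * c\<^sup>2 / K - 2 * P * r\<^sup>2 * c\<^sup>2 / K + K * r\<^sup>2 / D
     + (Rz\<^sup>2 - s\<^sup>2 * P) * r\<^sup>2 * r\<^sup>2 / (K * D) = f * Rz\<^sup>2 / K"
  proof -
    have "((K * K) * c\<^sup>2 - P * b * c\<^sup>2 * c\<^sup>2 - 2 * P * r\<^sup>2 * c\<^sup>2) * D + K * K * r\<^sup>2
       + (Rz\<^sup>2 - s\<^sup>2 * P) * r\<^sup>2 * r\<^sup>2 = f * Rz\<^sup>2 * D"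
      unfolding KP fD(2) D_def sc by algebra
    then show ?thesis
      using nz(1,3) by (simp add: divide_simps) algebra
  qed
  define kk where "kk = inverse K"
  define dd where "dd = inverse D"
  define gg where "gg = K * inverse f"
  have "extended_form Q1 Q2 Rz (coord_map Rz q) (frechet_derivative (coord_map Rz) (at q) v)
          (frechet_derivative (coord_map Rz) (at q) w) =
     - (f / K) * (vt * wt) + K * (c\<^sup>2 + s\<^sup>2) * (vh * wh) + K / D * (vr * wr)
     + (K * s\<^sup>2 + P * b * s\<^sup>2 * s\<^sup>2 / K) * (vp * wp)
     + (K * c\<^sup>2 - P * b * c\<^sup>2 * c\<^sup>2 / K) * (vs * ws)
     + (- K * c\<^sup>2 + P * b * c\<^sup>2 * c\<^sup>2 / K + P * r\<^sup>2 * c\<^sup>2 / K) * (vs * wx + vx * ws)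
     + (K * c\<^sup>2 - P * b * c\<^sup>2 * c\<^sup>2 / K - 2 * P * r\<^sup>2 * c\<^sup>2 / K + K * r\<^sup>2 / D
         + (Rz\<^sup>2 - s\<^sup>2 * P) * r\<^sup>2 * r\<^sup>2 / (K * D)) * (vx * wx)
     - Q1 * Q2 / Rz * s\<^sup>2 / K * (vp * wt + wp * vt)"
    unfolding L divide_inverse inverse_mult_distrib kk_def[symmetric] dd_def[symmetric] mult_1_left
    by algebra
  also have "\<dots> = metric_form Q1 Q2 Rz q v w"
  proof -
    have c1: "c\<^sup>2 + s\<^sup>2 = 1" by (simp add: sc)
    have q: "Q1 * Q2 / Rz = b * Rz" using QQ Rz by (simp add: power2_eq_square)
    have "- (f * kk) * (vt * wt) + K * 1 * (vh * wh) + K * dd * (vr * wr)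
       + gg * Y * s\<^sup>2 * (vp * wp) + gg * X * c\<^sup>2 * (vs * ws)
       + - (b * Rz\<^sup>2 * c\<^sup>2 * kk) * (vs * wx + vx * ws)
       + f * Rz\<^sup>2 * kk * (vx * wx) - b * Rz * s\<^sup>2 * kk * (vp * wt + wp * vt) =
      - (f * kk) * (vt * wt - Rz * vx * (Rz * wx)) + K * (vh * wh + vr * wr * dd)
      - 2 * (b * Rz) * kk * (c\<^sup>2 * ((Rz * vx * ws + vs * (Rz * wx)) * inverse 2)
          + s\<^sup>2 * ((vt * wp + vp * wt) * inverse 2))
      + gg * (X * c\<^sup>2 * (vs * ws) + Y * s\<^sup>2 * (vp * wp))" for X Y
      by (simp add: field_simps power2_eq_square)
    then show ?thesis
      unfolding zed
      unfolding phi psi mix R c1 q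
      unfolding divide_inverse kk_def dd_def gg_def .
  qed
  finally show ?thesis .
qed

lemma two_charge_metric_exists:
  assumes "Q1 > 0" "Q2 > 0" "Rz > 0"
  shows "\<exists>g. two_charge_metric Q1 Q2 Rz g"
proof
  have a: "bounded_linear (\<lambda>v. angular z (h v))" if "bounded_linear h" for z and h :: "point \<Rightarrow> complex"
    unfolding angular_def
    by (intro bounded_linear_sub bounded_linear_const_mult bounded_linear_compose[OF bounded_linear_Re that]
        bounded_linear_compose[OF bounded_linear_Im that])
  have p: "bounded_linear (\<lambda>v::point. fst v)" "bounded_linear (\<lambda>v::point. fst (snd v))"
    "bounded_linear (\<lambda>v::point. snd (snd v))" "bounded_linear (\<lambda>v::point. fst (fst (snd v)))"
    "bounded_linear (\<lambda>v::point. snd (fst (snd v)))"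
    by (intro bounded_linear_compose[OF bounded_linear_fst] bounded_linear_compose[OF bounded_linear_snd]
        bounded_linear_fst bounded_linear_snd)+
  have "bilinear (extended_form Q1 Q2 Rz p)" for p
    unfolding bilinear_def extended_form_def Let_def
    by (intro allI conjI;
        rule bounded_linear.linear,
        (rule p a[OF p(3)] a[OF p(4)] a[OF p(5)] bounded_linear_add bounded_linear_const_mult
          bounded_linear_mult_const bounded_linear_compose[OF bounded_linear_inner_right p(2)]
          bounded_linear_compose[OF bounded_linear_inner_right p(3)]
          bounded_linear_compose[OF bounded_linear_inner_left p(2)]
          bounded_linear_compose[OF bounded_linear_inner_left p(3)])+)
  moreover have "smooth_on_submanifold spacetime (\<lambda>p. extended_form Q1 Q2 Rz p v w)" for v w
    using smooth_extended_form[OF assms] unfolding smooth_on_submanifold_def by blast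
  ultimately show "two_charge_metric Q1 Q2 Rz (extended_form Q1 Q2 Rz)"
    using extended_form_pullback[OF assms] by (simp add: two_charge_metric_def)
qed

end

theory Submission
  imports Defs
begin

text \<open>The field \<open>T\<close> is causal, and null only on the locus \<open>f = 0\<close>, that is \<open>r = 0\<close>, \<open>\<theta> = \<pi>/2\<close>. So the
  conserved \<open>T\<close>-energy is nonnegative and controls all derivatives of \<open>u\<close> except, near that locus,
  the one along \<open>\<Phi>\<close>, which enters with a coefficient proportional to \<open>f \<ge> r\<^sup>2\<close>. Since \<open>\<Phi>\<close> is Killing,
  \<open>\<Phi> u\<close> solves the wave equation too, and its \<open>T\<close>-energy controls \<open>\<partial>\<^sub>r \<Phi> u\<close>. A Hardy inequality in
  \<open>r\<close> bounds the weighted \<open>L\<^sup>2\<close> norm of \<open>\<Phi> u\<close> by the \<open>T\<close>-energies of \<open>u\<close> and of \<open>\<Phi> u\<close>.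

  The composition of \<open>u\<close> with the coordinate map is smooth on the whole coordinate space and
  periodic in the angles, and the boundary fluxes of the energy through \<open>r = \<epsilon>\<close>, \<open>\<theta> = \<epsilon>\<close> and
  \<open>\<theta> = \<pi>/2 - \<epsilon>\<close> are \<open>O(\<epsilon>)\<close>. So the degenerate coordinates do no harm.\<close>

section \<open>Smooth functions of the coordinates\<close>

text \<open>Square roots enter the metric only through \<open>K\<close>: the volume factor is
  \<open>K r sin \<theta> cos \<theta>\<close>, and the inverse metric is \<open>1 / K\<close> times
  rational functions of r, sin and cos. In the product \<open>K\<close> cancels, so the wave
  equation, the energy and the fluxes become polynomial identities against the weight
  \<open>wt\<close>. The defect of the T-energy is explicit. From
  \<open>1 / sin^2 = f / (D sin^2) + (qq / Rz^2) / D\<close> one sees that, up to comparable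
  weights, the full energy exceeds the T-energy by a multiple of \<open>(\<Phi> u)^2 / D\<close>
  only. For r at least 1 even this is controlled by the T-energy, so the Hardy inequality is needed
  on the unit interval alone. The energy comparison is made on boxes that avoid the degenerate loci,
  with a cutoff that vanishes on the outer face. The boxes are then exhausted and the cutoff is
  removed by Fatou's lemma, so that neither decay nor finiteness of the energy at the later time has
  to be known beforehand.\<close>

lemma Ck_on_subset: "T \<subseteq> S \<Longrightarrow> Ck_on k S f \<Longrightarrow> Ck_on k T f"
  by (induction k arbitrary: f) (auto intro: continuous_on_subset)

text \<open>The derivatives in \<open>Ck_on\<close> are taken in the full space, so the induction
  never depends on the set, and continuity is local on open sets. This turns the local extensions in
  \<open>smooth_on_submanifold\<close> into global smoothness.\<close>

lemma Ck_on_local: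
  "(\<And>x. x \<in> S \<Longrightarrow> \<exists>T. open T \<and> x \<in> T \<and> Ck_on k T f) \<Longrightarrow> Ck_on k S f"
proof (induction k arbitrary: f)
  case 0
  show ?case
    unfolding Ck_on.simps
  proof (rule continuous_at_imp_continuous_on, rule ballI)
    fix x assume "x \<in> S"
    from 0[OF this] show "isCont f x"
      by (auto simp: continuous_on_eq_continuous_at)
  qed
next
  case (Suc k)
  show ?case
    unfolding Ck_on.simps
  proof (intro conjI ballI allI)
    fix x assume "x \<in> S"
    from Suc.prems[OF this] show "f differentiable at x" by auto
  next
    fix v
    show "Ck_on k S (\<lambda>x. frechet_derivative f (at x) v)"
      by (rule Suc.IH) (use Suc.prems in fastforce)
  qed
qed

lemma Ck_on_bounded_linear:
  assumes S: "open S" and L: "bounded_linear L"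
  shows "Ck_on k S f \<Longrightarrow> Ck_on k S (\<lambda>x. L (f x))"
proof (induction k arbitrary: f)
  case 0
  then show ?case
    using bounded_linear.continuous_on[OF L] by simp
next
  case (Suc k)
  show ?case
    by (rule Ck_on_SucI[OF S bounded_linear.has_derivative[OF L Ck_on_SucD]])
       (use Suc in auto)
qed

lemma Ck_on_sum:
  assumes "open S" "finite I" "\<And>i. i \<in> I \<Longrightarrow> Ck_on k S (f i)"
  shows "Ck_on k S (\<lambda>x. \<Sum>i\<in>I. f i x)"
  using assms(2,3) by (induction I) (auto intro!: Ck_on_const Ck_on_add assms(1))

text \<open>The chain rule gives a derivative of \<open>F\<close> in a direction that varies with
  the point. Expanding this direction in an orthonormal basis leaves products of scalar functions,
  one factor being a derivative of \<open>F\<close> in a fixed direction composed with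
  \<open>\<sigma>\<close>; the induction over all \<open>F\<close> applies to it.\<close>

lemma Ck_on_compose:
  fixes \<sigma> :: "'a::real_normed_vector \<Rightarrow> 'c::euclidean_space" and F :: "'c \<Rightarrow> real"
  assumes S: "open S" and W: "open W" and sub: "\<And>x. x \<in> S \<Longrightarrow> \<sigma> x \<in> W"
  shows "Ck_on k S \<sigma> \<Longrightarrow> Ck_on k W F \<Longrightarrow> Ck_on k S (\<lambda>x. F (\<sigma> x))"
proof (induction k arbitrary: F)
  case 0
  then show ?case using sub by (auto intro: continuous_on_compose2)
next
  case (Suc k)
  have \<sigma>k: "Ck_on k S \<sigma>" using Suc.prems(1) Ck_on_Suc_imp by blast
  show ?case
  proof (rule Ck_on_SucI[OF S])
    fix x assume x: "x \<in> S"
    have dF: "(F has_derivative frechet_derivative F (at (\<sigma> x))) (at (\<sigma> x))"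
      using Ck_on_SucD[OF Suc.prems(2) sub[OF x]] .
    interpret F: bounded_linear "frechet_derivative F (at (\<sigma> x))"
      using dF by (rule has_derivative_bounded_linear)
    have e: "frechet_derivative F (at (\<sigma> x)) w =
       (\<Sum>b\<in>Basis. inner w b * frechet_derivative F (at (\<sigma> x)) b)" for w
    proof -
      have "frechet_derivative F (at (\<sigma> x)) w
        = frechet_derivative F (at (\<sigma> x)) (\<Sum>b\<in>Basis. inner w b *\<^sub>R b)"
        by (simp add: euclidean_representation)
      then show ?thesis by (simp add: F.sum F.scaleR)
    qed
    show "((\<lambda>x. F (\<sigma> x)) has_derivative (\<lambda>v. \<Sum>b\<in>Basis.
        inner (frechet_derivative \<sigma> (at x) v) b * frechet_derivative F (at (\<sigma> x)) b)) (at x)"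
      by (rule has_derivative_eq_rhs[OF has_derivative_compose[OF Ck_on_SucD[OF Suc.prems(1) x] dF]])
        (rule ext, rule e)
  next
    fix v
    show "Ck_on k S (\<lambda>x. \<Sum>b\<in>Basis.
        inner (frechet_derivative \<sigma> (at x) v) b * frechet_derivative F (at (\<sigma> x)) b)"
      using Suc.prems
      by (auto intro!: Ck_on_sum[OF S] Ck_on_mult[OF S] Suc.IH[OF \<sigma>k]
          Ck_on_bounded_linear[OF S bounded_linear_inner_left])
  qed
qed

text \<open>The two functions go through the induction together, because each is up to sign the
  derivative of the other.\<close>

lemma Ck_on_sin_cos:
  fixes l :: "'a::real_normed_vector \<Rightarrow> real"
  assumes S: "open S" and l: "bounded_linear l"
  shows "Ck_on k S (\<lambda>x. sin (l x)) \<and> Ck_on k S (\<lambda>x. cos (l x))"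
proof (induction k)
  case 0
  then show ?case
    by (auto intro!: continuous_intros bounded_linear.continuous_on[OF l])
next
  case (Suc k)
  have d: "(l has_derivative l) (at x)" for x
    using l by (rule bounded_linear_imp_has_derivative)
  have D: "((\<lambda>x. sin (l x)) has_derivative (\<lambda>v. l v * cos (l x))) (at x)"
    "((\<lambda>x. cos (l x)) has_derivative (\<lambda>v. (- l v) * sin (l x))) (at x)" for x
    by (auto intro!: derivative_eq_intros d)
  show ?case
    using Suc
    by (intro conjI Ck_on_SucI[OF S D(1)] Ck_on_SucI[OF S D(2)] Ck_on_mult[OF S] Ck_on_const[OF S]) auto
qed

lemma Ck_on_coord_map: "Ck_on k UNIV (coord_map Rz)"
proof -
  have v: "bounded_linear (\<lambda>q::real^ix. q $ i)" for i by (rule bounded_linear_vec_nth)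
  have zl: "bounded_linear (\<lambda>q::real^ix. q $ Space Zed / Rz)"
    using bounded_linear_compose[OF bounded_linear_divide v] .
  have pl: "bounded_linear (\<lambda>q::real^ix. q $ Space Psi - q $ Space Zed / Rz)"
    by (intro bounded_linear_sub v zl)
  note sc = Ck_on_sin_cos[OF open_UNIV v] Ck_on_sin_cos[OF open_UNIV zl] Ck_on_sin_cos[OF open_UNIV pl]
  have R: "Ck_on k UNIV (\<lambda>x. h x *\<^sub>R (c::point))" if "Ck_on k UNIV h" for h :: "real^ix \<Rightarrow> real" and c
    using Ck_on_bounded_linear[OF open_UNIV bounded_linear_scaleR_left that] .
  \<comment> \<open>Real functions times fixed vectors, so that the product rule for real functions
    suffices.\<close>
  have c: "coord_map Rz = (\<lambda>q. q $ Time *\<^sub>R (1,(0,0),0)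
     + (sin (q $ Space Theta) * cos (q $ Space Phi)) *\<^sub>R (0,(1,0),0)
     + (sin (q $ Space Theta) * sin (q $ Space Phi)) *\<^sub>R (0,(\<i>,0),0)
     + (cos (q $ Space Theta) * cos (q $ Space Psi - q $ Space Zed / Rz)) *\<^sub>R (0,(0,1),0)
     + (cos (q $ Space Theta) * sin (q $ Space Psi - q $ Space Zed / Rz)) *\<^sub>R (0,(0,\<i>),0)
     + (q $ Space Rad * cos (q $ Space Zed / Rz)) *\<^sub>R (0,(0,0),1)
     + (q $ Space Rad * sin (q $ Space Zed / Rz)) *\<^sub>R (0,(0,0),\<i>))"
    by (rule ext) (simp add: coord_map_def Let_def complex_eq_iff)
  show ?thesis
    unfolding c
    by (intro Ck_on_add[OF open_UNIV] R Ck_on_mult[OF open_UNIV] Ck_on_linear[OF open_UNIV v]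
        sc[THEN conjunct1] sc[THEN conjunct2])
qed

lemma coord_map_in_spacetime: "coord_map Rz q \<in> spacetime"
proof -
  have "(norm (sin (q $ Space Theta)))\<^sup>2 + (norm (cos (q $ Space Theta)))\<^sup>2 = 1"
    by simp
  then show ?thesis
    by (simp add: coord_map_def Let_def spacetime_def norm_Pair norm_mult)
qed

text \<open>The coordinate map is smooth and takes values in \<open>spacetime\<close> at every
  \<open>q\<close>, also where it fails to be an immersion. Hence the composite is smooth across the
  degenerate loci, which is what bounds the fluxes there.\<close>

lemma smooth_comp_coord_map:
  fixes u :: "point \<Rightarrow> real"
  assumes "smooth_on_submanifold spacetime u"
  shows "smooth_on UNIV (u \<circ> coord_map Rz)"
  unfolding smooth_on_def
proof (intro allI Ck_on_local)
  fix k and q :: "real^ix"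
  obtain W F where W: "open W" "coord_map Rz q \<in> W" "smooth_on W F"
      and F: "\<And>y. y \<in> W \<inter> spacetime \<Longrightarrow> F y = u y"
    using bspec[OF assms[unfolded smooth_on_submanifold_def] coord_map_in_spacetime[of Rz q]] by metis
  define T where "T = coord_map Rz -` W"
  have "continuous_on UNIV (coord_map Rz)"
    using Ck_on_coord_map[of 0 Rz] by simp
  then have T: "open T"
    using W(1) by (simp add: T_def open_vimage)
  have "Ck_on k T (\<lambda>x. F (coord_map Rz x))"
    by (rule Ck_on_compose[OF T W(1)])
      (use W(3) in \<open>auto simp: T_def smooth_on_def intro: Ck_on_subset[OF subset_UNIV Ck_on_coord_map]\<close>)
  then have "Ck_on k T (u \<circ> coord_map Rz)"
    by (rule Ck_on_cong[OF T, rotated]) (auto simp: T_def F coord_map_in_spacetime)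
  then show "\<exists>T. open T \<and> q \<in> T \<and> Ck_on k T (u \<circ> coord_map Rz)"
    using T W(2) by (auto simp: T_def)
qed

lemma smooth_on_has_derivative:
  assumes "smooth_on UNIV F"
  shows "(F has_derivative frechet_derivative F (at q)) (at q)"
  using assms Ck_on_SucD[of 0 UNIV F q] unfolding smooth_on_def by blast

lemma smooth_partial:
  assumes "smooth_on UNIV F"
  shows "smooth_on UNIV (partial i F)"
  unfolding smooth_on_def
proof
  fix k
  have "Ck_on (Suc k) UNIV F" using assms unfolding smooth_on_def by blast
  then show "Ck_on k UNIV (partial i F)" by (simp add: partial_def[abs_def])
qed

lemma smooth_continuous: "smooth_on UNIV F \<Longrightarrow> continuous_on S F"
  unfolding smooth_on_def using Ck_on.simps(1) continuous_on_subset subset_UNIV by blast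

lemma partial_along_line:
  fixes F :: "real^'n::finite \<Rightarrow> real"
  assumes "smooth_on UNIV F"
  shows "((\<lambda>s. F (q + s *\<^sub>R axis i 1)) has_real_derivative partial i F (q + s *\<^sub>R axis i 1)) (at s within S)"
proof -
  let ?D = "frechet_derivative F (at (q + s *\<^sub>R axis i 1))"
  interpret D: bounded_linear ?D
    using smooth_on_has_derivative[OF assms] by (rule has_derivative_bounded_linear)
  have "((\<lambda>s. q + s *\<^sub>R axis i 1) has_derivative (\<lambda>h. h *\<^sub>R axis i 1)) (at s within S)"
    by (auto intro!: derivative_eq_intros)
  from has_derivative_compose[OF this smooth_on_has_derivative[OF assms]]
  show ?thesis
    unfolding has_field_derivative_def partial_def by (simp add: D.scaleR mult.commute[of _ "?D _"])
qed

text \<open>Differentiate \<open>F (x, y) = F (-1, y) + \<integral> F\<^sub>x\<close> under the integral sign.\<close>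

lemma partial_commute:
  fixes F :: "real^'n::finite \<Rightarrow> real"
  assumes F: "smooth_on UNIV F"
  shows "partial i (partial j F) q = partial j (partial i F) q"
proof -
  define p where "p x y = q + x *\<^sub>R axis j (1::real) + y *\<^sub>R axis i 1" for x y
  note sj = smooth_partial[OF F, of j] and si = smooth_partial[OF F, of i]
  note sij = smooth_partial[OF sj, of i] and sji = smooth_partial[OF si, of j]
  have px: "((\<lambda>x. H (p x y)) has_real_derivative partial j H (p x y)) (at x within S)"
    if "smooth_on UNIV H" for H x y S
    using partial_along_line[OF that, of "q + y *\<^sub>R axis i 1" j x S] by (simp add: p_def add_ac)
  have py: "((\<lambda>y. H (p x y)) has_real_derivative partial i H (p x y)) (at y within S)"
    if "smooth_on UNIV H" for H x y S
    using partial_along_line[OF that, of "q + x *\<^sub>R axis j 1" i y S] by (simp add: p_def add_ac)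
  have pc: "continuous_on S (\<lambda>z. H (p (f z) (g z)))"
    if "smooth_on UNIV H" "continuous_on S f" "continuous_on S g" for H S and f g :: "'c::topological_space \<Rightarrow> real"
    by (rule continuous_on_compose2[OF smooth_continuous[OF that(1), of UNIV]])
      (auto simp: p_def intro!: continuous_intros that(2,3))
  have ftc: "F (p x y) = F (p (-1) y) + integral (cbox (-1) x) (\<lambda>s. partial j F (p s y))"
    if "x \<ge> -1" for x y
  proof -
    have "((\<lambda>s. partial j F (p s y)) has_integral (F (p x y) - F (p (-1) y))) {-1..x}"
      by (rule fundamental_theorem_of_calculus[OF that])
        (use px[OF F] in \<open>auto simp: has_real_derivative_iff_has_vector_derivative\<close>)
    then show ?thesis by (simp add: integral_unique)
  qed
  have h: "partial i F (p x 0) = partial i F (p (-1) 0)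
      + integral {-1..x} (\<lambda>s. partial i (partial j F) (p s 0))" if "x \<ge> -1" for x
  proof -
    have "((\<lambda>y. integral (cbox (-1) x) (\<lambda>s. partial j F (p s y))) has_field_derivative
        integral (cbox (-1) x) (\<lambda>s. partial i (partial j F) (p s 0))) (at 0 within UNIV)"
      by (rule leibniz_rule_field_derivative)
        (auto intro!: py[OF sj] integrable_continuous_real pc[OF sj] pc[OF sij] continuous_intros
          simp: case_prod_unfold)
    then have "((\<lambda>y. F (p x y)) has_field_derivative partial i F (p (-1) 0)
        + integral (cbox (-1) x) (\<lambda>s. partial i (partial j F) (p s 0))) (at 0)"
      unfolding ftc[OF that] by (intro DERIV_add py[OF F]) simp
    from DERIV_unique[OF py[OF F] this] show ?thesis by simp
  qed
  \<comment> \<open>Now \<open>h\<close> is differentiated in x at 0. Because the integral starts at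
    -1, the point 0 is interior and the derivative is two-sided.\<close>
  have "((\<lambda>x. integral {-1..x} (\<lambda>s. partial i (partial j F) (p s 0))) has_real_derivative
      partial i (partial j F) (p 0 0)) (at 0 within {-1..1})"
    by (rule integral_has_real_derivative) (auto intro!: pc[OF sij] continuous_intros)
  then have "((\<lambda>x. partial i F (p (-1) 0) + integral {-1..x} (\<lambda>s. partial i (partial j F) (p s 0)))
      has_real_derivative partial i (partial j F) (p 0 0)) (at 0 within {-1..1})"
    using DERIV_add[OF DERIV_const] by fastforce
  then have "((\<lambda>x. partial i F (p x 0)) has_real_derivative partial i (partial j F) (p 0 0))
      (at 0 within {-1..1})"
    by (rule has_field_derivative_transform_within[where d=1]) (auto simp: h[symmetric])
  then have "((\<lambda>x. partial i F (p x 0)) has_real_derivative partial i (partial j F) (p 0 0)) (at 0)"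
    by (simp add: at_within_Icc_at)
  from DERIV_unique[OF this px[OF si]] show ?thesis by (simp add: p_def)
qed

section \<open>Functions of the coordinates as functions of six real variables\<close>

lemma coords_nth [simp]:
  "coords t (r, \<theta>, \<phi>, \<psi>, z) $ Time = t"
  "coords t (r, \<theta>, \<phi>, \<psi>, z) $ Space Rad = r"
  "coords t (r, \<theta>, \<phi>, \<psi>, z) $ Space Theta = \<theta>"
  "coords t (r, \<theta>, \<phi>, \<psi>, z) $ Space Phi = \<phi>"
  "coords t (r, \<theta>, \<phi>, \<psi>, z) $ Space Psi = \<psi>"
  "coords t (r, \<theta>, \<phi>, \<psi>, z) $ Space Zed = z"
  by (simp_all add: coords_def)

lemma forall_ix: "(\<forall>i. P i) \<longleftrightarrow> P Time \<and> P (Space Rad) \<and> P (Space Theta) \<and> P (Space Phi)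
    \<and> P (Space Psi) \<and> P (Space Zed)"
proof -
  have "(\<forall>i. P i) \<longleftrightarrow> (\<forall>i\<in>UNIV. P i)" by blast
  then show ?thesis unfolding UNIV_ix by simp
qed

lemma coords_affine:
  "coords t (r, \<theta>, \<phi>, \<psi>, z) = coords 0 (r, \<theta>, \<phi>, \<psi>, z) + t *\<^sub>R axis Time 1"
  "coords t (r, \<theta>, \<phi>, \<psi>, z) = coords t (0, \<theta>, \<phi>, \<psi>, z) + r *\<^sub>R axis (Space Rad) 1"
  "coords t (r, \<theta>, \<phi>, \<psi>, z) = coords t (r, 0, \<phi>, \<psi>, z) + \<theta> *\<^sub>R axis (Space Theta) 1"
  "coords t (r, \<theta>, \<phi>, \<psi>, z) = coords t (r, \<theta>, 0, \<psi>, z) + \<phi> *\<^sub>R axis (Space Phi) 1"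
  "coords t (r, \<theta>, \<phi>, \<psi>, z) = coords t (r, \<theta>, \<phi>, 0, z) + \<psi> *\<^sub>R axis (Space Psi) 1"
  "coords t (r, \<theta>, \<phi>, \<psi>, z) = coords t (r, \<theta>, \<phi>, \<psi>, 0) + z *\<^sub>R axis (Space Zed) 1"
  by (simp_all add: vec_eq_iff forall_ix axis_def)

lemma DERIV_coords:
  assumes F: "smooth_on UNIV F"
  shows "((\<lambda>t. F (coords t (r, \<theta>, \<phi>, \<psi>, z))) has_real_derivative partial Time F (coords t (r, \<theta>, \<phi>, \<psi>, z))) (at t within S)"
    "((\<lambda>r. F (coords t (r, \<theta>, \<phi>, \<psi>, z))) has_real_derivative partial (Space Rad) F (coords t (r, \<theta>, \<phi>, \<psi>, z))) (at r within S)"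
    "((\<lambda>\<theta>. F (coords t (r, \<theta>, \<phi>, \<psi>, z))) has_real_derivative partial (Space Theta) F (coords t (r, \<theta>, \<phi>, \<psi>, z))) (at \<theta> within S)"
    "((\<lambda>\<phi>. F (coords t (r, \<theta>, \<phi>, \<psi>, z))) has_real_derivative partial (Space Phi) F (coords t (r, \<theta>, \<phi>, \<psi>, z))) (at \<phi> within S)"
    "((\<lambda>\<psi>. F (coords t (r, \<theta>, \<phi>, \<psi>, z))) has_real_derivative partial (Space Psi) F (coords t (r, \<theta>, \<phi>, \<psi>, z))) (at \<psi> within S)"
    "((\<lambda>z. F (coords t (r, \<theta>, \<phi>, \<psi>, z))) has_real_derivative partial (Space Zed) F (coords t (r, \<theta>, \<phi>, \<psi>, z))) (at z within S)"
  using partial_along_line[OF F, of "coords 0 (r, \<theta>, \<phi>, \<psi>, z)" Time t S]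
    partial_along_line[OF F, of "coords t (0, \<theta>, \<phi>, \<psi>, z)" "Space Rad" r S]
    partial_along_line[OF F, of "coords t (r, 0, \<phi>, \<psi>, z)" "Space Theta" \<theta> S]
    partial_along_line[OF F, of "coords t (r, \<theta>, 0, \<psi>, z)" "Space Phi" \<phi> S]
    partial_along_line[OF F, of "coords t (r, \<theta>, \<phi>, 0, z)" "Space Psi" \<psi> S]
    partial_along_line[OF F, of "coords t (r, \<theta>, \<phi>, \<psi>, 0)" "Space Zed" z S]
  unfolding coords_affine[symmetric] by - assumption+

lemma coords_basis: "coords t (r, \<theta>, \<phi>, \<psi>, z) = t *\<^sub>R axis Time 1 + r *\<^sub>R axis (Space Rad) 1
   + \<theta> *\<^sub>R axis (Space Theta) 1 + \<phi> *\<^sub>R axis (Space Phi) 1 + \<psi> *\<^sub>R axis (Space Psi) 1 + z *\<^sub>R axis (Space Zed) 1"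
  by (simp add: vec_eq_iff forall_ix axis_def)

lemma continuous_on_coords:
  assumes "smooth_on UNIV F" "continuous_on S t" "continuous_on S r" "continuous_on S \<theta>"
    "continuous_on S \<phi>" "continuous_on S \<psi>" "continuous_on S z"
  shows "continuous_on S (\<lambda>y. F (coords (t y) (r y, \<theta> y, \<phi> y, \<psi> y, z y)))"
  by (rule continuous_on_compose2[OF smooth_continuous[OF assms(1), of UNIV]])
    (auto simp: coords_basis intro!: continuous_intros assms)

section \<open>The metric in coordinates\<close>

text \<open>Subtract from row i the multiple of row j that clears the entry (i, j). Since row j
  vanishes outside the columns i and j, only (i, j) and (i, i) change.\<close>

lemma det_eliminate:
  fixes A :: "real^'n::finite^'n"
  assumes ij: "i \<noteq> j" and nz: "A $ j $ j \<noteq> 0"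
    and row: "\<And>k. k \<noteq> i \<Longrightarrow> k \<noteq> j \<Longrightarrow> A $ j $ k = 0"
  shows "det A = det (\<chi> k l. if k = i \<and> l = j then 0
    else if k = i \<and> l = i then A $ i $ i - A $ i $ j * A $ j $ i / A $ j $ j else A $ k $ l)"
    (is "_ = det ?B")
proof -
  have "?B = (\<chi> k. if k = i then row i A + (- (A $ i $ j / A $ j $ j)) *s row j A else row k A)"
    using ij nz row by (auto simp: vec_eq_iff row_def)
  then show ?thesis by (simp only: det_row_operation[OF ij])
qed

text \<open>Made for the two coupled pairs of the metric, (t, \<phi>) and (\<psi>, z). Such a pair
  is replaced by the diagonal entries \<open>\<delta> / A $ j $ j\<close> and
  \<open>A $ j $ j\<close>, whose product is the determinant \<open>\<delta>\<close> of the
  block.\<close>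

lemma det_block2:
  fixes A :: "real^'n::finite^'n"
  assumes ij: "i \<noteq> j" and nz: "A $ j $ j \<noteq> 0"
    and \<delta>: "\<delta> = A $ i $ i * A $ j $ j - A $ i $ j * A $ j $ i" "\<delta> \<noteq> 0"
    and row: "\<And>k. k \<noteq> i \<Longrightarrow> k \<noteq> j \<Longrightarrow> A $ i $ k = 0 \<and> A $ j $ k = 0"
  shows "det A = det (\<chi> k l. if (k = i \<and> l = j) \<or> (k = j \<and> l = i) then 0
    else if k = i \<and> l = i then \<delta> / A $ j $ j else A $ k $ l)" (is "_ = det ?C")
proof -
  define B where "B = (\<chi> k l. if k = i \<and> l = j then 0
    else if k = i \<and> l = i then A $ i $ i - A $ i $ j * A $ j $ i / A $ j $ j else A $ k $ l)"
  have d: "A $ i $ i - A $ i $ j * A $ j $ i / A $ j $ j = \<delta> / A $ j $ j"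
    using nz by (simp add: \<delta>(1) field_simps)
  have "det A = det B"
    unfolding B_def by (rule det_eliminate[OF ij nz]) (use row in auto)
  \<comment> \<open>The entry (i, j) is zero by now, so this elimination clears (j, i) and leaves
    the diagonal alone.\<close>
  also have "\<dots> = det (\<chi> k l. if k = j \<and> l = i then 0
    else if k = j \<and> l = j then B $ j $ j - B $ j $ i * B $ i $ j / B $ i $ i else B $ k $ l)"
    by (rule det_eliminate) (use ij row nz \<delta>(2) in \<open>auto simp: B_def d\<close>)
  also have "(\<chi> k l. if k = j \<and> l = i then 0
    else if k = j \<and> l = j then B $ j $ j - B $ j $ i * B $ i $ j / B $ i $ i else B $ k $ l) = ?C"
    using ij by (auto simp: B_def d vec_eq_iff)
  finally show ?thesis .
qed

lemma matrix_inv_eqI: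
  fixes A :: "real^'n::finite^'n"
  assumes "A ** B = mat 1"
  shows "matrix_inv A = B"
proof -
  have BA: "B ** A = mat 1" using assms matrix_left_right_inverse by blast
  have "A ** matrix_inv A = mat 1 \<and> matrix_inv A ** A = mat 1"
    unfolding matrix_inv_def by (rule someI[where x=B]) (simp add: assms BA)
  then have "matrix_inv A = (B ** A) ** matrix_inv A" by (simp add: BA)
  also have "\<dots> = B" by (simp add: matrix_mul_assoc[symmetric] \<open>_ \<and> _\<close>)
  finally show ?thesis .
qed

text \<open>Only r and \<theta> are restricted: the set is open, and translations in t and in the
  three angles preserve it.\<close>

definition chart :: "(real^ix) set" where
  "chart = {q. q $ Space Rad > 0 \<and> q $ Space Theta \<in> {0<..<pi/2}}"

lemma open_chart: "open chart"
proof -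
  have e: "chart = {q. 0 < q $ Space Rad} \<inter> ({q. 0 < q $ Space Theta} \<inter> {q. q $ Space Theta < pi/2})"
    by (auto simp: chart_def)
  show ?thesis
    unfolding e by (intro open_Int open_Collect_less continuous_intros)
qed

locale two_charge =
  fixes Q1 Q2 Rz :: real
  assumes Q1: "Q1 > 0" and Q2: "Q2 > 0" and Rz: "Rz > 0"
begin

text \<open>\<^term>\<open>K\<close> is \<open>h f\<close>, and \<open>-G / K\<close> is the component \<open>g\<^sup>t\<^sup>t\<close> of the inverse metric. Multiplied by \<open>K\<close>,
  the inverse metric has coefficients without square roots.\<close>

definition qq :: real where "qq = Q1 * Q2"
definition D :: "real \<Rightarrow> real" where "D r = r\<^sup>2 + qq / Rz\<^sup>2"
definition f :: "real \<Rightarrow> real \<Rightarrow> real" where "f r \<theta> = r\<^sup>2 + qq / Rz\<^sup>2 * (cos \<theta>)\<^sup>2"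
definition P :: "real \<Rightarrow> real \<Rightarrow> real" where "P r \<theta> = f r \<theta> + Q1 + Q2"
definition G :: "real \<Rightarrow> real \<Rightarrow> real" where "G r \<theta> = P r \<theta> + qq / D r"
definition K :: "real \<Rightarrow> real \<Rightarrow> real" where "K r \<theta> = sqrt ((f r \<theta> + Q1) * (f r \<theta> + Q2))"

lemma qq_pos: "qq > 0" using Q1 Q2 by (simp add: qq_def)
lemma D_pos: "D r > 0"
  using qq_pos Rz by (simp add: D_def add_nonneg_pos)
lemma f_nonneg: "f r \<theta> \<ge> 0" using qq_pos by (simp add: f_def)
lemma f_pos: "r > 0 \<Longrightarrow> f r \<theta> > 0" using qq_pos by (simp add: f_def add_pos_nonneg)
lemma P_pos: "P r \<theta> > 0" using f_nonneg[of r \<theta>] Q1 Q2 by (simp add: P_def)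
lemma G_pos: "G r \<theta> > 0" using P_pos[of r \<theta>] D_pos[of r] qq_pos by (simp add: G_def add_pos_pos)
lemma K_pos: "K r \<theta> > 0" using f_nonneg[of r \<theta>] Q1 Q2 by (simp add: K_def)
lemma K_sq: "K r \<theta> * K r \<theta> = f r \<theta> * P r \<theta> + qq"
  using f_nonneg[of r \<theta>] Q1 Q2 by (simp add: K_def P_def qq_def algebra_simps)

lemma f_eq_D: "f r \<theta> = D r - qq / Rz\<^sup>2 * (sin \<theta>)\<^sup>2"
  unfolding f_def D_def cos_squared_eq by (simp add: right_diff_distrib)

text \<open>Cleared of denominators, this says that the (t, \<phi>) block of the metric has
  determinant \<open>- D r * (sin \<theta>)\<^sup>2\<close>.\<close>

lemma K_sq_G: "K r \<theta> * K r \<theta> * D r = f r \<theta> * G r \<theta> * D r + (qq / Rz)\<^sup>2 * (sin \<theta>)\<^sup>2"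
proof -
  have "qq * D r = qq * f r \<theta> + (qq / Rz)\<^sup>2 * (sin \<theta>)\<^sup>2"
    by (simp add: f_eq_D algebra_simps power2_eq_square)
  then show ?thesis
    unfolding K_sq G_def using D_pos[of r] by (simp add: field_simps)
qed

text \<open>Cleared of denominators, this says that the (\<psi>, z) block of the metric has
  determinant \<open>r\<^sup>2 * (cos \<theta>)\<^sup>2\<close>.\<close>

lemma K_sq_P: "K r \<theta> * K r \<theta> * r\<^sup>2 + (qq / Rz)\<^sup>2 * (cos \<theta>)\<^sup>2 = f r \<theta> * (P r \<theta> * r\<^sup>2 + qq)"
  unfolding K_sq by (simp add: f_def algebra_simps power2_eq_square)

text \<open>The line element after \<open>h\<close> has been eliminated through
  \<open>h f = K\<close>. The identities \<open>K_sq_G\<close> and \<open>K_sq_P\<close> serve to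
  remove the fractions over \<open>h\<^sup>2 f\<^sup>2\<close> from the \<phi>\<phi> and
  \<psi>\<psi> entries.\<close>

definition met :: "real \<Rightarrow> real \<Rightarrow> ix \<Rightarrow> ix \<Rightarrow> real" where
  "met r \<theta> i j = (if i = j then
      (case i of Time \<Rightarrow> - (f r \<theta> / K r \<theta>) | Space k \<Rightarrow>
        (case k of Rad \<Rightarrow> K r \<theta> / D r | Theta \<Rightarrow> K r \<theta>
         | Phi \<Rightarrow> (sin \<theta>)\<^sup>2 * D r * G r \<theta> / K r \<theta>
         | Psi \<Rightarrow> (cos \<theta>)\<^sup>2 * (P r \<theta> * r\<^sup>2 + qq) / K r \<theta>
         | Zed \<Rightarrow> f r \<theta> / K r \<theta>))
    else if i = Time \<and> j = Space Phi \<or> j = Time \<and> i = Space Phi then - (qq / Rz * (sin \<theta>)\<^sup>2 / K r \<theta>)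
    else if i = Space Psi \<and> j = Space Zed \<or> j = Space Psi \<and> i = Space Zed
      then - (qq / Rz * (cos \<theta>)\<^sup>2 / K r \<theta>)
    else 0)"

definition inv_met :: "real \<Rightarrow> real \<Rightarrow> ix \<Rightarrow> ix \<Rightarrow> real" where
  "inv_met r \<theta> i j = (if i = j then
      (case i of Time \<Rightarrow> - G r \<theta> | Space k \<Rightarrow>
        (case k of Rad \<Rightarrow> D r | Theta \<Rightarrow> 1
         | Phi \<Rightarrow> f r \<theta> / (D r * (sin \<theta>)\<^sup>2)
         | Psi \<Rightarrow> f r \<theta> / (r\<^sup>2 * (cos \<theta>)\<^sup>2)
         | Zed \<Rightarrow> P r \<theta> + qq / r\<^sup>2))
    else if i = Time \<and> j = Space Phi \<or> j = Time \<and> i = Space Phi then - (qq / Rz / D r)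
    else if i = Space Psi \<and> j = Space Zed \<or> j = Space Psi \<and> i = Space Zed then qq / Rz / r\<^sup>2
    else 0) / K r \<theta>"

lemma metric_form_chart:
  assumes "q \<in> chart"
  shows "metric_form Q1 Q2 Rz q v w =
    (\<Sum>i\<in>UNIV. \<Sum>j\<in>UNIV. v $ i * met (q $ Space Rad) (q $ Space Theta) i j * w $ j)"
proof -
  define r where "r = q $ Space Rad"
  define \<theta> where "\<theta> = q $ Space Theta"
  define k where "k = K r \<theta>"
  define ff where "ff = f r \<theta>"
  have r: "r > 0" using assms by (simp add: chart_def r_def)
  have ff: "ff > 0" using f_pos[OF r] by (simp add: ff_def)
  have k: "k > 0" using K_pos by (simp add: k_def)
  have a2: "(sqrt (Q1 * Q2) / Rz)\<^sup>2 = qq / Rz\<^sup>2"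
    using Q1 Q2 by (simp add: qq_def power_divide)
  have aq: "2 * (sqrt (Q1 * Q2) / Rz) * sqrt (Q1 * Q2) = 2 * (qq / Rz)"
    using Q1 Q2 by (simp add: qq_def field_simps)
  have f0: "r\<^sup>2 + qq / Rz\<^sup>2 * (cos \<theta>)\<^sup>2 = ff"
    by (simp add: ff_def f_def)
  have h: "sqrt ((1 + Q1 / ff) * (1 + Q2 / ff)) = k / ff"
  proof -
    have "(1 + Q1 / ff) * (1 + Q2 / ff) = (ff + Q1) * (ff + Q2) / ff\<^sup>2"
      using ff by (simp add: field_simps power2_eq_square)
    then show ?thesis using ff by (simp add: k_def ff_def K_def real_sqrt_divide)
  qed
  have hf: "1 / (k / ff) = ff / k" "k / ff * ff = k" "(k / ff)\<^sup>2 * ff\<^sup>2 = k * k"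
    using ff k by (simp_all add: field_simps power2_eq_square)
  have aQ: "qq / Rz\<^sup>2 * Q1 * Q2 = (qq / Rz)\<^sup>2"
    by (simp add: qq_def power2_eq_square)
  have Dr: "r\<^sup>2 + qq / Rz\<^sup>2 = D r" by (simp add: D_def)
  have e1: "D r - (qq / Rz)\<^sup>2 * (sin \<theta>)\<^sup>2 / (k * k) = ff * G r \<theta> * D r / (k * k)"
    using k K_sq_G[of r \<theta>] by (simp add: ff_def[symmetric] k_def[symmetric] field_simps)
  have phi: "k / ff * ((D r - (qq / Rz)\<^sup>2 * (sin \<theta>)\<^sup>2 / (k * k)) * (sin \<theta>)\<^sup>2)
      = (sin \<theta>)\<^sup>2 * D r * G r \<theta> / k"
    unfolding e1 using ff k by (simp add: field_simps)
  have e2: "r\<^sup>2 + (qq / Rz)\<^sup>2 * (cos \<theta>)\<^sup>2 / (k * k) = ff * (P r \<theta> * r\<^sup>2 + qq) / (k * k)"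
    using k K_sq_P[of r \<theta>] by (simp add: ff_def[symmetric] k_def[symmetric] field_simps)
  have psi: "k / ff * ((r\<^sup>2 + (qq / Rz)\<^sup>2 * (cos \<theta>)\<^sup>2 / (k * k)) * (cos \<theta>)\<^sup>2)
      = (cos \<theta>)\<^sup>2 * (P r \<theta> * r\<^sup>2 + qq) / k"
    unfolding e2 using ff k by (simp add: field_simps)
  have red: "metric_form Q1 Q2 Rz q v w =
     - (ff / k) * (sym_prod Time Time v w - sym_prod (Space Zed) (Space Zed) v w)
     + k * (sym_prod (Space Theta) (Space Theta) v w
         + sym_prod (Space Rad) (Space Rad) v w / D r)
     - 2 * (qq / Rz) / k * ((cos \<theta>)\<^sup>2 * sym_prod (Space Zed) (Space Psi) v w
         + (sin \<theta>)\<^sup>2 * sym_prod Time (Space Phi) v w)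
     + ((cos \<theta>)\<^sup>2 * (P r \<theta> * r\<^sup>2 + qq) / k * sym_prod (Space Psi) (Space Psi) v w
       + (sin \<theta>)\<^sup>2 * D r * G r \<theta> / k * sym_prod (Space Phi) (Space Phi) v w)"
    unfolding phi[symmetric] psi[symmetric]
    unfolding metric_form_def Let_def r_def[symmetric] \<theta>_def[symmetric] f0 h hf aq a2 aQ Dr
    by (simp add: distrib_left mult.assoc)
  show ?thesis
    unfolding red r_def[symmetric] \<theta>_def[symmetric] UNIV_ix
    by (simp add: met_def sym_prod_def ff_def k_def algebra_simps add_divide_distrib)
qed

lemma metric_form_axis:
  assumes "q \<in> chart"
  shows "metric_form Q1 Q2 Rz q (axis i 1) (axis j 1) = met (q $ Space Rad) (q $ Space Theta) i j"
proof -
  have a: "(\<Sum>i\<in>UNIV. axis k 1 $ i * F i) = F k" "(\<Sum>i\<in>UNIV. F i * axis k 1 $ i) = F k"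
    for F :: "ix \<Rightarrow> real" and k
    by (simp_all add: axis_def if_distrib[of "\<lambda>x. x * _"] if_distrib[of "\<lambda>x. _ * x"] cong: if_cong)
  show ?thesis
    unfolding metric_form_chart[OF assms] by (simp add: a mult.assoc flip: sum_distrib_left)
qed

lemma chartD:
  assumes "q \<in> chart"
  shows "q $ Space Rad > 0" "sin (q $ Space Theta) > 0" "cos (q $ Space Theta) > 0"
  using assms by (auto simp: chart_def intro!: sin_gt_zero2 cos_gt_zero)

lemma met_inverse:
  assumes r: "r > 0" and s: "sin \<theta> > 0" and c: "cos \<theta> > 0"
  shows "(\<chi> i j. met r \<theta> i j) ** (\<chi> i j. inv_met r \<theta> i j) = mat 1"
proof -
  define k where "k = K r \<theta>"
  define ff where "ff = f r \<theta>"
  define d where "d = D r"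
  define g where "g = G r \<theta>"
  define p where "p = P r \<theta>"
  define S where "S = (sin \<theta>)\<^sup>2"
  define C where "C = (cos \<theta>)\<^sup>2"
  define R where "R = r\<^sup>2"
  define A where "A = qq / Rz"
  have pos: "k > 0" "ff > 0" "d > 0" "S > 0" "C > 0" "R > 0"
    using K_pos f_pos[OF r] D_pos r s c
    by (simp_all add: k_def ff_def d_def S_def C_def R_def)
  then have nz: "k \<noteq> 0" "ff \<noteq> 0" "d \<noteq> 0" "S \<noteq> 0" "C \<noteq> 0" "R \<noteq> 0" by auto
  have e1: "k * k * d = ff * g * d + A\<^sup>2 * S" and e2: "k * k * R + A\<^sup>2 * C = ff * (p * R + qq)"
    using K_sq_G[of r \<theta>] K_sq_P[of r \<theta>]
    by (simp_all add: k_def ff_def d_def g_def p_def S_def C_def R_def A_def)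
  \<comment> \<open>The facts \<open>tt\<close>, \<open>pp\<close>, \<open>zz\<close>,
    \<open>ss\<close> are the diagonal equations of the two coupled blocks and follow from the block
    determinants; \<open>psz\<close> is the equation for the entry (\<psi>, z). The remaining
    entries need no identity.\<close>
  have kk: "ff * g + A * S * (A / d) = k * k"
    using nz e1 by (simp add: divide_simps) (simp add: power2_eq_square)
  have "ff / k * (g / k) + A * S / k * (A / d / k) = (ff * g + A * S * (A / d)) / (k * k)"
    by (simp add: add_divide_distrib)
  then have tt: "ff / k * (g / k) + A * S / k * (A / d / k) = 1"
    using nz kk by simp
  have pp: "A * S / k * (A / d / k) + S * d * g / k * (ff / (d * S) / k) = 1"
    using nz tt by (simp add: mult_ac)
  have kk': "ff * (p + qq / R) - A * C * (A / R) = k * k"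
    using nz e2 by (simp add: divide_simps) (simp add: power2_eq_square algebra_simps)
  have "ff / k * ((p + qq / R) / k) - A * C / k * (A / R / k) = (ff * (p + qq / R) - A * C * (A / R)) / (k * k)"
    by (simp add: diff_divide_distrib)
  then have zz: "ff / k * ((p + qq / R) / k) - A * C / k * (A / R / k) = 1"
    using nz kk' by simp
  have "C * (p * R + qq) / k * (ff / (R * C) / k) = ff / k * ((p + qq / R) / k)"
    using nz by (simp add: field_simps)
  then have ss: "C * (p * R + qq) / k * (ff / (R * C) / k) - A * C / k * (A / R / k) = 1"
    using zz by simp
  have psz: "C * (p * R + qq) * A / (k * R * k) = A * C * (p + qq / R) / (k * k)"
    using nz by (simp add: field_simps)
  have "\<forall>i j. (\<Sum>l\<in>UNIV. met r \<theta> i l * inv_met r \<theta> l j) = (if i = j then 1 else 0)"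
    unfolding forall_ix UNIV_ix
    using tt pp ss zz nz psz
    by (simp add: met_def inv_met_def k_def[symmetric] ff_def[symmetric] d_def[symmetric]
      g_def[symmetric] p_def[symmetric] S_def[symmetric] C_def[symmetric] R_def[symmetric] A_def[symmetric])
  then show ?thesis
    by (simp add: vec_eq_iff matrix_matrix_mult_def mat_def)
qed

text \<open>The block determinants \<open>- D sin^2\<close> and \<open>r^2 cos^2\<close> are
  multiplied by the radial entry \<open>K / D\<close> and the \<theta> entry \<open>K\<close>; the
  factor \<open>D\<close> cancels.\<close>

lemma det_met:
  assumes r: "r > 0" and s: "sin \<theta> > 0" and c: "cos \<theta> > 0"
  shows "det (\<chi> i j. met r \<theta> i j) = - (K r \<theta> * r * sin \<theta> * cos \<theta>)\<^sup>2"
proof -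
  define k where "k = K r \<theta>"
  define ff where "ff = f r \<theta>"
  define d where "d = D r"
  define g where "g = G r \<theta>"
  define p where "p = P r \<theta>"
  define S where "S = (sin \<theta>)\<^sup>2"
  define C where "C = (cos \<theta>)\<^sup>2"
  define R where "R = r\<^sup>2"
  define A where "A = qq / Rz"
  have pos: "k > 0" "ff > 0" "d > 0" "S > 0" "C > 0" "R > 0" "g > 0" "p > 0"
    using K_pos f_pos[OF r] D_pos r s c G_pos P_pos
    by (simp_all add: k_def ff_def d_def S_def C_def R_def g_def p_def)
  then have nz: "k \<noteq> 0" "ff \<noteq> 0" "d \<noteq> 0" "S \<noteq> 0" "C \<noteq> 0" "R \<noteq> 0" "g \<noteq> 0" by auto
  have e1: "k * k * d = ff * g * d + A\<^sup>2 * S" and e2: "k * k * R + A\<^sup>2 * C = ff * (p * R + qq)"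
    using K_sq_G[of r \<theta>] K_sq_P[of r \<theta>]
    by (simp_all add: k_def ff_def d_def g_def p_def S_def C_def R_def A_def)
  note abb = k_def[symmetric] ff_def[symmetric] d_def[symmetric]
      g_def[symmetric] p_def[symmetric] S_def[symmetric] C_def[symmetric] R_def[symmetric] A_def[symmetric]
  define M where "M = (\<chi> i j. met r \<theta> i j)"
  define M1 where "M1 = (\<chi> i j. if (i = Space Phi \<and> j = Time) \<or> (i = Time \<and> j = Space Phi) then 0
    else if i = Space Phi \<and> j = Space Phi then - (d * S) / M $ Time $ Time else M $ i $ j)"
  have d1: "- (d * S) = M $ Space Phi $ Space Phi * M $ Time $ Time - M $ Space Phi $ Time * M $ Time $ Space Phi"
  proof -
    have "- (d * S) = S * d * g / k * - (ff / k) - A * S / k * (A * S / k)"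
      using nz(1) e1 by (simp add: divide_simps) algebra
    then show ?thesis by (simp add: M_def met_def abb)
  qed
  have "det M = det M1"
    unfolding M1_def
    by (rule det_block2[OF _ _ d1]) (use nz in \<open>auto simp: M_def met_def abb\<close>)
  define M2 where "M2 = (\<chi> i j. if (i = Space Psi \<and> j = Space Zed) \<or> (i = Space Zed \<and> j = Space Psi) then 0
    else if i = Space Psi \<and> j = Space Psi then R * C / M1 $ Space Zed $ Space Zed else M1 $ i $ j)"
  have d2: "R * C = M1 $ Space Psi $ Space Psi * M1 $ Space Zed $ Space Zed - M1 $ Space Psi $ Space Zed * M1 $ Space Zed $ Space Psi"
  proof -
    have "R * C = C * (p * R + qq) / k * (ff / k) - A * C / k * (A * C / k)"
      using nz(1) e2 by (simp add: divide_simps) algebra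
    then show ?thesis by (simp add: M1_def M_def met_def abb)
  qed
  have "det M1 = det M2"
    unfolding M2_def
    by (rule det_block2[OF _ _ d2]) (use nz in \<open>auto simp: M1_def M_def met_def abb\<close>)
  have "det M2 = prod (\<lambda>i. M2 $ i $ i) UNIV"
    by (rule det_diagonal) (auto simp: M2_def M1_def M_def met_def)
  also have "\<dots> = - (k\<^sup>2 * R * S * C)"
    using nz by (simp add: UNIV_ix M2_def M1_def M_def met_def abb power2_eq_square)
  finally show ?thesis
    using \<open>det M = det M1\<close> \<open>det M1 = det M2\<close>
    by (simp add: M_def k_def R_def S_def C_def power_mult_distrib)
qed

lemma sqrt_det_met:
  assumes r: "r > 0" and s: "sin \<theta> > 0" and c: "cos \<theta> > 0"
  shows "sqrt \<bar>det (\<chi> i j. met r \<theta> i j)\<bar> = K r \<theta> * r * sin \<theta> * cos \<theta>"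
  using assms K_pos[of r \<theta>] unfolding det_met[OF assms] by (simp add: real_sqrt_mult)

end

section \<open>The wave equation in coordinates\<close>

lemma partial_eqI: "(F has_derivative F') (at q) \<Longrightarrow> partial i F q = F' (axis i 1)"
  unfolding partial_def by (simp add: frechet_derivative_at[symmetric])

lemma partial_cong_open:
  assumes S: "open S" "q \<in> S" and e: "\<And>y. y \<in> S \<Longrightarrow> F y = H y"
  shows "partial i F q = partial i H q"
proof -
  have "(F has_derivative F') (at q) \<longleftrightarrow> (H has_derivative F') (at q)" for F'
    using has_derivative_transform_within_open[OF _ S, of F F' UNIV H]
      has_derivative_transform_within_open[OF _ S, of H F' UNIV F] e by auto
  then show ?thesis by (simp add: partial_def frechet_derivative_def)
qed

lemma partial_via_line:
  fixes F :: "real^'n::finite \<Rightarrow> real"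
  assumes F: "F differentiable (at q)"
    and d: "((\<lambda>s. F (q + s *\<^sub>R axis i 1)) has_real_derivative d) (at 0)"
  shows "partial i F q = d"
proof -
  let ?D = "frechet_derivative F (at q)"
  have D: "(F has_derivative ?D) (at (q + 0 *\<^sub>R axis i 1))"
    using F frechet_derivative_works by auto
  interpret D: bounded_linear ?D
    using D by (rule has_derivative_bounded_linear)
  have "((\<lambda>s. q + s *\<^sub>R axis i 1) has_derivative (\<lambda>h. h *\<^sub>R axis i 1)) (at 0)"
    by (auto intro!: derivative_eq_intros)
  from has_derivative_compose[OF this D]
  have "((\<lambda>s. F (q + s *\<^sub>R axis i 1)) has_real_derivative partial i F q) (at 0)"
    unfolding has_field_derivative_def partial_def by (simp add: D.scaleR mult.commute[of _ "?D _"])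
  from DERIV_unique[OF this d] show ?thesis .
qed

lemma smooth_differentiable: "smooth_on UNIV F \<Longrightarrow> F differentiable (at q)"
  using smooth_on_has_derivative unfolding differentiable_def by blast

lemma partial_add:
  fixes F H :: "real^'n::finite \<Rightarrow> real"
  assumes "F differentiable (at q)" "H differentiable (at q)"
  shows "partial i (\<lambda>y. F y + H y) q = partial i F q + partial i H q"
  using partial_eqI[OF has_derivative_add[OF assms[unfolded frechet_derivative_works]]]
  by (simp add: partial_def)

lemma partial_mult:
  fixes F H :: "real^'n::finite \<Rightarrow> real"
  assumes "F differentiable (at q)" "H differentiable (at q)"
  shows "partial i (\<lambda>y. F y * H y) q = partial i F q * H q + F q * partial i H q"
  using partial_eqI[OF has_derivative_mult[OF assms[unfolded frechet_derivative_works]]]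
  by (simp add: partial_def)

lemma differentiable_nth [simp]: "(\<lambda>y::real^'n::finite. y $ i) differentiable (at q)"
  unfolding differentiable_def using bounded_linear_imp_has_derivative[OF bounded_linear_vec_nth] by blast

lemma differentiable_sin_cos_nth [simp]:
  "(\<lambda>y::real^'n::finite. sin (y $ i)) differentiable (at q)"
  "(\<lambda>y::real^'n::finite. cos (y $ i)) differentiable (at q)"
  using has_derivative_sin[OF bounded_linear_imp_has_derivative[OF bounded_linear_vec_nth]]
    has_derivative_cos[OF bounded_linear_imp_has_derivative[OF bounded_linear_vec_nth]]
  unfolding differentiable_def by blast+

context two_charge
begin

text \<open>Up to a constant, the coordinate volume density of the flat plane times the round
  three-sphere. It vanishes on each degenerate locus, and this makes the fluxes there small.\<close>

definition wt :: "real \<Rightarrow> real \<Rightarrow> real" where "wt r \<theta> = r * sin \<theta> * cos \<theta>"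

text \<open>The wave operator times \<open>K r sin \<theta> cos \<theta>\<close>, the square root of minus the determinant of the
  metric. The factor \<open>K\<close> cancels.\<close>

definition wave_expr :: "(real^ix \<Rightarrow> real) \<Rightarrow> real^ix \<Rightarrow> real" where
  "wave_expr U q = (let r = q $ Space Rad; \<theta> = q $ Space Theta;
      U2 = (\<lambda>i j. partial i (partial j U) q) in
    wt r \<theta> * (- G r \<theta> * U2 Time Time - 2 * (qq / Rz / D r) * U2 Time (Space Phi)
       + f r \<theta> / (D r * (sin \<theta>)\<^sup>2) * U2 (Space Phi) (Space Phi)
       + D r * U2 (Space Rad) (Space Rad) + U2 (Space Theta) (Space Theta)
       + (P r \<theta> + qq / r\<^sup>2) * U2 (Space Zed) (Space Zed)
       + 2 * (qq / Rz / r\<^sup>2) * U2 (Space Zed) (Space Psi)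
       + f r \<theta> / (r\<^sup>2 * (cos \<theta>)\<^sup>2) * U2 (Space Psi) (Space Psi))
    + sin \<theta> * cos \<theta> * (D r + 2 * r\<^sup>2) * partial (Space Rad) U q
    + r * ((cos \<theta>)\<^sup>2 - (sin \<theta>)\<^sup>2) * partial (Space Theta) U q)"

text \<open>The metric depends on r and \<theta> alone, so its coefficients pass through derivatives
  in t and in the angles. In the other two directions, restriction to a coordinate line leaves a
  one-variable derivative of the coefficient.\<close>

lemma partial_coeff_mult:
  assumes A: "(\<lambda>y. A (y $ Space Rad) (y $ Space Theta)) differentiable (at q)" and F: "smooth_on UNIV F"
  shows "i \<notin> {Space Rad, Space Theta} \<Longrightarrow>
      partial i (\<lambda>y. A (y $ Space Rad) (y $ Space Theta) * F y) q
        = A (q $ Space Rad) (q $ Space Theta) * partial i F q"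
    "((\<lambda>r. A r (q $ Space Theta)) has_real_derivative d) (at (q $ Space Rad)) \<Longrightarrow>
      partial (Space Rad) (\<lambda>y. A (y $ Space Rad) (y $ Space Theta) * F y) q
        = d * F q + A (q $ Space Rad) (q $ Space Theta) * partial (Space Rad) F q"
    "((\<lambda>\<theta>. A (q $ Space Rad) \<theta>) has_real_derivative d) (at (q $ Space Theta)) \<Longrightarrow>
      partial (Space Theta) (\<lambda>y. A (y $ Space Rad) (y $ Space Theta) * F y) q
        = d * F q + A (q $ Space Rad) (q $ Space Theta) * partial (Space Theta) F q"
proof -
  note m = partial_mult[OF A smooth_differentiable[OF F]]
  have sh: "((\<lambda>s. H (x + s)) has_real_derivative d) (at 0)"
    if "(H has_real_derivative d) (at x)" for H x d
    using that DERIV_shift[of H d 0 x] by (simp add: add.commute)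
  show "partial i (\<lambda>y. A (y $ Space Rad) (y $ Space Theta) * F y) q
        = A (q $ Space Rad) (q $ Space Theta) * partial i F q" if "i \<notin> {Space Rad, Space Theta}"
    using that by (subst m, subst partial_via_line[OF A, where d=0]) (auto simp: axis_def)
  show "partial (Space Rad) (\<lambda>y. A (y $ Space Rad) (y $ Space Theta) * F y) q
        = d * F q + A (q $ Space Rad) (q $ Space Theta) * partial (Space Rad) F q"
    if "((\<lambda>r. A r (q $ Space Theta)) has_real_derivative d) (at (q $ Space Rad))"
    using sh[OF that] by (subst m, subst partial_via_line[OF A, where d=d]) (auto simp: axis_def)
  show "partial (Space Theta) (\<lambda>y. A (y $ Space Rad) (y $ Space Theta) * F y) q
        = d * F q + A (q $ Space Rad) (q $ Space Theta) * partial (Space Theta) F q"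
    if "((\<lambda>\<theta>. A (q $ Space Rad) \<theta>) has_real_derivative d) (at (q $ Space Theta))"
    using sh[OF that] by (subst m, subst partial_via_line[OF A, where d=d]) (auto simp: axis_def)
qed

lemma pullback_matrix_chart:
  assumes g: "two_charge_metric Q1 Q2 Rz g" and q: "q \<in> chart"
  shows "pullback_matrix g (coord_map Rz) q = (\<chi> i j. met (q $ Space Rad) (q $ Space Theta) i j)"
  using g q unfolding two_charge_metric_def pullback_matrix_def partial_def
  by (simp add: chart_def metric_form_axis[OF q, symmetric])

lemma local_param_coord_map: "local_param chart (coord_map Rz)"
  unfolding local_param_def
proof (intro conjI ballI)
  show "open chart" by (rule open_chart)
  show "smooth_on chart (coord_map Rz)"
    using Ck_on_subset[OF subset_UNIV Ck_on_coord_map] by (auto simp: smooth_on_def)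
  show "coord_map Rz ` chart \<subseteq> spacetime" using coord_map_in_spacetime by auto
next
  fix q assume q: "q \<in> chart"
  note pos = chartD[OF q]
  \<comment> \<open>Each complex component of the differential is a vector in polar form times a
    unit complex number. These factors cancel, and injectivity reduces to r, sin and cos being
    nonzero.\<close>
  have c: "z * cis \<alpha> = z' * cis \<alpha> \<longleftrightarrow> z = z'" for z z' \<alpha>
    using cis_neq_zero by simp
  show "inj (frechet_derivative (coord_map Rz) (at q))"
  proof (rule injI)
    fix v w :: "real^ix"
    assume "frechet_derivative (coord_map Rz) (at q) v = frechet_derivative (coord_map Rz) (at q) w"
    then show "v = w"
      unfolding coord_map_derivative[OF Rz] using pos Rz
      by (auto simp: c vec_eq_iff forall_ix)
  qed
qed

lemma wave_equation:
  assumes g: "two_charge_metric Q1 Q2 Rz g" and u: "smooth_wave_solution g u" and q: "q \<in> chart"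
  shows "wave_expr (u \<circ> coord_map Rz) q = 0"
proof -
  define U where "U = u \<circ> coord_map Rz"
  have U: "smooth_on UNIV U"
    using u smooth_comp_coord_map by (simp add: U_def smooth_wave_solution_def)
  note sm = smooth_partial[OF U]
  let ?M = "pullback_matrix g (coord_map Rz)"
  \<comment> \<open>\<open>H i\<close> is the i-th component of the gradient times the volume
    factor; the wave operator is the divergence of \<open>H\<close> divided by that factor.\<close>
  define H where "H = (\<lambda>i y. sqrt \<bar>det (?M y)\<bar> *
        (\<Sum>j\<in>UNIV. matrix_inv (?M y) $ i $ j * partial j U y))"
  have "wave_operator ?M U q = 0"
    using u q local_param_coord_map unfolding smooth_wave_solution_def U_def by blast
  moreover have "sqrt \<bar>det (?M q)\<bar> > 0"
    unfolding pullback_matrix_chart[OF g q] sqrt_det_met[OF chartD[OF q]]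
    using chartD[OF q] K_pos by simp
  ultimately have sum0: "(\<Sum>i\<in>UNIV. partial i (H i) q) = 0"
    by (simp add: wave_operator_def H_def)
  have H: "H i y = (\<Sum>j\<in>UNIV. (K (y $ Space Rad) (y $ Space Theta) * wt (y $ Space Rad) (y $ Space Theta))
      * inv_met (y $ Space Rad) (y $ Space Theta) i j * partial j U y)" if y: "y \<in> chart" for i y
    unfolding H_def pullback_matrix_chart[OF g y] matrix_inv_eqI[OF met_inverse[OF chartD[OF y]]]
      sqrt_det_met[OF chartD[OF y]]
    by (simp add: sum_distrib_left wt_def mult_ac)
  \<comment> \<open>Here the \<open>K\<close> of the volume factor meets the \<open>1 / K\<close> of
    the inverse metric.\<close>
  have Kc: "K r \<theta> * w * (x / K r \<theta>) * v = w * x * v" for r \<theta> w x v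
    using K_pos[of r \<theta>] by simp
  let ?w = "\<lambda>y. wt (y $ Space Rad) (y $ Space Theta)" and ?r = "\<lambda>y. y $ Space Rad" and ?\<theta> = "\<lambda>y. y $ Space Theta"
  note Hs = H[unfolded inv_met_def Kc UNIV_ix]
  \<comment> \<open>The formula for \<open>H\<close> holds on \<open>chart\<close> only. As this set
    is open, the formula may be used under partial derivatives at \<open>q\<close>.\<close>
  note co = partial_cong_open[OF open_chart q]
  have Ht: "partial i (H Time) q = partial i (\<lambda>y. (?w y * - G (?r y) (?\<theta> y)) * partial Time U y
      + (?w y * - (qq / Rz / D (?r y))) * partial (Space Phi) U y) q" for i
    by (rule co) (simp add: Hs)
  have Hr: "partial i (H (Space Rad)) q = partial i (\<lambda>y. (?w y * D (?r y)) * partial (Space Rad) U y) q" for i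
    by (rule co) (simp add: Hs)
  have Hh: "partial i (H (Space Theta)) q = partial i (\<lambda>y. ?w y * partial (Space Theta) U y) q" for i
    by (rule co) (simp add: Hs)
  have Hp: "partial i (H (Space Phi)) q = partial i (\<lambda>y. (?w y * - (qq / Rz / D (?r y))) * partial Time U y
     + (?w y * (f (?r y) (?\<theta> y) / (D (?r y) * (sin (?\<theta> y))\<^sup>2))) * partial (Space Phi) U y) q" for i
    by (rule co) (simp add: Hs)
  have Hs': "partial i (H (Space Psi)) q = partial i (\<lambda>y. (?w y * (f (?r y) (?\<theta> y) / ((?r y)\<^sup>2 * (cos (?\<theta> y))\<^sup>2))) * partial (Space Psi) U y
     + (?w y * (qq / Rz / (?r y)\<^sup>2)) * partial (Space Zed) U y) q" for i
    by (rule co) (simp add: Hs)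
  have Hz: "partial i (H (Space Zed)) q = partial i (\<lambda>y. (?w y * (qq / Rz / (?r y)\<^sup>2)) * partial (Space Psi) U y
     + (?w y * (P (?r y) (?\<theta> y) + qq / (?r y)\<^sup>2)) * partial (Space Zed) U y) q" for i
    by (rule co) (simp add: Hs)
  have nz: "D (?r q) \<noteq> 0" "?r q \<noteq> 0" "sin (?\<theta> q) \<noteq> 0" "cos (?\<theta> q) \<noteq> 0" "Rz \<noteq> 0"
    using chartD[OF q] D_pos[of "?r q"] Rz by auto
  have df: "(\<lambda>y. ?w y * - G (?r y) (?\<theta> y)) differentiable (at q)"
    "(\<lambda>y. ?w y * - (qq / Rz / D (?r y))) differentiable (at q)"
    "(\<lambda>y. ?w y * D (?r y)) differentiable (at q)"
    "?w differentiable (at q)"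
    "(\<lambda>y. ?w y * (f (?r y) (?\<theta> y) / (D (?r y) * (sin (?\<theta> y))\<^sup>2))) differentiable (at q)"
    "(\<lambda>y. ?w y * (f (?r y) (?\<theta> y) / ((?r y)\<^sup>2 * (cos (?\<theta> y))\<^sup>2))) differentiable (at q)"
    "(\<lambda>y. ?w y * (qq / Rz / (?r y)\<^sup>2)) differentiable (at q)"
    "(\<lambda>y. ?w y * (P (?r y) (?\<theta> y) + qq / (?r y)\<^sup>2)) differentiable (at q)"
    unfolding wt_def G_def P_def f_def using nz unfolding D_def
    by (auto intro!: differentiable_mult differentiable_add differentiable_minus differentiable_divide
        differentiable_power differentiable_const)
  note pc1 = partial_coeff_mult(1)[where A="\<lambda>r \<theta>. wt r \<theta> * - G r \<theta>", OF df(1)]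
    partial_coeff_mult(1)[where A="\<lambda>r \<theta>. wt r \<theta> * - (qq / Rz / D r)", OF df(2)]
    partial_coeff_mult(1)[where A="\<lambda>r \<theta>. wt r \<theta> * (f r \<theta> / (D r * (sin \<theta>)\<^sup>2))", OF df(5)]
    partial_coeff_mult(1)[where A="\<lambda>r \<theta>. wt r \<theta> * (f r \<theta> / (r\<^sup>2 * (cos \<theta>)\<^sup>2))", OF df(6)]
    partial_coeff_mult(1)[where A="\<lambda>r \<theta>. wt r \<theta> * (qq / Rz / r\<^sup>2)", OF df(7)]
    partial_coeff_mult(1)[where A="\<lambda>r \<theta>. wt r \<theta> * (P r \<theta> + qq / r\<^sup>2)", OF df(8)]
  have pa: "partial i (\<lambda>y. \<alpha> y * partial j U y + \<beta> y * partial k U y) q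
      = partial i (\<lambda>y. \<alpha> y * partial j U y) q + partial i (\<lambda>y. \<beta> y * partial k U y) q"
    if "\<alpha> differentiable (at q)" "\<beta> differentiable (at q)" for i j k \<alpha> \<beta>
    by (intro partial_add differentiable_mult that smooth_differentiable sm)
  let ?U = "\<lambda>i j. partial i (partial j U) q"
  have ni: "Time \<notin> {Space Rad, Space Theta}" "Space Phi \<notin> {Space Rad, Space Theta}"
    "Space Psi \<notin> {Space Rad, Space Theta}" "Space Zed \<notin> {Space Rad, Space Theta}"
    by auto
  have t: "partial Time (H Time) q = (?w q * - G (?r q) (?\<theta> q)) * ?U Time Time
      + (?w q * - (qq / Rz / D (?r q))) * ?U Time (Space Phi)"
    by (simp only: Ht pa[OF df(1,2)] pc1[OF sm] ni not_False_eq_True)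
  have p: "partial (Space Phi) (H (Space Phi)) q = (?w q * - (qq / Rz / D (?r q))) * ?U Time (Space Phi)
     + (?w q * (f (?r q) (?\<theta> q) / (D (?r q) * (sin (?\<theta> q))\<^sup>2))) * ?U (Space Phi) (Space Phi)"
    by (simp only: Hp pa[OF df(2,5)] pc1[OF sm] ni not_False_eq_True partial_commute[OF U, of "Space Phi" Time q])
  have s: "partial (Space Psi) (H (Space Psi)) q = (?w q * (f (?r q) (?\<theta> q) / ((?r q)\<^sup>2 * (cos (?\<theta> q))\<^sup>2))) * ?U (Space Psi) (Space Psi)
     + (?w q * (qq / Rz / (?r q)\<^sup>2)) * ?U (Space Zed) (Space Psi)"
    by (simp only: Hs' pa[OF df(6,7)] pc1[OF sm] ni not_False_eq_True partial_commute[OF U, of "Space Psi" "Space Zed" q])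
  have z: "partial (Space Zed) (H (Space Zed)) q = (?w q * (qq / Rz / (?r q)\<^sup>2)) * ?U (Space Zed) (Space Psi)
     + (?w q * (P (?r q) (?\<theta> q) + qq / (?r q)\<^sup>2)) * ?U (Space Zed) (Space Zed)"
    by (simp only: Hz pa[OF df(7,8)] pc1[OF sm] ni not_False_eq_True)
  have r: "partial (Space Rad) (H (Space Rad)) q =
     (sin (?\<theta> q) * cos (?\<theta> q) * (D (?r q) + 2 * (?r q)\<^sup>2)) * partial (Space Rad) U q
     + ?w q * D (?r q) * ?U (Space Rad) (Space Rad)"
    unfolding Hr
    by (rule partial_coeff_mult(2)[where A="\<lambda>r \<theta>. wt r \<theta> * D r", OF df(3) sm])
      (use nz(5) in \<open>auto simp: wt_def D_def power2_eq_square algebra_simps intro!: derivative_eq_intros\<close>)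
  have h: "partial (Space Theta) (H (Space Theta)) q =
     (?r q * ((cos (?\<theta> q))\<^sup>2 - (sin (?\<theta> q))\<^sup>2)) * partial (Space Theta) U q
     + ?w q * ?U (Space Theta) (Space Theta)"
    unfolding Hh
    by (rule partial_coeff_mult(3)[where A=wt, OF df(4) sm])
      (auto simp: wt_def power2_eq_square algebra_simps intro!: derivative_eq_intros)
  have "wave_expr U q = (\<Sum>i\<in>UNIV. partial i (H i) q)"
    unfolding UNIV_ix by (simp add: t p s z r h wave_expr_def Let_def algebra_simps)
  then show ?thesis using sum0 by (simp add: U_def)
qed

text \<open>The coordinate form of the fact that a Killing field commutes with the wave operator.
  The coefficients do not contain \<phi> and \<open>chart\<close> is invariant under translation in
  \<phi>, so the claim is the derivative of the equation for \<open>U\<close> along a \<phi>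
  line.\<close>

lemma wave_expr_Phi:
  assumes U: "smooth_on UNIV U" and w: "\<And>q. q \<in> chart \<Longrightarrow> wave_expr U q = 0" and q: "q \<in> chart"
  shows "wave_expr (partial (Space Phi) U) q = 0"
proof -
  have c1: "partial i (partial (Space Phi) U) y = partial (Space Phi) (partial i U) y" for i y
    by (rule partial_commute[OF U])
  have c2: "partial i (partial j (partial (Space Phi) U)) y = partial (Space Phi) (partial i (partial j U)) y" for i j y
  proof -
    have "partial i (partial j (partial (Space Phi) U)) y = partial i (partial (Space Phi) (partial j U)) y"
      using c1 by (metis ext)
    then show ?thesis using partial_commute[OF smooth_partial[OF U]] by metis
  qed
  let ?l = "\<lambda>s. q + s *\<^sub>R axis (Space Phi) 1"
  have l: "?l s $ Space Rad = q $ Space Rad" "?l s $ Space Theta = q $ Space Theta" for s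
    by (simp_all add: axis_def)
  have d: "((\<lambda>s. F (?l s)) has_real_derivative partial (Space Phi) F q) (at 0)" if "smooth_on UNIV F" for F :: "real^ix \<Rightarrow> real"
    using partial_along_line[OF that, of q "Space Phi" 0 UNIV] by simp
  have d1: "((\<lambda>s. partial i U (?l s)) has_real_derivative partial i (partial (Space Phi) U) q) (at 0)" for i
    using d[OF smooth_partial[OF U]] unfolding c1[of i q] .
  have d2: "((\<lambda>s. partial i (partial j U) (?l s)) has_real_derivative
      partial i (partial j (partial (Space Phi) U)) q) (at 0)" for i j
    using d[OF smooth_partial[OF smooth_partial[OF U]]] unfolding c2[of i j q] .
  have "((\<lambda>s. wave_expr U (?l s)) has_real_derivative wave_expr (partial (Space Phi) U) q) (at 0)"
    unfolding wave_expr_def Let_def l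
    by (intro DERIV_add DERIV_cmult d1 d2 DERIV_diff)
  moreover have "((\<lambda>s. wave_expr U (?l s)) has_real_derivative 0) (at 0)"
  proof -
    have "?l s \<in> chart" for s using q unfolding chart_def mem_Collect_eq l .
    then show ?thesis using w by simp
  qed
  ultimately show ?thesis by (rule DERIV_unique)
qed

end

section \<open>The energy density\<close>

lemma sum_UNIV_ix: "(\<Sum>i\<in>UNIV. F i) = F Time + (\<Sum>k\<in>UNIV. F (Space k))"
  by (simp add: UNIV_ix UNIV_space_ix add_ac)

lemma forall_space_ix: "(\<forall>i. Q i) \<longleftrightarrow> Q Rad \<and> Q Theta \<and> Q Phi \<and> Q Psi \<and> Q Zed"
proof -
  have "(\<forall>i. Q i) \<longleftrightarrow> (\<forall>i\<in>UNIV. Q i)" by blast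
  then show ?thesis unfolding UNIV_space_ix by simp
qed

lemma frechet_derivative_partials:
  fixes F :: "real^'n::finite \<Rightarrow> real"
  assumes "F differentiable (at q)"
  shows "frechet_derivative F (at q) v = (\<Sum>i\<in>UNIV. v $ i * partial i F q)"
proof -
  interpret D: bounded_linear "frechet_derivative F (at q)"
    using assms frechet_derivative_works has_derivative_bounded_linear by blast
  have "frechet_derivative F (at q) v = frechet_derivative F (at q) (\<Sum>i\<in>UNIV. v $ i *\<^sub>R axis i 1)"
    using basis_expansion[of v] by (simp add: scalar_mult_eq_scaleR)
  then show ?thesis by (simp add: D.sum D.scaleR partial_def)
qed

context two_charge
begin

text \<open>The inverse of the spatial block of the metric. Time couples to \<phi> only, so it
  differs from the spatial block of the inverse spacetime metric in the (\<phi>, \<phi>) entry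
  alone.\<close>

definition inv_sp :: "real \<Rightarrow> real \<Rightarrow> space_ix \<Rightarrow> space_ix \<Rightarrow> real" where
  "inv_sp r \<theta> i j = (if i = Phi \<and> j = Phi then K r \<theta> / ((sin \<theta>)\<^sup>2 * D r * G r \<theta>)
     else inv_met r \<theta> (Space i) (Space j))"

lemma inv_sp_inverse:
  assumes r: "r > 0" and s: "sin \<theta> > 0" and c: "cos \<theta> > 0"
  shows "(\<chi> i j. met r \<theta> (Space i) (Space j)) ** (\<chi> i j. inv_sp r \<theta> i j) = mat 1"
proof -
  have "(\<Sum>l\<in>UNIV. met r \<theta> (Space i) (Space l) * inv_sp r \<theta> l j) = (if i = j then 1 else 0)" for i j
  proof -
    have "(\<Sum>l\<in>UNIV. met r \<theta> (Space i) l * inv_met r \<theta> l (Space j)) = (if i = j then 1 else 0)"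
      using arg_cong[OF met_inverse[OF assms], of "\<lambda>M. M $ Space i $ Space j"]
      by (simp add: matrix_matrix_mult_def mat_def)
    moreover have "(\<Sum>l\<in>UNIV. met r \<theta> (Space i) (Space l) * inv_sp r \<theta> l j) =
      (\<Sum>l\<in>UNIV. met r \<theta> (Space i) l * inv_met r \<theta> l (Space j))" if "i \<noteq> Phi \<or> j \<noteq> Phi"
      using that unfolding sum_UNIV_ix UNIV_space_ix
      by (cases i; cases j) (simp_all add: met_def inv_sp_def inv_met_def)
    moreover have "(\<Sum>l\<in>UNIV. met r \<theta> (Space Phi) (Space l) * inv_sp r \<theta> l Phi) = 1"
      using s K_pos[of r \<theta>] D_pos[of r] G_pos[of r \<theta>] unfolding UNIV_space_ix
      by (simp add: met_def inv_sp_def)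
    ultimately show ?thesis by (cases "i = Phi \<and> j = Phi") auto
  qed
  then show ?thesis by (simp add: vec_eq_iff matrix_matrix_mult_def mat_def)
qed

text \<open>Gives content to the \<open>SOME\<close> in \<open>energy_density\<close>. Gram-Schmidt
  acts only on the pair (\<psi>, z): the \<psi> field is corrected by a multiple of the z field, and
  the other coordinate fields are merely rescaled.\<close>

lemma orthonormal_frame_exists:
  assumes q: "q \<in> chart"
  shows "\<exists>X. orthonormal_frame Q1 Q2 Rz q X"
proof -
  define r where "r = q $ Space Rad"
  define \<theta> where "\<theta> = q $ Space Theta"
  define k where "k = K r \<theta>"
  define ff where "ff = f r \<theta>"
  define d where "d = D r"
  define g where "g = G r \<theta>"
  define p where "p = P r \<theta>"
  define S where "S = (sin \<theta>)\<^sup>2"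
  define C where "C = (cos \<theta>)\<^sup>2"
  define R where "R = r\<^sup>2"
  define A where "A = qq / Rz"
  note abb = k_def[symmetric] ff_def[symmetric] d_def[symmetric]
      g_def[symmetric] p_def[symmetric] S_def[symmetric] C_def[symmetric] R_def[symmetric] A_def[symmetric]
  have pos: "k > 0" "ff > 0" "d > 0" "S > 0" "C > 0" "R > 0" "g > 0" "p > 0"
    using K_pos f_pos D_pos chartD[OF q] G_pos P_pos
    by (simp_all add: k_def ff_def d_def S_def C_def R_def g_def p_def r_def \<theta>_def)
  have e2: "k * k * R + A\<^sup>2 * C = ff * (p * R + qq)"
    using K_sq_P[of r \<theta>] by (simp add: k_def ff_def p_def C_def R_def A_def)
  \<comment> \<open>The (\<psi>, z) block has determinant \<open>R * C\<close>, so
    \<open>k * R * C / ff\<close> is the squared length of the part of the \<psi> field orthogonal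
    to the z field; \<open>a\<close> normalizes it.\<close>
  define a where "a = sqrt (ff / (k * R * C))"
  have a2: "a * a = ff / (k * R * C)" using pos by (simp add: a_def)
  define v where "v = (\<lambda>x::real. \<lambda>k. x *\<^sub>R axis (Space k) 1 :: real^ix)"
  define X where "X = (\<lambda>B. case B of Rad \<Rightarrow> v (sqrt (d / k)) Rad | Theta \<Rightarrow> v (sqrt (1 / k)) Theta
     | Phi \<Rightarrow> v (sqrt (k / (S * d * g))) Phi | Zed \<Rightarrow> v (sqrt (k / ff)) Zed
     | Psi \<Rightarrow> v a Psi + v (a * (A * C / ff)) Zed)"
  have sq: "sqrt x * y * sqrt x = x * y" if "x \<ge> 0" for x y
    using that by (metis mult.assoc mult.commute real_sqrt_mult_self abs_of_nonneg)
  have pp: "a * (C * (p * R + qq) / k) * a - 2 * (a * (A * C / k) * (a * (A * C / ff)))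
      + a * (A * C / ff) * (ff / k) * (a * (A * C / ff)) = 1"
  proof -
    have "a * (C * (p * R + qq) / k) * a - 2 * (a * (A * C / k) * (a * (A * C / ff)))
      + a * (A * C / ff) * (ff / k) * (a * (A * C / ff)) =
       (a * a) * (C / (k * ff)) * (ff * (p * R + qq) - A\<^sup>2 * C)"
      using pos by (simp add: field_simps power2_eq_square)
    also have "\<dots> = 1" unfolding a2 e2[symmetric] using pos by (simp add: field_simps)
    finally show ?thesis .
  qed
  have "orthonormal_frame Q1 Q2 Rz q X"
    unfolding orthonormal_frame_def
  proof (intro conjI)
    show "\<forall>B. X B $ Time = 0"
      unfolding forall_space_ix by (simp add: X_def v_def axis_def)
    show "\<forall>B B'. metric_form Q1 Q2 Rz q (X B) (X B') = of_bool (B = B')"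
      unfolding forall_space_ix metric_form_chart[OF q] r_def[symmetric] \<theta>_def[symmetric] UNIV_ix
      using pos pp
      by (simp add: X_def v_def axis_def met_def abb sq) (simp add: field_simps)
  qed
  then show ?thesis by blast
qed

text \<open>With the frame vectors as rows of \<open>Y\<close>, orthonormality says
  \<open>Y ** (M ** transpose Y) = mat 1\<close>. Hence \<open>transpose Y ** Y\<close> is the
  inverse of the induced metric, and the sum over the frame is independent of the frame.\<close>

lemma energy_density_chart:
  assumes q: "q \<in> chart" and U: "U differentiable (at q)"
  shows "energy_density Q1 Q2 Rz U q = (let r = q $ Space Rad; \<theta> = q $ Space Theta in
     (partial Time U q)\<^sup>2 + (D r * (partial (Space Rad) U q)\<^sup>2 + (partial (Space Theta) U q)\<^sup>2
       + P r \<theta> * (partial (Space Zed) U q)\<^sup>2 + (partial (Space Psi) U q)\<^sup>2 / (cos \<theta>)\<^sup>2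
       + qq / r\<^sup>2 * (partial (Space Zed) U q + partial (Space Psi) U q / Rz)\<^sup>2) / K r \<theta>
     + K r \<theta> / (D r * G r \<theta>) * ((partial (Space Phi) U q)\<^sup>2 / (sin \<theta>)\<^sup>2))"
proof -
  define r where "r = q $ Space Rad"
  define \<theta> where "\<theta> = q $ Space Theta"
  have pos: "r > 0" "sin \<theta> > 0" "cos \<theta> > 0" using chartD[OF q] by (simp_all add: r_def \<theta>_def)
  define X where "X = (SOME X. orthonormal_frame Q1 Q2 Rz q X)"
  have X: "orthonormal_frame Q1 Q2 Rz q X"
    unfolding X_def using orthonormal_frame_exists[OF q] by (rule someI_ex)
  define Y :: "real^space_ix^space_ix" where "Y = (\<chi> A i. X A $ Space i)"
  define M :: "real^space_ix^space_ix" where "M = (\<chi> i j. met r \<theta> (Space i) (Space j))"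
  define N :: "real^space_ix^space_ix" where "N = (\<chi> i j. inv_sp r \<theta> i j)"
  have X0: "X A $ Time = 0" for A using X by (simp add: orthonormal_frame_def)
  have "metric_form Q1 Q2 Rz q (X A) (X B) = (Y ** (M ** transpose Y)) $ A $ B" for A B
    unfolding metric_form_chart[OF q] sum_UNIV_ix X0
    by (simp add: Y_def M_def matrix_matrix_mult_def transpose_def r_def \<theta>_def sum_distrib_left mult.assoc)
  then have "Y ** (M ** transpose Y) = mat 1"
    using X by (simp add: orthonormal_frame_def vec_eq_iff mat_def)
  then have "(M ** transpose Y) ** Y = mat 1"
    using matrix_left_right_inverse by blast
  then have "M ** (transpose Y ** Y) = mat 1" by (simp add: matrix_mul_assoc)
  then have "matrix_inv M = transpose Y ** Y" by (rule matrix_inv_eqI)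
  moreover have "matrix_inv M = N"
    unfolding M_def N_def by (rule matrix_inv_eqI[OF inv_sp_inverse[OF pos]])
  ultimately have e: "transpose Y ** Y = N" by simp
  have YN: "(\<Sum>A\<in>UNIV. Y $ A $ i * Y $ A $ j) = inv_sp r \<theta> i j" for i j
    using arg_cong[OF e, of "\<lambda>M. M $ i $ j"]
    by (simp add: matrix_matrix_mult_def transpose_def N_def)
  let ?u = "\<lambda>i. partial (Space i) U q"
  have "(\<Sum>A\<in>UNIV. (frechet_derivative U (at q) (X A))\<^sup>2) = (\<Sum>A\<in>UNIV. (\<Sum>i\<in>UNIV. Y $ A $ i * ?u i)\<^sup>2)"
    unfolding frechet_derivative_partials[OF U] sum_UNIV_ix X0 by (simp add: Y_def)
  also have "\<dots> = (\<Sum>A\<in>UNIV. \<Sum>i\<in>UNIV. \<Sum>j\<in>UNIV. Y $ A $ i * Y $ A $ j * (?u i * ?u j))"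
    by (simp add: power2_eq_square sum_product mult_ac)
  also have "\<dots> = (\<Sum>i\<in>UNIV. \<Sum>j\<in>UNIV. inv_sp r \<theta> i j * (?u i * ?u j))"
    unfolding YN[symmetric] sum_distrib_right
    by (subst sum.swap, rule sum.cong[OF refl], subst sum.swap) simp
  also have "\<dots> = (D r * (?u Rad)\<^sup>2 + (?u Theta)\<^sup>2 + P r \<theta> * (?u Zed)\<^sup>2 + (?u Psi)\<^sup>2 / (cos \<theta>)\<^sup>2
       + qq / r\<^sup>2 * (?u Zed + ?u Psi / Rz)\<^sup>2) / K r \<theta>
     + K r \<theta> / (D r * G r \<theta>) * ((?u Phi)\<^sup>2 / (sin \<theta>)\<^sup>2)"
  proof -
    \<comment> \<open>Splitting the \<psi>\<psi> coefficient completes a square in the z and \<psi>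
      derivatives. The square belongs to \<open>Rz\<close> times the z field plus the \<psi> field,
      which shrinks to zero at r = 0 and compensates the factor
      \<open>1 / r\<^sup>2\<close>.\<close>
    have ps: "f r \<theta> / (r\<^sup>2 * (cos \<theta>)\<^sup>2) = 1 / (cos \<theta>)\<^sup>2 + qq / Rz\<^sup>2 / r\<^sup>2"
      using pos Rz by (simp add: f_def field_simps)
    have sq: "(?u Zed + ?u Psi / Rz)\<^sup>2 = (?u Zed)\<^sup>2 + 2 * (?u Zed * ?u Psi) / Rz + (?u Psi)\<^sup>2 / Rz\<^sup>2"
      by (simp add: power2_sum power_divide)
    show ?thesis
      unfolding UNIV_space_ix
      by (simp add: inv_sp_def inv_met_def ps sq)
        (simp add: power2_eq_square algebra_simps add_divide_distrib)
  qed
  finally show ?thesis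
    unfolding energy_density_def Let_def X_def[symmetric] r_def[symmetric] \<theta>_def[symmetric] by simp
qed

lemma det_induced_metric:
  assumes q: "q \<in> chart"
  shows "det (induced_metric Q1 Q2 Rz q) = K (q $ Space Rad) (q $ Space Theta) * G (q $ Space Rad) (q $ Space Theta)
    * (wt (q $ Space Rad) (q $ Space Theta))\<^sup>2"
proof -
  define r where "r = q $ Space Rad"
  define \<theta> where "\<theta> = q $ Space Theta"
  define k where "k = K r \<theta>"
  define ff where "ff = f r \<theta>"
  define d where "d = D r"
  define g where "g = G r \<theta>"
  define p where "p = P r \<theta>"
  define S where "S = (sin \<theta>)\<^sup>2"
  define C where "C = (cos \<theta>)\<^sup>2"
  define R where "R = r\<^sup>2"
  define A where "A = qq / Rz"
  note abb = k_def[symmetric] ff_def[symmetric] d_def[symmetric]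
      g_def[symmetric] p_def[symmetric] S_def[symmetric] C_def[symmetric] R_def[symmetric] A_def[symmetric]
  have pos: "k > 0" "ff > 0" "d > 0" "S > 0" "C > 0" "R > 0" "g > 0" "p > 0"
    using K_pos f_pos D_pos chartD[OF q] G_pos P_pos
    by (simp_all add: k_def ff_def d_def S_def C_def R_def g_def p_def r_def \<theta>_def)
  then have nz: "k \<noteq> 0" "ff \<noteq> 0" "d \<noteq> 0" "S \<noteq> 0" "C \<noteq> 0" "R \<noteq> 0" "g \<noteq> 0" by auto
  have e2: "k * k * R + A\<^sup>2 * C = ff * (p * R + qq)"
    using K_sq_P[of r \<theta>] by (simp add: k_def ff_def p_def C_def R_def A_def)
  define M :: "real^space_ix^space_ix" where "M = (\<chi> i j. met r \<theta> (Space i) (Space j))"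
  define M1 where "M1 = (\<chi> i j. if (i = Psi \<and> j = Zed) \<or> (i = Zed \<and> j = Psi) then 0
    else if i = Psi \<and> j = Psi then R * C / M $ Zed $ Zed else M $ i $ j)"
  have d1: "R * C = M $ Psi $ Psi * M $ Zed $ Zed - M $ Psi $ Zed * M $ Zed $ Psi"
  proof -
    have "R * C = C * (p * R + qq) / k * (ff / k) - A * C / k * (A * C / k)"
      using nz(1) e2 by (simp add: divide_simps) algebra
    then show ?thesis by (simp add: M_def met_def abb)
  qed
  have "det M = det M1"
    unfolding M1_def
    by (rule det_block2[OF _ _ d1]) (use nz in \<open>auto simp: M_def met_def abb\<close>)
  also have "det M1 = prod (\<lambda>i. M1 $ i $ i) UNIV"
    by (rule det_diagonal) (auto simp: M1_def M_def met_def)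
  also have "\<dots> = k * g * (R * S * C)"
    using nz by (simp add: UNIV_space_ix M1_def M_def met_def abb)
  finally show ?thesis
    unfolding induced_metric_def metric_form_axis[OF q] r_def[symmetric] \<theta>_def[symmetric]
    by (simp add: M_def k_def g_def R_def S_def C_def wt_def power_mult_distrib)
qed

text \<open>Relative to \<^const>\<open>wt\<close> this is twice the energy density of \<open>T\<close>. The coefficient of the \<open>\<phi>\<close>
  derivative degenerates where \<open>f\<close> vanishes.\<close>

definition T_density :: "(real^ix \<Rightarrow> real) \<Rightarrow> real^ix \<Rightarrow> real" where
  "T_density U q = (let r = q $ Space Rad; \<theta> = q $ Space Theta in
     G r \<theta> * (partial Time U q)\<^sup>2 + f r \<theta> / (D r * (sin \<theta>)\<^sup>2) * (partial (Space Phi) U q)\<^sup>2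
     + (D r * (partial (Space Rad) U q)\<^sup>2 + (partial (Space Theta) U q)\<^sup>2
       + P r \<theta> * (partial (Space Zed) U q)\<^sup>2 + (partial (Space Psi) U q)\<^sup>2 / (cos \<theta>)\<^sup>2
       + qq / r\<^sup>2 * (partial (Space Zed) U q + partial (Space Psi) U q / Rz)\<^sup>2))"

text \<open>\<open>K\<close> is the geometric mean of \<open>f + Q1\<close> and
  \<open>f + Q2\<close>, hence lies between \<open>f + min Q1 Q2\<close> and
  \<open>P = f + Q1 + Q2\<close>. The bound \<open>D \<ge> qq / Rz\<^sup>2\<close> caps
  \<open>G - P = qq / D\<close> by \<open>Rz\<^sup>2\<close>, and with \<open>f \<le> D\<close> it
  bounds \<open>P\<close> by a multiple of \<open>D\<close>.\<close>

lemma coefficient_bounds: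
  "\<exists>\<kappa>\<ge>1. \<forall>r \<theta>. K r \<theta> \<le> G r \<theta> \<and> G r \<theta> \<le> \<kappa> * K r \<theta> \<and> K r \<theta> \<le> \<kappa> * D r \<and> f r \<theta> \<le> K r \<theta>"
proof -
  define b where "b = qq / Rz\<^sup>2"
  have b: "b > 0" using qq_pos Rz by (simp add: b_def)
  define m where "m = min Q1 Q2"
  have m: "0 < m" "m \<le> Q1" "m \<le> Q2" using Q1 Q2 by (auto simp: m_def)
  \<comment> \<open>\<open>k1\<close> bounds \<open>G\<close> by \<open>P\<close>, \<open>k2\<close>
    bounds \<open>P\<close> by \<open>K\<close>, and \<open>k5\<close> bounds \<open>P\<close> by
    \<open>D\<close>; \<kappa> is their product.\<close>
  define k1 where "k1 = 1 + Rz\<^sup>2 / (Q1 + Q2)"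
  define k2 where "k2 = (Q1 + Q2) / m"
  define k5 where "k5 = 1 + (Q1 + Q2) / b"
  have k1: "k1 \<ge> 1" using Q1 Q2 by (simp add: k1_def)
  have k2: "k2 \<ge> 1" using m Q1 Q2 by (simp add: k2_def)
  have k5: "k5 \<ge> 1" using Q1 Q2 b by (simp add: k5_def)
  have main: "K r \<theta> \<le> P r \<theta>" "P r \<theta> \<le> G r \<theta>" "G r \<theta> \<le> k1 * P r \<theta>" "P r \<theta> \<le> k2 * K r \<theta>"
    "P r \<theta> \<le> k5 * D r" "f r \<theta> \<le> K r \<theta>" for r \<theta>
  proof -
    have f: "f r \<theta> \<ge> 0" by (rule f_nonneg)
    have "K r \<theta> \<le> sqrt ((P r \<theta>)\<^sup>2)"
      unfolding K_def
    proof (rule real_sqrt_le_mono)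
      have "(f r \<theta> + Q1) * (f r \<theta> + Q2) \<le> P r \<theta> * P r \<theta>"
        by (rule mult_mono) (use f Q1 Q2 in \<open>auto simp: P_def\<close>)
      then show "(f r \<theta> + Q1) * (f r \<theta> + Q2) \<le> (P r \<theta>)\<^sup>2" by (simp add: power2_eq_square)
    qed
    then show "K r \<theta> \<le> P r \<theta>" using P_pos[of r \<theta>] by simp
    show "P r \<theta> \<le> G r \<theta>" using qq_pos D_pos[of r] by (simp add: G_def)
    have "qq / D r \<le> qq / b"
    proof (rule divide_left_mono)
      show "b \<le> D r" by (simp add: D_def b_def)
      show "0 < D r * b" using D_pos b by simp
    qed (use qq_pos in simp)
    also have "qq / b = Rz\<^sup>2" using qq_pos by (simp add: b_def)
    also have "\<dots> \<le> Rz\<^sup>2 / (Q1 + Q2) * P r \<theta>"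
      using f Q1 Q2 by (simp add: P_def field_simps)
    finally show "G r \<theta> \<le> k1 * P r \<theta>" by (simp add: G_def k1_def algebra_simps)
    have fm: "f r \<theta> + m \<le> K r \<theta>"
      unfolding K_def
    proof (rule real_le_rsqrt)
      have "(f r \<theta> + m) * (f r \<theta> + m) \<le> (f r \<theta> + Q1) * (f r \<theta> + Q2)"
        by (rule mult_mono) (use f m in auto)
      then show "(f r \<theta> + m)\<^sup>2 \<le> (f r \<theta> + Q1) * (f r \<theta> + Q2)" by (simp add: power2_eq_square)
    qed
    then show "f r \<theta> \<le> K r \<theta>" using m by simp
    have "P r \<theta> = f r \<theta> + k2 * m" using m by (simp add: P_def k2_def)
    also have "\<dots> \<le> k2 * f r \<theta> + k2 * m" using f k2 mult_right_mono[of 1 k2 "f r \<theta>"] by simp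
    also have "\<dots> \<le> k2 * K r \<theta>" using fm k2 mult_left_mono[OF fm, of k2] by (simp add: distrib_left)
    finally show "P r \<theta> \<le> k2 * K r \<theta>" .
    have "f r \<theta> \<le> D r" using qq_pos by (simp add: f_eq_D)
    moreover have "Q1 + Q2 \<le> (Q1 + Q2) / b * D r"
      using b Q1 Q2 by (simp add: D_def b_def[symmetric] field_simps)
    ultimately show "P r \<theta> \<le> k5 * D r" by (simp add: P_def k5_def algebra_simps)
  qed
  define \<kappa> where "\<kappa> = k1 * k2 * k5"
  have k12: "1 \<le> k1 * k2" using k1 k2 mult_mono[of 1 k1 1 k2] by simp
  have \<kappa>: "1 \<le> \<kappa>" "k1 * k2 \<le> \<kappa>" "k5 \<le> \<kappa>"
    using mult_mono[of 1 "k1 * k2" 1 k5] mult_left_mono[of 1 k5 "k1 * k2"] mult_right_mono[of 1 "k1 * k2" k5] k12 k5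
    by (simp_all add: \<kappa>_def)
  have "G r \<theta> \<le> \<kappa> * K r \<theta>" for r \<theta>
  proof -
    have "G r \<theta> \<le> k1 * (k2 * K r \<theta>)"
      by (rule order_trans[OF main(3) mult_left_mono[OF main(4)]]) (use k1 in simp)
    also have "\<dots> \<le> \<kappa> * K r \<theta>"
      using mult_right_mono[OF \<kappa>(2), of "K r \<theta>"] K_pos[of r \<theta>] by simp
    finally show ?thesis .
  qed
  moreover have "K r \<theta> \<le> \<kappa> * D r" for r \<theta>
    by (rule order_trans[OF order_trans[OF main(1,5)] mult_right_mono[OF \<kappa>(3)]])
      (use D_pos[of r] in simp)
  ultimately show ?thesis
    using \<kappa>(1) main(1,2,6) order_trans by (intro exI[of _ \<kappa>]) blast
qed

text \<open>Both densities have the same terms with comparable weights, except that the \<phi> term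
  carries \<open>1 / sin^2\<close> in the energy density and only \<open>f / (D sin^2)\<close> in
  \<open>T_density\<close>. The fact \<open>fS\<close> in the proof measures the gap, which becomes
  the extra term of the upper bound.\<close>

lemma density_comparison:
  "\<exists>\<kappa>\<ge>1. \<forall>U q. U differentiable (at q) \<longrightarrow> q \<in> chart \<longrightarrow>
     wt (q $ Space Rad) (q $ Space Theta) * T_density U q
       \<le> \<kappa> * (energy_density Q1 Q2 Rz U q * sqrt (det (induced_metric Q1 Q2 Rz q))) \<and>
     energy_density Q1 Q2 Rz U q * sqrt (det (induced_metric Q1 Q2 Rz q))
       \<le> \<kappa> * (wt (q $ Space Rad) (q $ Space Theta) * (T_density U q + (partial (Space Phi) U q)\<^sup>2 / D (q $ Space Rad)))"
proof -
  obtain \<kappa>0 where \<kappa>0: "\<kappa>0 \<ge> 1" and cb: "\<And>r \<theta>. K r \<theta> \<le> G r \<theta>" "\<And>r \<theta>. G r \<theta> \<le> \<kappa>0 * K r \<theta>"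
      "\<And>r \<theta>. K r \<theta> \<le> \<kappa>0 * D r" "\<And>r \<theta>. f r \<theta> \<le> K r \<theta>"
    using coefficient_bounds by blast
  \<comment> \<open>The factor \<open>1 + qq / Rz\<^sup>2\<close> absorbs the coefficient of the
    remainder in \<open>fS\<close>.\<close>
  define \<kappa> where "\<kappa> = \<kappa>0 * (1 + qq / Rz\<^sup>2)"
  have b: "qq / Rz\<^sup>2 > 0" using qq_pos Rz by simp
  have \<kappa>: "\<kappa> \<ge> \<kappa>0" "\<kappa>0 * (qq / Rz\<^sup>2) \<le> \<kappa>" "\<kappa> \<ge> 1"
  proof -
    show "\<kappa> \<ge> \<kappa>0" "\<kappa>0 * (qq / Rz\<^sup>2) \<le> \<kappa>"
      using \<kappa>0 qq_pos unfolding \<kappa>_def distrib_left by simp_all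
    then show "\<kappa> \<ge> 1" using \<kappa>0 by simp
  qed
  have "wt (q $ Space Rad) (q $ Space Theta) * T_density U q
       \<le> \<kappa> * (energy_density Q1 Q2 Rz U q * sqrt (det (induced_metric Q1 Q2 Rz q))) \<and>
     energy_density Q1 Q2 Rz U q * sqrt (det (induced_metric Q1 Q2 Rz q))
       \<le> \<kappa> * (wt (q $ Space Rad) (q $ Space Theta) * (T_density U q + (partial (Space Phi) U q)\<^sup>2 / D (q $ Space Rad)))"
    if U: "U differentiable (at q)" and q: "q \<in> chart" for U q
  proof -
    define r where "r = q $ Space Rad"
    define \<theta> where "\<theta> = q $ Space Theta"
    have pos: "r > 0" "sin \<theta> > 0" "cos \<theta> > 0" using chartD[OF q] by (simp_all add: r_def \<theta>_def)
    define w where "w = wt r \<theta>"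
    have w: "w > 0" using pos by (simp add: w_def wt_def)
    define k where "k = K r \<theta>"
    define g where "g = G r \<theta>"
    define d where "d = D r"
    define ff where "ff = f r \<theta>"
    \<comment> \<open>The volume density of the slice is \<open>s\<close> times \<open>wt\<close>.
      As a geometric mean, \<open>s\<close> lies between \<open>K\<close> and \<open>G\<close>,
      which are comparable.\<close>
    define s where "s = sqrt (k * g)"
    have p: "k > 0" "g > 0" "d > 0" "ff > 0" using K_pos G_pos D_pos f_pos pos
      by (simp_all add: k_def g_def d_def ff_def)
    have c: "k \<le> g" "g \<le> \<kappa>0 * k" "k \<le> \<kappa>0 * d" "ff \<le> k"
      using cb by (simp_all add: k_def g_def d_def ff_def)
    have s: "s > 0" "s * s = k * g" using p by (simp_all add: s_def)
    have s1: "s \<le> g" "k \<le> s"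
      using p c by (auto simp: s_def intro!: real_le_lsqrt real_le_rsqrt mult_mono simp: power2_eq_square)
    have s2: "g \<le> \<kappa>0 * s" "s \<le> \<kappa>0 * k"
      using order_trans[OF c(2) mult_left_mono[OF s1(2)]] order_trans[OF s1(1) c(2)] \<kappa>0 by auto
    define T2 where "T2 = (partial Time U q)\<^sup>2"
    define F2 where "F2 = (partial (Space Phi) U q)\<^sup>2"
    define X where "X = D r * (partial (Space Rad) U q)\<^sup>2 + (partial (Space Theta) U q)\<^sup>2
       + P r \<theta> * (partial (Space Zed) U q)\<^sup>2 + (partial (Space Psi) U q)\<^sup>2 / (cos \<theta>)\<^sup>2
       + qq / r\<^sup>2 * (partial (Space Zed) U q + partial (Space Psi) U q / Rz)\<^sup>2"
    define S where "S = (sin \<theta>)\<^sup>2"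
    have S: "S > 0" using pos by (simp add: S_def)
    have nn: "T2 \<ge> 0" "F2 \<ge> 0" "X \<ge> 0"
      using D_pos[of r] P_pos[of r \<theta>] qq_pos by (auto simp: T2_def F2_def X_def intro!: add_nonneg_nonneg)
    have E: "energy_density Q1 Q2 Rz U q = T2 + X / k + k / (d * g) * (F2 / S)"
      unfolding energy_density_chart[OF q U] Let_def r_def[symmetric] \<theta>_def[symmetric]
      by (simp add: T2_def X_def F2_def k_def d_def g_def S_def)
    have T: "T_density U q = g * T2 + ff / (d * S) * F2 + X"
      unfolding T_density_def Let_def r_def[symmetric] \<theta>_def[symmetric]
      by (simp add: T2_def X_def F2_def ff_def d_def g_def S_def)
    have V: "sqrt (det (induced_metric Q1 Q2 Rz q)) = s * w"
      unfolding det_induced_metric[OF q] r_def[symmetric] \<theta>_def[symmetric]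
      using w by (simp add: s_def k_def g_def w_def real_sqrt_mult)
    have fS: "1 / S = ff / (d * S) + qq / Rz\<^sup>2 / d"
    proof -
      have "d = ff + qq / Rz\<^sup>2 * S" by (simp add: d_def ff_def S_def f_eq_D)
      then have "d / (d * S) = ff / (d * S) + qq / Rz\<^sup>2 * S / (d * S)" by (metis add_divide_distrib)
      then show ?thesis using S p by simp
    qed
    have low: "T_density U q \<le> \<kappa>0 * (s * (T2 + X / k + k / (d * g) * (F2 / S)))"
    proof -
      have "g * T2 \<le> \<kappa>0 * s * T2" using s2 nn by (intro mult_right_mono) auto
      moreover have "X \<le> \<kappa>0 * s * (X / k)"
      proof -
        have "k * 1 \<le> s * \<kappa>0" using s1 \<kappa>0 p s by (intro mult_mono) auto
        then have "1 \<le> \<kappa>0 * s / k" using p by (simp add: mult.commute)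
        from mult_right_mono[OF this nn(3)] show ?thesis by simp
      qed
      moreover have "ff / (d * S) * F2 \<le> \<kappa>0 * s * (k / (d * g) * (F2 / S))"
      proof -
        have "ff * g \<le> k * (\<kappa>0 * s)" using c s2 p by (intro mult_mono) auto
        then have "ff \<le> \<kappa>0 * s * k / g" using p by (simp add: pos_le_divide_eq mult_ac)
        then have "ff * (F2 / (d * S)) \<le> \<kappa>0 * s * k / g * (F2 / (d * S))"
          using nn p S by (intro mult_right_mono) auto
        then show ?thesis by (simp add: mult_ac)
      qed
      ultimately show ?thesis unfolding T by (simp add: algebra_simps)
    qed
    have up: "s * (T2 + X / k + k / (d * g) * (F2 / S)) \<le> \<kappa> * (T_density U q + F2 / d)"
    proof -
      have "s * T2 \<le> \<kappa> * (g * T2)"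
      proof -
        have "1 * s \<le> \<kappa> * g" using \<kappa> s1 p s by (intro mult_mono) auto
        then show ?thesis using mult_right_mono[OF _ nn(1)] by fastforce
      qed
      moreover have "s * (X / k) \<le> \<kappa> * X"
      proof -
        have "s \<le> \<kappa> * k" using order_trans[OF s2(2) mult_right_mono[OF \<kappa>(1)]] p by simp
        then have "s / k \<le> \<kappa>" using p by (simp add: pos_divide_le_eq)
        from mult_right_mono[OF this nn(3)] show ?thesis by simp
      qed
      moreover have "s * (k / (d * g) * (F2 / S)) \<le> \<kappa> * (ff / (d * S) * F2 + F2 / d)"
      proof -
        have "s * k \<le> g * (\<kappa>0 * d)" using s1 c p s by (intro mult_mono) auto
        then have "s * k / (d * g) \<le> \<kappa>0" using p by (simp add: pos_divide_le_eq mult_ac)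
        then have "s * k / (d * g) * (F2 / S) \<le> \<kappa>0 * (F2 / S)"
          using nn S by (intro mult_right_mono) auto
        also have "\<kappa>0 * (F2 / S) = \<kappa>0 * F2 * (1 / S)" by simp
        also have "\<dots> = \<kappa>0 * (ff / (d * S) * F2) + \<kappa>0 * (qq / Rz\<^sup>2) * (F2 / d)"
          unfolding fS by (simp add: algebra_simps)
        also have "\<dots> \<le> \<kappa> * (ff / (d * S) * F2) + \<kappa> * (F2 / d)"
          using \<kappa> nn p S by (intro add_mono mult_right_mono) auto
        finally show ?thesis by (simp add: algebra_simps)
      qed
      ultimately show ?thesis unfolding T by (simp add: algebra_simps)
    qed
    let ?e = "T2 + X / k + k / (d * g) * (F2 / S)"
    have e0: "0 \<le> s * ?e" using s nn p S by (intro mult_nonneg_nonneg add_nonneg_nonneg) auto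
    have "w * T_density U q \<le> w * (\<kappa> * (s * ?e))"
      using low mult_right_mono[OF \<kappa>(1) e0] w by (intro mult_left_mono) auto
    moreover have "w * (s * ?e) \<le> w * (\<kappa> * (T_density U q + F2 / d))"
      using up w by (intro mult_left_mono) auto
    ultimately show ?thesis
      unfolding E V r_def[symmetric] \<theta>_def[symmetric] w_def[symmetric] F2_def[symmetric] d_def[symmetric]
      by (simp add: mult_ac)
  qed
  then show ?thesis using \<kappa>(3) by blast
qed

end

section \<open>Integration over coordinate boxes\<close>

lemma integral_outer_derivative:
  fixes F F' :: "real \<times> 'b::euclidean_space \<Rightarrow> real"
  assumes ab: "a \<le> b" and c: "continuous_on (cbox (a, c) (b, d)) F'"
    and D: "\<And>x y. x \<in> {a..b} \<Longrightarrow> y \<in> cbox c d \<Longrightarrow>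
      ((\<lambda>x. F (x, y)) has_real_derivative F' (x, y)) (at x within {a..b})"
  shows "integral (cbox (a, c) (b, d)) F' = integral (cbox c d) (\<lambda>y. F (b, y) - F (a, y))"
proof -
  have "integral (cbox (a, c) (b, d)) F' = integral (cbox a b) (\<lambda>x. integral (cbox c d) (\<lambda>y. F' (x, y)))"
    by (rule integral_prod_continuous[OF c])
  also have "\<dots> = integral (cbox c d) (\<lambda>y. integral (cbox a b) (\<lambda>x. F' (x, y)))"
    by (rule integral_swap_continuous) (simp add: c)
  also have "\<dots> = integral (cbox c d) (\<lambda>y. F (b, y) - F (a, y))"
  proof (rule integral_cong)
    fix y assume "y \<in> cbox c d"
    then have "((\<lambda>x. F' (x, y)) has_integral (F (b, y) - F (a, y))) {a..b}"
      using D by (intro fundamental_theorem_of_calculus[OF ab])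
        (auto simp: has_real_derivative_iff_has_vector_derivative)
    then show "integral (cbox a b) (\<lambda>x. F' (x, y)) = F (b, y) - F (a, y)"
      by (simp add: integral_unique)
  qed
  finally show ?thesis .
qed

lemma integral_outer_derivative_bound:
  fixes F F' :: "real \<times> 'b::euclidean_space \<Rightarrow> real"
  assumes "a \<le> b" "continuous_on (cbox (a, c) (b, d)) F'"
    "\<And>x y. x \<in> {a..b} \<Longrightarrow> y \<in> cbox c d \<Longrightarrow>
      ((\<lambda>x. F (x, y)) has_real_derivative F' (x, y)) (at x within {a..b})"
    and M: "\<And>y. y \<in> cbox c d \<Longrightarrow> \<bar>F (b, y) - F (a, y)\<bar> \<le> M" "M \<ge> 0"
    and cont: "continuous_on (cbox c d) (\<lambda>y. F (b, y) - F (a, y))"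
  shows "\<bar>integral (cbox (a, c) (b, d)) F'\<bar> \<le> M * measure lborel (cbox c d)"
proof -
  have e: "integral (cbox (a, c) (b, d)) F' = integral (cbox c d) (\<lambda>y. F (b, y) - F (a, y))"
    by (rule integral_outer_derivative[OF assms(1-3)])
  show ?thesis
    unfolding e using integrable_bound[of M "\<lambda>y. F (b, y) - F (a, y)" c d] integrable_continuous[OF cont] M
    by simp
qed

text \<open>The premise on a slice may assume that the slice is continuous, so that the lemma can be
  applied again to the slice and one variable is peeled off at a time.\<close>

lemma integral_slices_bound:
  fixes F' :: "real \<times> 'b::euclidean_space \<Rightarrow> real"
  assumes ab: "a \<le> b" and c: "continuous_on (cbox (a, c) (b, d)) F'"
    and M': "\<And>x. x \<in> {a..b} \<Longrightarrow> continuous_on (cbox c d) (\<lambda>y. F' (x, y)) \<Longrightarrow>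
        \<bar>integral (cbox c d) (\<lambda>y. F' (x, y))\<bar> \<le> M" and M0: "M \<ge> 0"
  shows "\<bar>integral (cbox (a, c) (b, d)) F'\<bar> \<le> M * (b - a)"
proof -
  have "continuous_on (cbox c d) (\<lambda>y. F' (x, y))" if "x \<in> {a..b}" for x
    by (rule continuous_on_compose2[OF c]) (use that in \<open>auto simp: cbox_Pair_eq intro!: continuous_intros\<close>)
  note M = M'[OF _ this] M0
  have "continuous_on (cbox a b) (\<lambda>x. integral (cbox c d) (\<lambda>y. F' (x, y)))"
    using integral_continuous_on_param[of "cbox a b" c d "\<lambda>x y. F' (x, y)"] c
    by (simp add: cbox_Pair_eq)
  then have "(\<lambda>x. integral (cbox c d) (\<lambda>y. F' (x, y))) integrable_on cbox a b"
    by (rule integrable_continuous)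
  then show ?thesis
    unfolding integral_prod_continuous[OF c]
    using integrable_bound[of M "\<lambda>x. integral (cbox c d) (\<lambda>y. F' (x, y))" a b] M ab
    by simp
qed

text \<open>Passes from gauge integrals, in which the divergence theorem is carried out, to the
  extended nonnegative integrals that define the energies.\<close>

lemma nn_integral_cbox_continuous:
  fixes F :: "'a::euclidean_space \<Rightarrow> real"
  assumes c: "continuous_on (cbox a b) F" and nn: "\<And>x. x \<in> cbox a b \<Longrightarrow> F x \<ge> 0"
  shows "(\<integral>\<^sup>+ x \<in> cbox a b. ennreal (F x) \<partial>lborel) = ennreal (integral (cbox a b) F)"
proof -
  have i: "integrable lborel (\<lambda>x. indicator (cbox a b) x *\<^sub>R F x)"
    by (rule borel_integrable_compact[OF compact_cbox c])
  have "(\<integral>\<^sup>+ x \<in> cbox a b. ennreal (F x) \<partial>lborel)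
      = (\<integral>\<^sup>+ x. ennreal (indicator (cbox a b) x *\<^sub>R F x) \<partial>lborel)"
    by (rule nn_integral_cong) (auto simp: indicator_def)
  also have "\<dots> = ennreal (LINT x|lborel. indicator (cbox a b) x *\<^sub>R F x)"
    by (rule nn_integral_eq_integral[OF i]) (auto simp: indicator_def nn)
  also have "(LINT x|lborel. indicator (cbox a b) x *\<^sub>R F x) = integral (cbox a b) F"
    using set_borel_integral_eq_integral(2)[of "cbox a b" F] i
    by (simp add: set_integrable_def set_lebesgue_integral_def)
  finally show ?thesis .
qed

text \<open>Squaring makes the positive part continuously differentiable across 0, so a cutoff of
  this form can be differentiated everywhere and still vanishes identically outside a bounded range
  of r.\<close>

lemma DERIV_pos_part_squared:
  "((\<lambda>x::real. (max 0 x)\<^sup>2) has_real_derivative 2 * max 0 x) (at x within S)"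
proof -
  have "((\<lambda>x::real. (max 0 x)\<^sup>2) has_real_derivative 2 * max 0 x) (at x)"
  proof (rule linorder_cases[of x 0])
    assume x: "x < 0"
    have "((\<lambda>x::real. 0) has_real_derivative 0) (at x)" by simp
    then have "((\<lambda>x::real. (max 0 x)\<^sup>2) has_real_derivative 0) (at x)"
      by (rule has_field_derivative_transform_within_open[where S="{..<0}"]) (use x in auto)
    then show ?thesis using x by simp
  next
    assume x: "0 < x"
    have "((\<lambda>x::real. x\<^sup>2) has_real_derivative 2 * x) (at x)"
      by (auto intro!: derivative_eq_intros)
    then have "((\<lambda>x::real. (max 0 x)\<^sup>2) has_real_derivative 2 * x) (at x)"
      by (rule has_field_derivative_transform_within_open[where S="{0<..}"]) (use x in auto)
    then show ?thesis using x by simp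
  next
    assume x: "x = 0"
    have "(\<lambda>y::real. (max 0 y)\<^sup>2 / y) \<midarrow>0\<rightarrow> 0"
    proof (rule Lim_null_comparison)
      show "\<forall>\<^sub>F y in at 0. norm ((max 0 y)\<^sup>2 / y) \<le> \<bar>y::real\<bar>"
        by (rule always_eventually) (auto simp: max_def power2_eq_square)
      show "(\<lambda>y::real. \<bar>y\<bar>) \<midarrow>0\<rightarrow> 0" by (rule tendsto_eq_intros | simp)+
    qed
    then show ?thesis unfolding x has_field_derivative_iff by simp
  qed
  then show ?thesis by (rule has_field_derivative_at_within)
qed

lemma integral_slices_zero:
  fixes H :: "real \<times> 'b::euclidean_space \<Rightarrow> real"
  assumes "a \<le> b" "continuous_on (cbox (a, c) (b, d)) H"
    "\<And>x. x \<in> {a..b} \<Longrightarrow> continuous_on (cbox c d) (\<lambda>y. H (x, y)) \<Longrightarrow> integral (cbox c d) (\<lambda>y. H (x, y)) = 0"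
  shows "integral (cbox (a, c) (b, d)) H = 0"
  using integral_slices_bound[OF assms(1,2), of 0] assms(3) by simp

lemma integral_outer_derivative_zero:
  fixes F F' :: "real \<times> 'b::euclidean_space \<Rightarrow> real"
  assumes "a \<le> b" "continuous_on (cbox (a, c) (b, d)) F'"
    "\<And>x y. x \<in> {a..b} \<Longrightarrow> y \<in> cbox c d \<Longrightarrow>
      ((\<lambda>x. F (x, y)) has_real_derivative F' (x, y)) (at x within {a..b})"
    and per: "\<And>y. F (b, y) = F (a, y)"
  shows "integral (cbox (a, c) (b, d)) F' = 0"
proof -
  have "integral (cbox (a, c) (b, d)) F' = integral (cbox c d) (\<lambda>y. F (b, y) - F (a, y))"
    by (rule integral_outer_derivative[OF assms(1-3)])
  then show ?thesis by (simp add: per)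
qed

text \<open>One divergence term on a six-dimensional box: \<open>F'\<close> is the derivative of
  \<open>F\<close> in one of the variables, chosen by each lemma. Time keeps its exact boundary
  values, r and \<theta> need only bounds on the faces, and in the angles periodicity makes the
  integral zero.\<close>

locale box6 =
  fixes a1 b1 a2 b2 a3 b3 a4 b4 a5 b5 a6 b6 :: real
    and F F' :: "real \<Rightarrow> real \<Rightarrow> real \<Rightarrow> real \<Rightarrow> real \<Rightarrow> real \<Rightarrow> real"
  assumes ab: "a1 \<le> b1" "a2 \<le> b2" "a3 \<le> b3" "a4 \<le> b4" "a5 \<le> b5" "a6 \<le> b6"
    and cont: "continuous_on (cbox (a1, a2, a3, a4, a5, a6) (b1, b2, b3, b4, b5, b6))
        (\<lambda>(t, r, \<theta>, \<phi>, \<psi>, z). F' t r \<theta> \<phi> \<psi> z)"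
begin

abbreviation "in_box t r \<theta> \<phi> \<psi> z \<equiv> t \<in> {a1..b1} \<and> r \<in> {a2..b2} \<and> \<theta> \<in> {a3..b3} \<and>
  \<phi> \<in> {a4..b4} \<and> \<psi> \<in> {a5..b5} \<and> z \<in> {a6..b6}"

abbreviation "integral_box \<equiv> integral (cbox (a1, a2, a3, a4, a5, a6) (b1, b2, b3, b4, b5, b6))
  (\<lambda>(t, r, \<theta>, \<phi>, \<psi>, z). F' t r \<theta> \<phi> \<psi> z)"

lemma integral_deriv_1:
  assumes "\<And>t r \<theta> \<phi> \<psi> z. in_box t r \<theta> \<phi> \<psi> z
      \<Longrightarrow> ((\<lambda>t. F t r \<theta> \<phi> \<psi> z) has_real_derivative F' t r \<theta> \<phi> \<psi> z) (at t within {a1..b1})"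
  shows "integral_box = integral (cbox (a2, a3, a4, a5, a6) (b2, b3, b4, b5, b6))
    (\<lambda>(r, \<theta>, \<phi>, \<psi>, z). F b1 r \<theta> \<phi> \<psi> z - F a1 r \<theta> \<phi> \<psi> z)"
  using integral_outer_derivative[OF ab(1) cont, of "\<lambda>(t, r, \<theta>, \<phi>, \<psi>, z). F t r \<theta> \<phi> \<psi> z"] assms
  by (force simp: cbox_Pair_eq case_prod_unfold)

lemma integral_deriv_2:
  assumes d: "\<And>t r \<theta> \<phi> \<psi> z. in_box t r \<theta> \<phi> \<psi> z
      \<Longrightarrow> ((\<lambda>r. F t r \<theta> \<phi> \<psi> z) has_real_derivative F' t r \<theta> \<phi> \<psi> z) (at r within {a2..b2})"
    and M: "\<And>t \<theta> \<phi> \<psi> z. in_box t a2 \<theta> \<phi> \<psi> z \<Longrightarrow> \<bar>F t b2 \<theta> \<phi> \<psi> z - F t a2 \<theta> \<phi> \<psi> z\<bar> \<le> M" "M \<ge> 0"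
    and c: "\<And>t. t \<in> {a1..b1} \<Longrightarrow> continuous_on (cbox (a3, a4, a5, a6) (b3, b4, b5, b6))
      (\<lambda>(\<theta>, \<phi>, \<psi>, z). F t b2 \<theta> \<phi> \<psi> z - F t a2 \<theta> \<phi> \<psi> z)"
  shows "\<bar>integral_box\<bar> \<le> M * measure lborel (cbox (a3, a4, a5, a6) (b3, b4, b5, b6)) * (b1 - a1)"
proof (rule integral_slices_bound[OF ab(1) cont])
  fix t assume t: "t \<in> {a1..b1}"
    and ct: "continuous_on (cbox (a2, a3, a4, a5, a6) (b2, b3, b4, b5, b6))
      (\<lambda>y. case (t, y) of (t, r, \<theta>, \<phi>, \<psi>, z) \<Rightarrow> F' t r \<theta> \<phi> \<psi> z)"
  show "\<bar>integral (cbox (a2, a3, a4, a5, a6) (b2, b3, b4, b5, b6))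
      (\<lambda>y. case (t, y) of (t, r, \<theta>, \<phi>, \<psi>, z) \<Rightarrow> F' t r \<theta> \<phi> \<psi> z)\<bar>
     \<le> M * measure lborel (cbox (a3, a4, a5, a6) (b3, b4, b5, b6))"
    by (rule integral_outer_derivative_bound[OF ab(2) ct, of "\<lambda>(r, \<theta>, \<phi>, \<psi>, z). F t r \<theta> \<phi> \<psi> z"])
      (use t d M c[OF t] ab in \<open>auto simp: cbox_Pair_eq case_prod_unfold\<close>)
qed (use M in \<open>simp add: measure_nonneg\<close>)

lemma integral_deriv_3:
  assumes d: "\<And>t r \<theta> \<phi> \<psi> z. in_box t r \<theta> \<phi> \<psi> z
      \<Longrightarrow> ((\<lambda>\<theta>. F t r \<theta> \<phi> \<psi> z) has_real_derivative F' t r \<theta> \<phi> \<psi> z) (at \<theta> within {a3..b3})"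
    and M: "\<And>t r \<phi> \<psi> z. in_box t r a3 \<phi> \<psi> z \<Longrightarrow> \<bar>F t r b3 \<phi> \<psi> z - F t r a3 \<phi> \<psi> z\<bar> \<le> M" "M \<ge> 0"
    and c: "\<And>t r. t \<in> {a1..b1} \<Longrightarrow> r \<in> {a2..b2} \<Longrightarrow> continuous_on (cbox (a4, a5, a6) (b4, b5, b6))
      (\<lambda>(\<phi>, \<psi>, z). F t r b3 \<phi> \<psi> z - F t r a3 \<phi> \<psi> z)"
  shows "\<bar>integral_box\<bar> \<le> M * measure lborel (cbox (a4, a5, a6) (b4, b5, b6)) * (b2 - a2) * (b1 - a1)"
proof (rule integral_slices_bound[OF ab(1) cont], rule integral_slices_bound[OF ab(2)], assumption)
  fix t r assume t: "t \<in> {a1..b1}" and r: "r \<in> {a2..b2}"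
    and cr: "continuous_on (cbox (a3, a4, a5, a6) (b3, b4, b5, b6))
      (\<lambda>y. case (t, r, y) of (t, r, \<theta>, \<phi>, \<psi>, z) \<Rightarrow> F' t r \<theta> \<phi> \<psi> z)"
  show "\<bar>integral (cbox (a3, a4, a5, a6) (b3, b4, b5, b6))
      (\<lambda>y. case (t, r, y) of (t, r, \<theta>, \<phi>, \<psi>, z) \<Rightarrow> F' t r \<theta> \<phi> \<psi> z)\<bar>
     \<le> M * measure lborel (cbox (a4, a5, a6) (b4, b5, b6))"
    by (rule integral_outer_derivative_bound[OF ab(3) cr, of "\<lambda>(\<theta>, \<phi>, \<psi>, z). F t r \<theta> \<phi> \<psi> z"])
      (use t r d M c[OF t r] ab in \<open>auto simp: cbox_Pair_eq case_prod_unfold\<close>)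
qed (use M ab in \<open>simp_all add: measure_nonneg\<close>)

lemma integral_deriv_4:
  assumes d: "\<And>t r \<theta> \<phi> \<psi> z. in_box t r \<theta> \<phi> \<psi> z
      \<Longrightarrow> ((\<lambda>\<phi>. F t r \<theta> \<phi> \<psi> z) has_real_derivative F' t r \<theta> \<phi> \<psi> z) (at \<phi> within {a4..b4})"
    and per: "\<And>t r \<theta> \<psi> z. F t r \<theta> b4 \<psi> z = F t r \<theta> a4 \<psi> z"
  shows "integral_box = 0"
proof (rule integral_slices_zero[OF ab(1) cont], rule integral_slices_zero[OF ab(2)], assumption,
    rule integral_slices_zero[OF ab(3)], assumption)
  fix t r \<theta> assume "t \<in> {a1..b1}" "r \<in> {a2..b2}" "\<theta> \<in> {a3..b3}"
    and "continuous_on (cbox (a4, a5, a6) (b4, b5, b6))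
      (\<lambda>y. case (t, r, \<theta>, y) of (t, r, \<theta>, \<phi>, \<psi>, z) \<Rightarrow> F' t r \<theta> \<phi> \<psi> z)"
  then show "integral (cbox (a4, a5, a6) (b4, b5, b6))
      (\<lambda>y. case (t, r, \<theta>, y) of (t, r, \<theta>, \<phi>, \<psi>, z) \<Rightarrow> F' t r \<theta> \<phi> \<psi> z) = 0"
    by (intro integral_outer_derivative_zero[OF ab(4), where F="\<lambda>(\<phi>, \<psi>, z). F t r \<theta> \<phi> \<psi> z"])
      (use d per in \<open>auto simp: cbox_Pair_eq\<close>)
qed

lemma integral_deriv_5:
  assumes d: "\<And>t r \<theta> \<phi> \<psi> z. in_box t r \<theta> \<phi> \<psi> z
      \<Longrightarrow> ((\<lambda>\<psi>. F t r \<theta> \<phi> \<psi> z) has_real_derivative F' t r \<theta> \<phi> \<psi> z) (at \<psi> within {a5..b5})"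
    and per: "\<And>t r \<theta> \<phi> z. F t r \<theta> \<phi> b5 z = F t r \<theta> \<phi> a5 z"
  shows "integral_box = 0"
proof (rule integral_slices_zero[OF ab(1) cont], rule integral_slices_zero[OF ab(2)], assumption,
    rule integral_slices_zero[OF ab(3)], assumption, rule integral_slices_zero[OF ab(4)], assumption)
  fix t r \<theta> \<phi> assume "t \<in> {a1..b1}" "r \<in> {a2..b2}" "\<theta> \<in> {a3..b3}" "\<phi> \<in> {a4..b4}"
    and "continuous_on (cbox (a5, a6) (b5, b6))
      (\<lambda>y. case (t, r, \<theta>, \<phi>, y) of (t, r, \<theta>, \<phi>, \<psi>, z) \<Rightarrow> F' t r \<theta> \<phi> \<psi> z)"
  then show "integral (cbox (a5, a6) (b5, b6))
      (\<lambda>y. case (t, r, \<theta>, \<phi>, y) of (t, r, \<theta>, \<phi>, \<psi>, z) \<Rightarrow> F' t r \<theta> \<phi> \<psi> z) = 0"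
    by (intro integral_outer_derivative_zero[OF ab(5), where F="\<lambda>(\<psi>, z). F t r \<theta> \<phi> \<psi> z"])
      (use d per in \<open>auto simp: cbox_Pair_eq\<close>)
qed

lemma integral_deriv_6:
  assumes d: "\<And>t r \<theta> \<phi> \<psi> z. in_box t r \<theta> \<phi> \<psi> z
      \<Longrightarrow> ((\<lambda>z. F t r \<theta> \<phi> \<psi> z) has_real_derivative F' t r \<theta> \<phi> \<psi> z) (at z within {a6..b6})"
    and per: "\<And>t r \<theta> \<phi> \<psi>. F t r \<theta> \<phi> \<psi> b6 = F t r \<theta> \<phi> \<psi> a6"
  shows "integral_box = 0"
proof (rule integral_slices_zero[OF ab(1) cont], rule integral_slices_zero[OF ab(2)], assumption,
    rule integral_slices_zero[OF ab(3)], assumption, rule integral_slices_zero[OF ab(4)], assumption,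
    rule integral_slices_zero[OF ab(5)], assumption)
  fix t r \<theta> \<phi> \<psi> assume "t \<in> {a1..b1}" "r \<in> {a2..b2}" "\<theta> \<in> {a3..b3}" "\<phi> \<in> {a4..b4}" "\<psi> \<in> {a5..b5}"
  then have "((\<lambda>z. F' t r \<theta> \<phi> \<psi> z) has_integral (F t r \<theta> \<phi> \<psi> b6 - F t r \<theta> \<phi> \<psi> a6)) {a6..b6}"
    using d by (intro fundamental_theorem_of_calculus[OF ab(6)])
      (auto simp: has_real_derivative_iff_has_vector_derivative)
  then show "integral (cbox a6 b6) (\<lambda>y. case (t, r, \<theta>, \<phi>, \<psi>, y) of (t, r, \<theta>, \<phi>, \<psi>, z) \<Rightarrow> F' t r \<theta> \<phi> \<psi> z) = 0"
    by (simp add: per integral_unique)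
qed

end

section \<open>The T-energy estimate\<close>

lemma partial_shift:
  fixes F :: "real^'n::finite \<Rightarrow> real"
  assumes F: "smooth_on UNIV F" and per: "\<And>y. F (y + v) = F y"
  shows "partial i F (q + v) = partial i F q"
proof -
  have e: "F (q + v + s *\<^sub>R axis i 1) = F (q + s *\<^sub>R axis i 1)" for s
    using per[of "q + s *\<^sub>R axis i 1"] by (simp add: add_ac)
  have "((\<lambda>s. F (q + s *\<^sub>R axis i 1)) has_real_derivative partial i F (q + v)) (at 0)"
    using partial_along_line[OF F, of "q + v" i 0 UNIV] unfolding e by simp
  moreover have "((\<lambda>s. F (q + s *\<^sub>R axis i 1)) has_real_derivative partial i F q) (at 0)"
    using partial_along_line[OF F, of q i 0 UNIV] by simp
  ultimately show ?thesis by (rule DERIV_unique)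
qed

context two_charge
begin

definition angle_periodic :: "(real^ix \<Rightarrow> real) \<Rightarrow> bool" where
  "angle_periodic F \<longleftrightarrow> (\<forall>q. F (q + (2 * pi) *\<^sub>R axis (Space Phi) 1) = F q \<and>
     F (q + (2 * pi) *\<^sub>R axis (Space Psi) 1) = F q \<and> F (q + (2 * pi * Rz) *\<^sub>R axis (Space Zed) 1) = F q)"

lemma angle_periodic_partial:
  "smooth_on UNIV F \<Longrightarrow> angle_periodic F \<Longrightarrow> angle_periodic (partial i F)"
  unfolding angle_periodic_def by (intro allI conjI partial_shift) auto

lemma angle_periodic_coords:
  assumes "angle_periodic F"
  shows "F (coords t (r, \<theta>, 2 * pi, \<psi>, z)) = F (coords t (r, \<theta>, 0, \<psi>, z))"
    "F (coords t (r, \<theta>, \<phi>, 2 * pi, z)) = F (coords t (r, \<theta>, \<phi>, 0, z))"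
    "F (coords t (r, \<theta>, \<phi>, \<psi>, 2 * pi * Rz)) = F (coords t (r, \<theta>, \<phi>, \<psi>, 0))"
  using assms coords_affine(4)[of t r \<theta> "2 * pi" \<psi> z] coords_affine(5)[of t r \<theta> \<phi> "2 * pi" z]
    coords_affine(6)[of t r \<theta> \<phi> \<psi> "2 * pi * Rz"]
  unfolding angle_periodic_def by metis+

text \<open>A shift of z by its period \<open>2 * pi * Rz\<close> also turns the sphere angle
  \<open>\<psi> - z / Rz\<close> by a full turn, so both factors of the point return.\<close>

lemma angle_periodic_comp: "angle_periodic (u \<circ> coord_map Rz)"
proof -
  have c: "coord_map Rz (q + (2 * pi) *\<^sub>R axis (Space Phi) 1) = coord_map Rz q"
    "coord_map Rz (q + (2 * pi) *\<^sub>R axis (Space Psi) 1) = coord_map Rz q"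
    "coord_map Rz (q + (2 * pi * Rz) *\<^sub>R axis (Space Zed) 1) = coord_map Rz q" for q
  proof -
    have p: "cis (x + 2 * pi) = cis x" "cis (x - 2 * pi) = cis x" for x
      by (simp_all add: complex_eq_iff cos_diff sin_diff)
    have a: "y + 2 * pi - x = (y - x) + 2 * pi" "y - (x + 2 * pi) = (y - x) - 2 * pi"
      "(x + 2 * pi * Rz) / Rz = x / Rz + 2 * pi" for x y
      using Rz by (simp_all add: field_simps)
    show "coord_map Rz (q + (2 * pi) *\<^sub>R axis (Space Phi) 1) = coord_map Rz q"
      "coord_map Rz (q + (2 * pi) *\<^sub>R axis (Space Psi) 1) = coord_map Rz q"
      "coord_map Rz (q + (2 * pi * Rz) *\<^sub>R axis (Space Zed) 1) = coord_map Rz q"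
      by (simp_all add: coord_map_def Let_def axis_def a p)
  qed
  show ?thesis by (simp add: angle_periodic_def c)
qed

text \<open>The cutoff moves inwards at no less than the speed of light, so that the flux through it
  is outgoing. This gives an energy bound without finite speed of propagation.\<close>

definition speed :: real where "speed = 1 + qq / Rz\<^sup>2 / (Q1 + Q2)"

definition cutoff :: "real \<Rightarrow> real \<Rightarrow> real \<Rightarrow> real" where
  "cutoff R t r = (max 0 (1 - (r + speed * t) / R))\<^sup>2"

lemma speed_ge_1: "speed \<ge> 1"
  using qq_pos Q1 Q2 by (simp add: speed_def)

text \<open>\<open>D / G\<close> equals \<open>- g^rr / g^tt\<close>, the square of the coordinate
  speed of the radial light fronts. As \<open>speed\<close> is at least 1, bounding the square by
  \<open>speed\<close> also bounds the speed itself. The proof uses that \<open>r\<^sup>2\<close>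
  and \<open>Q1 + Q2\<close> can be charged to \<open>P\<close>.\<close>

lemma D_le_speed_G: "D r \<le> speed * G r \<theta>"
proof -
  have "D r \<le> r\<^sup>2 + qq / Rz\<^sup>2 / (Q1 + Q2) * (Q1 + Q2)" using Q1 Q2 by (simp add: D_def)
  also have "\<dots> \<le> P r \<theta> + qq / Rz\<^sup>2 / (Q1 + Q2) * P r \<theta>"
    by (intro add_mono mult_left_mono) (use qq_pos Q1 Q2 in \<open>auto simp: P_def f_def\<close>)
  also have "\<dots> = speed * P r \<theta>" by (simp add: speed_def algebra_simps)
  also have "\<dots> \<le> speed * G r \<theta>"
    by (rule mult_left_mono) (use qq_pos D_pos[of r] speed_ge_1 in \<open>auto simp: G_def\<close>)
  finally show ?thesis .
qed

text \<open>The coefficients \<open>c1\<close> to \<open>c5\<close> are the \<phi>\<phi>, t\<phi>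
  (with opposite sign), zz, z\<psi> and \<psi>\<psi> entries of \<open>K\<close> times the inverse
  metric. Naming them keeps them opaque in the polynomial identity for the divergence.\<close>

definition c1 where "c1 r \<theta> = f r \<theta> / (D r * (sin \<theta>)\<^sup>2)"
definition c2 where "c2 r = qq / Rz / D r"
definition c3 where "c3 r \<theta> = P r \<theta> + qq / r\<^sup>2"
definition c4 where "c4 r = qq / Rz / r\<^sup>2"
definition c5 where "c5 r \<theta> = f r \<theta> / (r\<^sup>2 * (cos \<theta>)\<^sup>2)"

text \<open>The square in \<open>T_density\<close> makes it visibly nonnegative; the divergence
  computation needs it as a quadratic form in the entries of the inverse metric.\<close>

lemma T_density_expand:
  assumes "q $ Space Rad = r" "q $ Space Theta = \<theta>" "r > 0" "cos \<theta> > 0"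
  shows "T_density U q = G r \<theta> * (partial Time U q)\<^sup>2 + c1 r \<theta> * (partial (Space Phi) U q)\<^sup>2
     + D r * (partial (Space Rad) U q)\<^sup>2 + (partial (Space Theta) U q)\<^sup>2
     + c3 r \<theta> * (partial (Space Zed) U q)\<^sup>2 + 2 * c4 r * (partial (Space Zed) U q * partial (Space Psi) U q)
     + c5 r \<theta> * (partial (Space Psi) U q)\<^sup>2"
proof -
  have ps: "c5 r \<theta> = 1 / (cos \<theta>)\<^sup>2 + qq / Rz\<^sup>2 / r\<^sup>2"
    using assms Rz by (simp add: f_def c5_def field_simps)
  have "(x + y / Rz)\<^sup>2 = x\<^sup>2 + 2 * (x * y) / Rz + y\<^sup>2 / Rz\<^sup>2" for x y
    by (simp add: power2_sum power_divide)
  then show ?thesis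
    unfolding T_density_def Let_def assms(1,2) ps
    by (simp add: c1_def c3_def c4_def algebra_simps add_divide_distrib)
qed

lemma T_density_lower:
  assumes "q $ Space Rad = r" "q $ Space Theta = \<theta>"
  shows "G r \<theta> * (partial Time U q)\<^sup>2 + D r * (partial (Space Rad) U q)\<^sup>2 \<le> T_density U q"
    "f r \<theta> / (D r * (sin \<theta>)\<^sup>2) * (partial (Space Phi) U q)\<^sup>2 + D r * (partial (Space Rad) U q)\<^sup>2 \<le> T_density U q"
    "0 \<le> T_density U q"
proof -
  have "0 \<le> f r \<theta> / (D r * (sin \<theta>)\<^sup>2) * (partial (Space Phi) U q)\<^sup>2" "0 \<le> (partial (Space Theta) U q)\<^sup>2"
    "0 \<le> P r \<theta> * (partial (Space Zed) U q)\<^sup>2" "0 \<le> (partial (Space Psi) U q)\<^sup>2 / (cos \<theta>)\<^sup>2"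
    "0 \<le> qq / r\<^sup>2 * (partial (Space Zed) U q + partial (Space Psi) U q / Rz)\<^sup>2"
    "0 \<le> G r \<theta> * (partial Time U q)\<^sup>2" "0 \<le> D r * (partial (Space Rad) U q)\<^sup>2"
    using f_nonneg[of r \<theta>] D_pos[of r] P_pos[of r \<theta>] qq_pos G_pos[of r \<theta>]
    by (auto intro!: mult_nonneg_nonneg divide_nonneg_nonneg)
  then show "G r \<theta> * (partial Time U q)\<^sup>2 + D r * (partial (Space Rad) U q)\<^sup>2 \<le> T_density U q"
    "f r \<theta> / (D r * (sin \<theta>)\<^sup>2) * (partial (Space Phi) U q)\<^sup>2 + D r * (partial (Space Rad) U q)\<^sup>2 \<le> T_density U q"
    "0 \<le> T_density U q"
    unfolding T_density_def Let_def assms by linarith+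
qed

text \<open>Here \<open>m\<close> stands for the slope of the cutoff. By Young's inequality the
  radial flux costs at most \<open>D x\<^sup>2 + D y\<^sup>2\<close>, and \<open>speed\<close> times
  the energy pays for it because \<open>D \<le> speed * G\<close> and
  \<open>1 \<le> speed\<close>.\<close>

lemma cutoff_flux:
  assumes m: "m \<ge> 0" and q: "q $ Space Rad = r" "q $ Space Theta = \<theta>"
  shows "- (speed * m * T_density U q) + 2 * m * (D r * (partial (Space Rad) U q * partial Time U q)) \<le> 0"
proof -
  define x where "x = partial Time U q"
  define y where "y = partial (Space Rad) U q"
  have "2 * (D r * (y * x)) \<le> D r * x\<^sup>2 + D r * y\<^sup>2"
  proof -
    have "D r * x\<^sup>2 + D r * y\<^sup>2 - 2 * (D r * (y * x)) = D r * (x - y)\<^sup>2"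
      by (simp add: power2_diff algebra_simps)
    moreover have "D r * (x - y)\<^sup>2 \<ge> 0" using D_pos[of r] by simp
    ultimately show ?thesis by linarith
  qed
  also have "\<dots> \<le> speed * G r \<theta> * x\<^sup>2 + speed * D r * y\<^sup>2"
    using D_le_speed_G[of r \<theta>] mult_right_mono[OF speed_ge_1, of "D r"] D_pos[of r]
    by (intro add_mono mult_right_mono) auto
  also have "\<dots> = speed * (G r \<theta> * x\<^sup>2 + D r * y\<^sup>2)" by (simp add: algebra_simps)
  also have "\<dots> \<le> speed * T_density U q"
    using T_density_lower(1)[OF q, of U] speed_ge_1 by (intro mult_left_mono) (auto simp: x_def y_def)
  finally have "m * (2 * (D r * (y * x))) \<le> m * (speed * T_density U q)"
    using m by (rule mult_left_mono)
  then show ?thesis by (simp add: x_def y_def mult_ac)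
qed

text \<open>Divergence theorem for the T-current times the cutoff, on a box at distance
  \<open>eps\<close> from the degenerate loci. The constant may depend on \<open>U\<close>,
  \<open>t1\<close> and \<open>R\<close>, but not on \<open>eps\<close>; this is what the limit
  needs.\<close>

lemma energy_box:
  assumes U: "smooth_on UNIV U" and per: "angle_periodic U"
    and wave: "\<And>q. q \<in> chart \<Longrightarrow> wave_expr U q = 0" and t1: "t1 \<ge> 0" and R: "R > 0"
  shows "\<exists>C\<ge>0. \<forall>eps. 0 < eps \<longrightarrow> eps \<le> R \<longrightarrow> eps < pi / 4 \<longrightarrow>
    integral (cbox (eps, eps, 0, 0, 0) (R, pi / 2 - eps, 2 * pi, 2 * pi, 2 * pi * Rz))
      (\<lambda>(r, \<theta>, \<phi>, \<psi>, z). cutoff R t1 r * (wt r \<theta> * T_density U (coords t1 (r, \<theta>, \<phi>, \<psi>, z)))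
         - cutoff R 0 r * (wt r \<theta> * T_density U (coords 0 (r, \<theta>, \<phi>, \<psi>, z)))) \<le> C * eps"
proof -
  let ?I = "(\<lambda>(r, \<theta>, \<phi>, \<psi>, z). cutoff R t1 r * (wt r \<theta> * T_density U (coords t1 (r, \<theta>, \<phi>, \<psi>, z)))
         - cutoff R 0 r * (wt r \<theta> * T_density U (coords 0 (r, \<theta>, \<phi>, \<psi>, z))))"
  let ?K5 = "\<lambda>eps. cbox (eps, eps, 0, 0, 0) (R, pi / 2 - eps, 2 * pi, 2 * pi, 2 * pi * Rz)"
  define v where "v i t r \<theta> \<phi> \<psi> z = partial i U (coords t (r, \<theta>, \<phi>, \<psi>, z))" for i t r \<theta> \<phi> \<psi> z
  define w where "w i j t r \<theta> \<phi> \<psi> z = partial i (partial j U) (coords t (r, \<theta>, \<phi>, \<psi>, z))" for i j t r \<theta> \<phi> \<psi> z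
  note sm = smooth_partial[OF U]
  have dv: "((\<lambda>t. v i t r \<theta> \<phi> \<psi> z) has_real_derivative w Time i t r \<theta> \<phi> \<psi> z) (at t within S)"
    "((\<lambda>r. v i t r \<theta> \<phi> \<psi> z) has_real_derivative w (Space Rad) i t r \<theta> \<phi> \<psi> z) (at r within S)"
    "((\<lambda>\<theta>. v i t r \<theta> \<phi> \<psi> z) has_real_derivative w (Space Theta) i t r \<theta> \<phi> \<psi> z) (at \<theta> within S)"
    "((\<lambda>\<phi>. v i t r \<theta> \<phi> \<psi> z) has_real_derivative w (Space Phi) i t r \<theta> \<phi> \<psi> z) (at \<phi> within S)"
    "((\<lambda>\<psi>. v i t r \<theta> \<phi> \<psi> z) has_real_derivative w (Space Psi) i t r \<theta> \<phi> \<psi> z) (at \<psi> within S)"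
    "((\<lambda>z. v i t r \<theta> \<phi> \<psi> z) has_real_derivative w (Space Zed) i t r \<theta> \<phi> \<psi> z) (at z within S)"
    for i t r \<theta> \<phi> \<psi> z S
    unfolding v_def w_def by (rule DERIV_coords[OF sm])+
  have comm: "w i j t r \<theta> \<phi> \<psi> z = w j i t r \<theta> \<phi> \<psi> z" for i j t r \<theta> \<phi> \<psi> z
    unfolding w_def by (rule partial_commute[OF U])
  have vper: "v i t r \<theta> (2 * pi) \<psi> z = v i t r \<theta> 0 \<psi> z" "v i t r \<theta> \<phi> (2 * pi) z = v i t r \<theta> \<phi> 0 z"
    "v i t r \<theta> \<phi> \<psi> (2 * pi * Rz) = v i t r \<theta> \<phi> \<psi> 0" for i t r \<theta> \<phi> \<psi> z
    unfolding v_def by (rule angle_periodic_coords[OF angle_periodic_partial[OF U per]])+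
  have vc: "continuous_on S (\<lambda>y. v i (t y) (r y) (\<theta> y) (\<phi> y) (\<psi> y) (z y))"
    "continuous_on S (\<lambda>y. w i j (t y) (r y) (\<theta> y) (\<phi> y) (\<psi> y) (z y))"
    if "continuous_on S t" "continuous_on S r" "continuous_on S \<theta>" "continuous_on S \<phi>" "continuous_on S \<psi>" "continuous_on S z"
    for i j and S :: "'c::topological_space set" and t r \<theta> \<phi> \<psi> z
    unfolding v_def w_def by (auto intro!: continuous_on_coords sm smooth_partial[OF sm] that)
  \<comment> \<open>\<open>X\<close> is the cutoff and \<open>N\<close> its nonnegative square root;
    both derivatives of \<open>X\<close> are negative multiples of \<open>N\<close>.\<close>
  define N where "N t r = max 0 (1 - (r + speed * t) / R)" for t r
  define X where "X t r = cutoff R t r" for t r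
  have Nn: "N t r \<ge> 0" for t r by (simp add: N_def)
  have XN: "X t r = (N t r)\<^sup>2" for t r by (simp add: X_def N_def cutoff_def)
  have "((\<lambda>t. 1 - (r + speed * t) / R) has_real_derivative - (speed / R)) (at t within S)"
    "((\<lambda>r. 1 - (r + speed * t) / R) has_real_derivative - (1 / R)) (at r within S)" for t r S
    using R by (auto intro!: derivative_eq_intros)
  note dN = DERIV_chain2[OF DERIV_pos_part_squared this(1)] DERIV_chain2[OF DERIV_pos_part_squared this(2)]
  have dX: "((\<lambda>t. X t r) has_real_derivative (2 * N t r * - (speed / R))) (at t within S)"
    "((\<lambda>r. X t r) has_real_derivative (2 * N t r * - (1 / R))) (at r within S)" for t r S
    unfolding X_def cutoff_def N_def by (rule dN)+
  have dD: "(D has_real_derivative 2 * r) (at r within S)" for r S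
    unfolding D_def by (auto intro!: derivative_eq_intros)
  have dD': "((\<lambda>r. r * D r) has_real_derivative D r + 2 * r\<^sup>2) (at r within S)" for r S
    by (auto intro!: derivative_eq_intros dD simp: power2_eq_square)
  have dsc: "((\<lambda>\<theta>. sin \<theta> * cos \<theta>) has_real_derivative (cos \<theta>)\<^sup>2 - (sin \<theta>)\<^sup>2) (at \<theta> within S)" for \<theta> S
    by (auto intro!: derivative_eq_intros simp: power2_eq_square)

  \<comment> \<open>Components of twice the T-current, with cutoff and weight, each paired with its
    derivative in its own variable (\<open>Ft\<close> and \<open>Ft'\<close>, and so on). A spatial
    component is \<open>-2\<close> times the gradient component times the time derivative. In the
    time component the mixed t\<phi> term cancels, so \<open>E\<close> contains none.\<close>
  define E where "E t r \<theta> \<phi> \<psi> z = G r \<theta> * (v Time t r \<theta> \<phi> \<psi> z)\<^sup>2 + c1 r \<theta> * (v (Space Phi) t r \<theta> \<phi> \<psi> z)\<^sup>2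
     + D r * (v (Space Rad) t r \<theta> \<phi> \<psi> z)\<^sup>2 + (v (Space Theta) t r \<theta> \<phi> \<psi> z)\<^sup>2
     + c3 r \<theta> * (v (Space Zed) t r \<theta> \<phi> \<psi> z)\<^sup>2
     + 2 * c4 r * (v (Space Zed) t r \<theta> \<phi> \<psi> z * v (Space Psi) t r \<theta> \<phi> \<psi> z)
     + c5 r \<theta> * (v (Space Psi) t r \<theta> \<phi> \<psi> z)\<^sup>2" for t r \<theta> \<phi> \<psi> z
  define E' where "E' t r \<theta> \<phi> \<psi> z = 2 * (G r \<theta> * (v Time t r \<theta> \<phi> \<psi> z * w Time Time t r \<theta> \<phi> \<psi> z)
     + c1 r \<theta> * (v (Space Phi) t r \<theta> \<phi> \<psi> z * w Time (Space Phi) t r \<theta> \<phi> \<psi> z)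
     + D r * (v (Space Rad) t r \<theta> \<phi> \<psi> z * w Time (Space Rad) t r \<theta> \<phi> \<psi> z)
     + v (Space Theta) t r \<theta> \<phi> \<psi> z * w Time (Space Theta) t r \<theta> \<phi> \<psi> z
     + c3 r \<theta> * (v (Space Zed) t r \<theta> \<phi> \<psi> z * w Time (Space Zed) t r \<theta> \<phi> \<psi> z)
     + c4 r * (w Time (Space Zed) t r \<theta> \<phi> \<psi> z * v (Space Psi) t r \<theta> \<phi> \<psi> z
             + v (Space Zed) t r \<theta> \<phi> \<psi> z * w Time (Space Psi) t r \<theta> \<phi> \<psi> z)
     + c5 r \<theta> * (v (Space Psi) t r \<theta> \<phi> \<psi> z * w Time (Space Psi) t r \<theta> \<phi> \<psi> z))" for t r \<theta> \<phi> \<psi> z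
  define Ft where "Ft t r \<theta> \<phi> \<psi> z = X t r * (wt r \<theta> * E t r \<theta> \<phi> \<psi> z)" for t r \<theta> \<phi> \<psi> z
  define Ft' where "Ft' t r \<theta> \<phi> \<psi> z = (2 * N t r * - (speed / R)) * (wt r \<theta> * E t r \<theta> \<phi> \<psi> z)
     + X t r * (wt r \<theta> * E' t r \<theta> \<phi> \<psi> z)" for t r \<theta> \<phi> \<psi> z
  define Fr where "Fr t r \<theta> \<phi> \<psi> z = (-2 * (sin \<theta> * cos \<theta>)) * (X t r * (r * D r)
      * (v (Space Rad) t r \<theta> \<phi> \<psi> z * v Time t r \<theta> \<phi> \<psi> z))" for t r \<theta> \<phi> \<psi> z
  define Fr' where "Fr' t r \<theta> \<phi> \<psi> z = (-2 * (sin \<theta> * cos \<theta>)) *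
     (((2 * N t r * - (1 / R)) * (r * D r) + X t r * (D r + 2 * r\<^sup>2)) * (v (Space Rad) t r \<theta> \<phi> \<psi> z * v Time t r \<theta> \<phi> \<psi> z)
      + X t r * (r * D r) * (w (Space Rad) (Space Rad) t r \<theta> \<phi> \<psi> z * v Time t r \<theta> \<phi> \<psi> z
         + v (Space Rad) t r \<theta> \<phi> \<psi> z * w (Space Rad) Time t r \<theta> \<phi> \<psi> z))" for t r \<theta> \<phi> \<psi> z
  define Fh where "Fh t r \<theta> \<phi> \<psi> z = (-2 * (X t r * r)) * (sin \<theta> * cos \<theta>
      * (v (Space Theta) t r \<theta> \<phi> \<psi> z * v Time t r \<theta> \<phi> \<psi> z))" for t r \<theta> \<phi> \<psi> z
  define Fh' where "Fh' t r \<theta> \<phi> \<psi> z = (-2 * (X t r * r)) *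
     (((cos \<theta>)\<^sup>2 - (sin \<theta>)\<^sup>2) * (v (Space Theta) t r \<theta> \<phi> \<psi> z * v Time t r \<theta> \<phi> \<psi> z)
      + sin \<theta> * cos \<theta> * (w (Space Theta) (Space Theta) t r \<theta> \<phi> \<psi> z * v Time t r \<theta> \<phi> \<psi> z
         + v (Space Theta) t r \<theta> \<phi> \<psi> z * w (Space Theta) Time t r \<theta> \<phi> \<psi> z))" for t r \<theta> \<phi> \<psi> z
  define Fp where "Fp t r \<theta> \<phi> \<psi> z = (-2 * (X t r * wt r \<theta>)) * (c1 r \<theta> * (v (Space Phi) t r \<theta> \<phi> \<psi> z * v Time t r \<theta> \<phi> \<psi> z)
      - c2 r * (v Time t r \<theta> \<phi> \<psi> z * v Time t r \<theta> \<phi> \<psi> z))" for t r \<theta> \<phi> \<psi> z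
  define Fp' where "Fp' t r \<theta> \<phi> \<psi> z = (-2 * (X t r * wt r \<theta>)) *
      (c1 r \<theta> * (w (Space Phi) (Space Phi) t r \<theta> \<phi> \<psi> z * v Time t r \<theta> \<phi> \<psi> z
         + v (Space Phi) t r \<theta> \<phi> \<psi> z * w (Space Phi) Time t r \<theta> \<phi> \<psi> z)
      - c2 r * (2 * (v Time t r \<theta> \<phi> \<psi> z * w (Space Phi) Time t r \<theta> \<phi> \<psi> z)))" for t r \<theta> \<phi> \<psi> z
  define Fs where "Fs t r \<theta> \<phi> \<psi> z = (-2 * (X t r * wt r \<theta>)) * (c5 r \<theta> * (v (Space Psi) t r \<theta> \<phi> \<psi> z * v Time t r \<theta> \<phi> \<psi> z)
      + c4 r * (v (Space Zed) t r \<theta> \<phi> \<psi> z * v Time t r \<theta> \<phi> \<psi> z))" for t r \<theta> \<phi> \<psi> z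
  define Fs' where "Fs' t r \<theta> \<phi> \<psi> z = (-2 * (X t r * wt r \<theta>)) *
      (c5 r \<theta> * (w (Space Psi) (Space Psi) t r \<theta> \<phi> \<psi> z * v Time t r \<theta> \<phi> \<psi> z
         + v (Space Psi) t r \<theta> \<phi> \<psi> z * w (Space Psi) Time t r \<theta> \<phi> \<psi> z)
      + c4 r * (w (Space Psi) (Space Zed) t r \<theta> \<phi> \<psi> z * v Time t r \<theta> \<phi> \<psi> z
         + v (Space Zed) t r \<theta> \<phi> \<psi> z * w (Space Psi) Time t r \<theta> \<phi> \<psi> z))" for t r \<theta> \<phi> \<psi> z
  define Fz where "Fz t r \<theta> \<phi> \<psi> z = (-2 * (X t r * wt r \<theta>)) * (c3 r \<theta> * (v (Space Zed) t r \<theta> \<phi> \<psi> z * v Time t r \<theta> \<phi> \<psi> z)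
      + c4 r * (v (Space Psi) t r \<theta> \<phi> \<psi> z * v Time t r \<theta> \<phi> \<psi> z))" for t r \<theta> \<phi> \<psi> z
  define Fz' where "Fz' t r \<theta> \<phi> \<psi> z = (-2 * (X t r * wt r \<theta>)) *
      (c3 r \<theta> * (w (Space Zed) (Space Zed) t r \<theta> \<phi> \<psi> z * v Time t r \<theta> \<phi> \<psi> z
         + v (Space Zed) t r \<theta> \<phi> \<psi> z * w (Space Zed) Time t r \<theta> \<phi> \<psi> z)
      + c4 r * (w (Space Zed) (Space Psi) t r \<theta> \<phi> \<psi> z * v Time t r \<theta> \<phi> \<psi> z
         + v (Space Psi) t r \<theta> \<phi> \<psi> z * w (Space Zed) Time t r \<theta> \<phi> \<psi> z))" for t r \<theta> \<phi> \<psi> z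
  note sq = power2_eq_square
  have dE: "((\<lambda>t. E t r \<theta> \<phi> \<psi> z) has_real_derivative E' t r \<theta> \<phi> \<psi> z) (at t within S)" for t r \<theta> \<phi> \<psi> z S
    unfolding E_def E'_def sq
    by (rule DERIV_cong, (rule DERIV_add DERIV_cmult DERIV_mult dv)+) (simp add: algebra_simps)
  have dFt: "((\<lambda>t. Ft t r \<theta> \<phi> \<psi> z) has_real_derivative Ft' t r \<theta> \<phi> \<psi> z) (at t within S)" for t r \<theta> \<phi> \<psi> z S
    unfolding Ft_def Ft'_def by (rule DERIV_cong, (rule DERIV_cmult dE | rule DERIV_mult dX)+) (simp add: algebra_simps)
  have dFr: "((\<lambda>r. Fr t r \<theta> \<phi> \<psi> z) has_real_derivative Fr' t r \<theta> \<phi> \<psi> z) (at r within S)" for t r \<theta> \<phi> \<psi> z S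
    unfolding Fr_def Fr'_def by (rule DERIV_cong, (rule DERIV_cmult dD' dX dv | rule DERIV_mult)+) (simp add: algebra_simps)
  have dFh: "((\<lambda>\<theta>. Fh t r \<theta> \<phi> \<psi> z) has_real_derivative Fh' t r \<theta> \<phi> \<psi> z) (at \<theta> within S)" for t r \<theta> \<phi> \<psi> z S
    unfolding Fh_def Fh'_def by (rule DERIV_cong, (rule DERIV_cmult dsc dv | rule DERIV_mult)+) (simp add: algebra_simps)
  have dFp: "((\<lambda>\<phi>. Fp t r \<theta> \<phi> \<psi> z) has_real_derivative Fp' t r \<theta> \<phi> \<psi> z) (at \<phi> within S)" for t r \<theta> \<phi> \<psi> z S
    unfolding Fp_def Fp'_def by (rule DERIV_cong, (rule DERIV_diff DERIV_cmult dv | rule DERIV_mult)+) (simp add: algebra_simps)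
  have dFs: "((\<lambda>\<psi>. Fs t r \<theta> \<phi> \<psi> z) has_real_derivative Fs' t r \<theta> \<phi> \<psi> z) (at \<psi> within S)" for t r \<theta> \<phi> \<psi> z S
    unfolding Fs_def Fs'_def by (rule DERIV_cong, (rule DERIV_add DERIV_cmult dv | rule DERIV_mult)+) (simp add: algebra_simps)
  have dFz: "((\<lambda>z. Fz t r \<theta> \<phi> \<psi> z) has_real_derivative Fz' t r \<theta> \<phi> \<psi> z) (at z within S)" for t r \<theta> \<phi> \<psi> z S
    unfolding Fz_def Fz'_def by (rule DERIV_cong, (rule DERIV_add DERIV_cmult dv | rule DERIV_mult)+) (simp add: algebra_simps)
  have sum: "Ft' t r \<theta> \<phi> \<psi> z + Fr' t r \<theta> \<phi> \<psi> z + Fh' t r \<theta> \<phi> \<psi> z + Fp' t r \<theta> \<phi> \<psi> z + Fs' t r \<theta> \<phi> \<psi> z + Fz' t r \<theta> \<phi> \<psi> z \<le> 0"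
    if r: "r > 0" and \<theta>: "\<theta> \<in> {0<..<pi/2}" for t r \<theta> \<phi> \<psi> z
  proof -
    let ?q = "coords t (r, \<theta>, \<phi>, \<psi>, z)"
    have q: "?q \<in> chart" using r \<theta> by (simp add: chart_def)
    note ct = chartD[OF q]
    have wz: "wt r \<theta> * (- G r \<theta> * w Time Time t r \<theta> \<phi> \<psi> z - 2 * c2 r * w Time (Space Phi) t r \<theta> \<phi> \<psi> z
       + c1 r \<theta> * w (Space Phi) (Space Phi) t r \<theta> \<phi> \<psi> z
       + D r * w (Space Rad) (Space Rad) t r \<theta> \<phi> \<psi> z + w (Space Theta) (Space Theta) t r \<theta> \<phi> \<psi> z
       + c3 r \<theta> * w (Space Zed) (Space Zed) t r \<theta> \<phi> \<psi> z
       + 2 * c4 r * w (Space Zed) (Space Psi) t r \<theta> \<phi> \<psi> z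
       + c5 r \<theta> * w (Space Psi) (Space Psi) t r \<theta> \<phi> \<psi> z)
    + sin \<theta> * cos \<theta> * (D r + 2 * r\<^sup>2) * v (Space Rad) t r \<theta> \<phi> \<psi> z
    + r * ((cos \<theta>)\<^sup>2 - (sin \<theta>)\<^sup>2) * v (Space Theta) t r \<theta> \<phi> \<psi> z = 0" (is "?W = 0")
      using wave[OF q] unfolding wave_expr_def Let_def coords_nth c1_def c2_def c3_def c4_def c5_def v_def w_def .
    have Te: "T_density U ?q = E t r \<theta> \<phi> \<psi> z"
      unfolding E_def v_def using ct r by (intro T_density_expand) auto
    note c = comm[of "Space Rad" Time] comm[of "Space Theta" Time] comm[of "Space Phi" Time]
      comm[of "Space Psi" Time] comm[of "Space Zed" Time] comm[of "Space Psi" "Space Zed"]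
    \<comment> \<open>The terms with second derivatives and with derivatives of the coefficients
      collect to a multiple of the wave expression \<open>?W\<close>; only the terms that
      differentiate the cutoff survive.\<close>
    have "Ft' t r \<theta> \<phi> \<psi> z + Fr' t r \<theta> \<phi> \<psi> z + Fh' t r \<theta> \<phi> \<psi> z + Fp' t r \<theta> \<phi> \<psi> z + Fs' t r \<theta> \<phi> \<psi> z + Fz' t r \<theta> \<phi> \<psi> z
      = wt r \<theta> * (- (speed * (2 * N t r / R) * E t r \<theta> \<phi> \<psi> z)
           + 2 * (2 * N t r / R) * (D r * (v (Space Rad) t r \<theta> \<phi> \<psi> z * v Time t r \<theta> \<phi> \<psi> z)))
        - 2 * X t r * v Time t r \<theta> \<phi> \<psi> z * ?W"
      unfolding Ft'_def Fr'_def Fh'_def Fp'_def Fs'_def Fz'_def E'_def c wt_def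
      by (simp add: divide_inverse) algebra
    also have "\<dots> \<le> 0"
    proof -
      have "wt r \<theta> \<ge> 0" using ct r by (simp add: wt_def)
      moreover have "- (speed * (2 * N t r / R) * E t r \<theta> \<phi> \<psi> z)
           + 2 * (2 * N t r / R) * (D r * (v (Space Rad) t r \<theta> \<phi> \<psi> z * v Time t r \<theta> \<phi> \<psi> z)) \<le> 0"
        using cutoff_flux[of "2 * N t r / R" ?q r \<theta> U] Nn[of t r] R unfolding Te v_def by simp
      ultimately show ?thesis unfolding wz by (simp add: mult_nonneg_nonpos)
    qed
    finally show ?thesis .
  qed
  have ccD: "continuous_on S (\<lambda>y. D (r y))" if "continuous_on S r"
    for S :: "'c::euclidean_space set" and r
    unfolding D_def by (intro continuous_intros that)
  have D0: "\<forall>y\<in>S. D (r y) \<noteq> 0" for S :: "'c::euclidean_space set" and r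
    using D_pos by (metis less_irrefl)
  have ccw: "continuous_on S (\<lambda>y. wt (r y) (\<theta> y))" if "continuous_on S r" "continuous_on S \<theta>"
    for S :: "'c::euclidean_space set" and r \<theta>
    unfolding wt_def by (intro continuous_intros that)
  have ccG: "continuous_on S (\<lambda>y. G (r y) (\<theta> y))" if "continuous_on S r" "continuous_on S \<theta>"
    for S :: "'c::euclidean_space set" and r \<theta>
    unfolding G_def P_def f_def by (intro continuous_intros that ccD D0)
  have ccN: "continuous_on S (\<lambda>y. N (t y) (r y))" if "continuous_on S t" "continuous_on S r"
    for S :: "'c::euclidean_space set" and t r
  proof -
    have "continuous_on S (\<lambda>y. 1 - (r y + speed * t y) / R)"
      using R by (intro continuous_intros that) auto
    then show ?thesis unfolding N_def by (intro continuous_on_max continuous_on_const)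
  qed
  have ccX: "continuous_on S (\<lambda>y. X (t y) (r y))" if "continuous_on S t" "continuous_on S r"
    for S :: "'c::euclidean_space set" and t r
    unfolding XN by (intro continuous_on_power ccN that)
  note cc = ccD ccw ccG ccN ccX
  have cc2: "continuous_on S (\<lambda>y. c2 (r y))" if "continuous_on S r"
    for S :: "'c::euclidean_space set" and r
    unfolding c2_def using Rz by (intro continuous_intros that ccD D0) auto
  have cc4: "continuous_on S (\<lambda>y. c4 (r y))" if "continuous_on S r" "\<forall>y\<in>S. r y > 0"
    for S :: "'c::euclidean_space set" and r
    unfolding c4_def using Rz that(2) by (intro continuous_intros that(1)) force+
  have cc135: "continuous_on S (\<lambda>y. c1 (r y) (\<theta> y))" "continuous_on S (\<lambda>y. c3 (r y) (\<theta> y))"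
    "continuous_on S (\<lambda>y. c5 (r y) (\<theta> y))"
    if "continuous_on S r" "continuous_on S \<theta>" "\<forall>y\<in>S. r y > 0 \<and> sin (\<theta> y) > 0 \<and> cos (\<theta> y) > 0"
    for S :: "'c::euclidean_space set" and r \<theta>
  proof -
    have Rz0: "\<forall>y\<in>S. Rz\<^sup>2 \<noteq> 0" using Rz by simp
    have nz: "\<forall>y\<in>S. D (r y) * (sin (\<theta> y))\<^sup>2 \<noteq> 0" "\<forall>y\<in>S. (r y)\<^sup>2 \<noteq> 0" "\<forall>y\<in>S. (r y)\<^sup>2 * (cos (\<theta> y))\<^sup>2 \<noteq> 0"
      using that(3) D0[of S r] by auto
    show "continuous_on S (\<lambda>y. c1 (r y) (\<theta> y))" "continuous_on S (\<lambda>y. c3 (r y) (\<theta> y))"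
      "continuous_on S (\<lambda>y. c5 (r y) (\<theta> y))"
      unfolding c1_def c3_def c5_def P_def f_def
      by (intro continuous_intros that(1,2) ccD nz Rz0)+
  qed
  have X01: "0 \<le> X t r" "X t r \<le> 1" if "t \<ge> 0" "r \<ge> 0" for t r
  proof -
    have "(r + speed * t) / R \<ge> 0" using that speed_ge_1 R by simp
    then have "N t r \<le> 1" by (simp add: N_def)
    then show "0 \<le> X t r" "X t r \<le> 1" using Nn[of t r] by (simp_all add: XN power_le_one)
  qed
  \<comment> \<open>The outer face carries no flux.\<close>
  have XR: "X t R = 0" if "t \<ge> 0" for t
  proof -
    have "1 - (R + speed * t) / R \<le> 0" using R that speed_ge_1 by (simp add: field_simps)
    then show ?thesis by (simp add: X_def cutoff_def)
  qed
  \<comment> \<open>The factors of the fluxes that do not become small are continuous on the closed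
    box, degenerate loci included. This yields a bound \<open>B\<close> that is uniform in
    \<open>eps\<close>.\<close>
  define H where "H = (\<lambda>(t, r, \<theta>, \<phi>, \<psi>, z). \<bar>D r * (v (Space Rad) t r \<theta> \<phi> \<psi> z * v Time t r \<theta> \<phi> \<psi> z)\<bar>
     + \<bar>v (Space Theta) t r \<theta> \<phi> \<psi> z * v Time t r \<theta> \<phi> \<psi> z\<bar>)"
  have "continuous_on (cbox (0, 0, 0, 0, 0, 0) (t1, R, pi / 2, 2 * pi, 2 * pi, 2 * pi * Rz)) H"
    unfolding H_def case_prod_unfold
    by (intro continuous_intros vc ccD)
  from compact_imp_bounded[OF compact_continuous_image[OF this compact_cbox]]
  obtain B where B: "\<And>p. p \<in> cbox (0, 0, 0, 0, 0, 0) (t1, R, pi / 2, 2 * pi, 2 * pi, 2 * pi * Rz) \<Longrightarrow> \<bar>H p\<bar> \<le> B"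
    unfolding bounded_iff by auto
  have HB: "\<bar>D r * (v (Space Rad) t r \<theta> \<phi> \<psi> z * v Time t r \<theta> \<phi> \<psi> z)\<bar> \<le> B"
      "\<bar>v (Space Theta) t r \<theta> \<phi> \<psi> z * v Time t r \<theta> \<phi> \<psi> z\<bar> \<le> B"
    if "t \<in> {0..t1}" "r \<in> {0..R}" "\<theta> \<in> {0..pi/2}" "\<phi> \<in> {0..2*pi}" "\<psi> \<in> {0..2*pi}" "z \<in> {0..2*pi*Rz}"
    for t r \<theta> \<phi> \<psi> z
    using B[of "(t, r, \<theta>, \<phi>, \<psi>, z)"] that by (auto simp: cbox_Pair_eq H_def)
  have B0: "B \<ge> 0"
    using HB(1)[of 0 0 0 0 0 0] t1 R Rz by (auto intro: order_trans[OF abs_ge_zero])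
  define m4 where "m4 = measure lborel (cbox (0, 0, 0, 0) (pi / 2, 2 * pi, 2 * pi, 2 * pi * Rz))"
  define m3 where "m3 = measure lborel (cbox (0, 0, 0) (2 * pi, 2 * pi, 2 * pi * Rz))"
  \<comment> \<open>The first summand is for the face r = \<open>eps\<close>, where the flux is at
    most \<open>2 * eps * B\<close>. The second is for the two \<theta> faces, with at most
    \<open>2 * R * B * eps\<close> each. The face volumes \<open>m4\<close> and \<open>m3\<close>
    are those of the box with \<open>eps\<close> = 0.\<close>
  define C where "C = 2 * B * m4 * t1 + 4 * R * B * m3 * R * t1"
  have m: "m4 \<ge> 0" "m3 \<ge> 0" by (simp_all add: m4_def m3_def)
  have C: "C \<ge> 0" using B0 m t1 R by (simp add: C_def)
  have "integral (?K5 eps)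
      ?I \<le> C * eps"
    if eps: "0 < eps" "eps \<le> R" "eps < pi / 4" for eps
  proof -
    define K6 where "K6 = cbox (0, eps, eps, 0, 0, 0) (t1, R, pi / 2 - eps, 2 * pi, 2 * pi, 2 * pi * Rz)"
    have trig: "\<theta> \<in> {0<..<pi/2}" "sin \<theta> > 0" "cos \<theta> > 0" if "\<theta> \<in> {eps..pi / 2 - eps}" for \<theta>
      using that eps by (auto intro!: sin_gt_zero2 cos_gt_zero)
    have pos: "\<forall>p\<in>K6. fst (snd p) > 0 \<and> sin (fst (snd (snd p))) > 0 \<and> cos (fst (snd (snd p))) > 0"
      using trig eps by (auto simp: K6_def cbox_Pair_eq)
    have pos': "\<forall>p\<in>K6. fst (snd p) > 0" using pos by simp
    note ci = continuous_intros vc cc cc2 cc4 cc135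
    define ft where "ft = (\<lambda>(t, r, \<theta>, \<phi>, \<psi>, z). Ft' t r \<theta> \<phi> \<psi> z)"
    define fr where "fr = (\<lambda>(t, r, \<theta>, \<phi>, \<psi>, z). Fr' t r \<theta> \<phi> \<psi> z)"
    define fh where "fh = (\<lambda>(t, r, \<theta>, \<phi>, \<psi>, z). Fh' t r \<theta> \<phi> \<psi> z)"
    define fp where "fp = (\<lambda>(t, r, \<theta>, \<phi>, \<psi>, z). Fp' t r \<theta> \<phi> \<psi> z)"
    define fs where "fs = (\<lambda>(t, r, \<theta>, \<phi>, \<psi>, z). Fs' t r \<theta> \<phi> \<psi> z)"
    define fz where "fz = (\<lambda>(t, r, \<theta>, \<phi>, \<psi>, z). Fz' t r \<theta> \<phi> \<psi> z)"
    have ct: "continuous_on K6 ft"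
      unfolding ft_def Ft'_def E_def E'_def case_prod_unfold by (intro ci pos pos')
    have cr: "continuous_on K6 fr"
      unfolding fr_def Fr'_def case_prod_unfold by (intro ci pos pos')
    have ch: "continuous_on K6 fh"
      unfolding fh_def Fh'_def case_prod_unfold by (intro ci pos pos')
    have cp: "continuous_on K6 fp"
      unfolding fp_def Fp'_def case_prod_unfold by (intro ci pos pos')
    have cs: "continuous_on K6 fs"
      unfolding fs_def Fs'_def case_prod_unfold by (intro ci pos pos')
    have cz: "continuous_on K6 fz"
      unfolding fz_def Fz'_def case_prod_unfold by (intro ci pos pos')
    have "F integrable_on K6" if "continuous_on K6 F" for F :: "_ \<Rightarrow> real"
      using integrable_continuous that unfolding K6_def .
    note int = this[OF ct] this[OF cr] this[OF ch] this[OF cp] this[OF cs] this[OF cz]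
    have ord: "0 \<le> t1" "eps \<le> R" "eps \<le> pi / 2 - eps" "0 \<le> 2 * pi" "0 \<le> 2 * pi * Rz"
      using t1 eps Rz by auto
    have "integral K6 (\<lambda>p. ft p + fr p + fh p + fp p + fs p + fz p)
        = integral K6 ft + integral K6 fr + integral K6 fh + integral K6 fp + integral K6 fs + integral K6 fz"
      by (simp add: integral_add integrable_add int)
    moreover have "integral K6 (\<lambda>p. ft p + fr p + fh p + fp p + fs p + fz p) \<le> integral K6 (\<lambda>p. 0)"
    proof (rule integral_le)
      show "(\<lambda>p. ft p + fr p + fh p + fp p + fs p + fz p) integrable_on K6"
        by (intro integrable_add int)
      show "(\<lambda>p. 0::real) integrable_on K6" by (rule integrable_0)
      show "ft p + fr p + fh p + fp p + fs p + fz p \<le> 0" if "p \<in> K6" for p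
      proof -
        obtain t r \<theta> \<phi> \<psi> z where p: "p = (t, r, \<theta>, \<phi>, \<psi>, z)" by (metis surj_pair)
        have "r > 0" "\<theta> \<in> {0<..<pi/2}" using that eps trig by (auto simp: p K6_def cbox_Pair_eq)
        then show ?thesis unfolding p ft_def fr_def fh_def fp_def fs_def fz_def prod.case by (rule sum)
      qed
    qed
    moreover have "integral K6 fp = 0"
    proof -
      interpret box6 0 t1 eps R eps "pi / 2 - eps" 0 "2 * pi" 0 "2 * pi" 0 "2 * pi * Rz" Fp Fp'
        by unfold_locales (use ord cp in \<open>simp_all add: K6_def fp_def\<close>)
      show ?thesis unfolding K6_def fp_def
        by (rule integral_deriv_4[OF dFp]) (simp add: Fp_def vper)
    qed
    moreover have "integral K6 fs = 0"
    proof -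
      interpret box6 0 t1 eps R eps "pi / 2 - eps" 0 "2 * pi" 0 "2 * pi" 0 "2 * pi * Rz" Fs Fs'
        by unfold_locales (use ord cs in \<open>simp_all add: K6_def fs_def\<close>)
      show ?thesis unfolding K6_def fs_def
        by (rule integral_deriv_5[OF dFs]) (simp add: Fs_def vper)
    qed
    moreover have "integral K6 fz = 0"
    proof -
      interpret box6 0 t1 eps R eps "pi / 2 - eps" 0 "2 * pi" 0 "2 * pi" 0 "2 * pi * Rz" Fz Fz'
        by unfold_locales (use ord cz in \<open>simp_all add: K6_def fz_def\<close>)
      show ?thesis unfolding K6_def fz_def
        by (rule integral_deriv_6[OF dFz]) (simp add: Fz_def vper)
    qed
    \<comment> \<open>The value at r = R vanishes by \<open>XR\<close>; at the inner face the weight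
      supplies the factor r = \<open>eps\<close>.\<close>
    moreover have "\<bar>integral K6 fr\<bar> \<le> 2 * B * m4 * t1 * eps"
    proof -
      interpret box6 0 t1 eps R eps "pi / 2 - eps" 0 "2 * pi" 0 "2 * pi" 0 "2 * pi * Rz" Fr Fr'
        by unfold_locales (use ord cr in \<open>simp_all add: K6_def fr_def\<close>)
      have "\<bar>integral K6 fr\<bar> \<le> (2 * eps * B) * measure lborel (cbox (eps, 0, 0, 0) (pi / 2 - eps, 2 * pi, 2 * pi, 2 * pi * Rz)) * (t1 - 0)"
        unfolding K6_def fr_def
      proof (rule integral_deriv_2[OF dFr])
        fix t \<theta> \<phi> \<psi> z
        assume *: "in_box t eps \<theta> \<phi> \<psi> z"
        have "\<bar>D eps * (v (Space Rad) t eps \<theta> \<phi> \<psi> z * v Time t eps \<theta> \<phi> \<psi> z)\<bar> \<le> B"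
          using * eps by (intro HB) auto
        moreover have "\<bar>sin \<theta> * cos \<theta> * X t eps\<bar> \<le> 1 * 1 * 1"
          unfolding abs_mult using * eps X01[of t eps] by (intro mult_mono) auto
        ultimately have "\<bar>sin \<theta> * cos \<theta> * X t eps\<bar> * \<bar>D eps * (v (Space Rad) t eps \<theta> \<phi> \<psi> z * v Time t eps \<theta> \<phi> \<psi> z)\<bar> \<le> 1 * B"
          by (intro mult_mono) auto
        from mult_left_mono[OF this, of "2 * eps"]
        have "2 * eps * (\<bar>sin \<theta> * cos \<theta> * X t eps\<bar> * \<bar>D eps * (v (Space Rad) t eps \<theta> \<phi> \<psi> z * v Time t eps \<theta> \<phi> \<psi> z)\<bar>) \<le> 2 * eps * B"
          using eps by simp
        then show "\<bar>Fr t R \<theta> \<phi> \<psi> z - Fr t eps \<theta> \<phi> \<psi> z\<bar> \<le> 2 * eps * B"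
          using XR[of t] * eps by (simp add: Fr_def abs_mult mult_ac)
      next
        show "continuous_on (cbox (eps, 0, 0, 0) (pi / 2 - eps, 2 * pi, 2 * pi, 2 * pi * Rz))
          (\<lambda>(\<theta>, \<phi>, \<psi>, z). Fr t R \<theta> \<phi> \<psi> z - Fr t eps \<theta> \<phi> \<psi> z)" for t
          unfolding Fr_def case_prod_unfold by (intro continuous_intros vc)
      qed (use eps B0 in simp)
      also have "\<dots> \<le> (2 * eps * B) * m4 * (t1 - 0)"
        unfolding m4_def using eps B0 t1
        by (intro mult_right_mono mult_left_mono content_subset) (auto simp: cbox_Pair_eq)
      finally show ?thesis by (simp add: mult_ac)
    qed
    \<comment> \<open>Smallness comes from sin at \<theta> = \<open>eps\<close> and from cos at
      \<theta> = \<open>pi / 2 - eps\<close>, in both cases through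
      \<open>sin eps \<le> eps\<close>.\<close>
    moreover have "\<bar>integral K6 fh\<bar> \<le> 4 * R * B * m3 * R * t1 * eps"
    proof -
      interpret box6 0 t1 eps R eps "pi / 2 - eps" 0 "2 * pi" 0 "2 * pi" 0 "2 * pi * Rz" Fh Fh'
        by unfold_locales (use ord ch in \<open>simp_all add: K6_def fh_def\<close>)
      have se: "0 \<le> sin eps" "sin eps \<le> eps"
        using eps sin_x_le_x[of eps] by (auto intro!: sin_ge_zero)
      have "\<bar>integral K6 fh\<bar> \<le> (4 * R * B * eps) * measure lborel (cbox (0, 0, 0) (2 * pi, 2 * pi, 2 * pi * Rz)) * (R - eps) * (t1 - 0)"
        unfolding K6_def fh_def
      proof (rule integral_deriv_3[OF dFh])
        fix t r \<phi> \<psi> z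
        assume *: "in_box t r eps \<phi> \<psi> z"
        have bd: "\<bar>Fh t r \<theta> \<phi> \<psi> z\<bar> \<le> 2 * R * B * eps" if \<theta>: "\<theta> \<in> {0..pi/2}" "\<bar>sin \<theta> * cos \<theta>\<bar> \<le> eps" for \<theta>
        proof -
          have "\<bar>v (Space Theta) t r \<theta> \<phi> \<psi> z * v Time t r \<theta> \<phi> \<psi> z\<bar> \<le> B"
            using * eps \<theta> by (intro HB) auto
          then have h1: "\<bar>sin \<theta> * cos \<theta>\<bar> * \<bar>v (Space Theta) t r \<theta> \<phi> \<psi> z * v Time t r \<theta> \<phi> \<psi> z\<bar> \<le> eps * B"
            using \<theta> eps by (intro mult_mono) auto
          have h2: "\<bar>X t r\<bar> * \<bar>r\<bar> \<le> 1 * R"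
            using * eps X01[of t r] by (intro mult_mono) auto
          have "(\<bar>X t r\<bar> * \<bar>r\<bar>) * (\<bar>sin \<theta> * cos \<theta>\<bar> * \<bar>v (Space Theta) t r \<theta> \<phi> \<psi> z * v Time t r \<theta> \<phi> \<psi> z\<bar>) \<le> (1 * R) * (eps * B)"
            by (rule mult_mono[OF h2 h1]) (use R in auto)
          then show ?thesis by (simp add: Fh_def abs_mult mult_ac)
        qed
        have "\<bar>Fh t r eps \<phi> \<psi> z\<bar> \<le> 2 * R * B * eps"
        proof (rule bd)
          have "\<bar>sin eps\<bar> * \<bar>cos eps\<bar> \<le> eps * 1" using se eps by (intro mult_mono) auto
          then show "\<bar>sin eps * cos eps\<bar> \<le> eps" by (simp add: abs_mult)
        qed (use eps in auto)
        moreover have "\<bar>Fh t r (pi / 2 - eps) \<phi> \<psi> z\<bar> \<le> 2 * R * B * eps"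
        proof (rule bd)
          have "\<bar>cos eps\<bar> * \<bar>sin eps\<bar> \<le> 1 * eps" using se eps by (intro mult_mono) auto
          then show "\<bar>sin (pi / 2 - eps) * cos (pi / 2 - eps)\<bar> \<le> eps"
            by (simp add: abs_mult sin_diff cos_diff)
        qed (use eps in auto)
        ultimately show "\<bar>Fh t r (pi / 2 - eps) \<phi> \<psi> z - Fh t r eps \<phi> \<psi> z\<bar> \<le> 4 * R * B * eps"
          by linarith
      next
        show "continuous_on (cbox (0, 0, 0) (2 * pi, 2 * pi, 2 * pi * Rz))
          (\<lambda>(\<phi>, \<psi>, z). Fh t r (pi / 2 - eps) \<phi> \<psi> z - Fh t r eps \<phi> \<psi> z)" for t r
          unfolding Fh_def case_prod_unfold by (intro continuous_intros vc)
      qed (use eps B0 R in simp)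
      also have "\<dots> \<le> (4 * R * B * eps) * m3 * R * (t1 - 0)"
        unfolding m3_def using eps B0 t1 R
        by (intro mult_right_mono mult_left_mono mult_nonneg_nonneg) auto
      finally show ?thesis by (simp add: mult_ac)
    qed
    ultimately have "integral K6 ft \<le> C * eps"
      by (simp add: C_def distrib_right)
    moreover have "integral K6 ft = integral (?K5 eps)
      (\<lambda>(r, \<theta>, \<phi>, \<psi>, z). Ft t1 r \<theta> \<phi> \<psi> z - Ft 0 r \<theta> \<phi> \<psi> z)"
    proof -
      interpret box6 0 t1 eps R eps "pi / 2 - eps" 0 "2 * pi" 0 "2 * pi" 0 "2 * pi * Rz" Ft Ft'
        by unfold_locales (use ord ct in \<open>simp_all add: K6_def ft_def\<close>)
      show ?thesis unfolding K6_def ft_def by (rule integral_deriv_1[OF dFt])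
    qed
    moreover have "integral (?K5 eps)
      (\<lambda>(r, \<theta>, \<phi>, \<psi>, z). Ft t1 r \<theta> \<phi> \<psi> z - Ft 0 r \<theta> \<phi> \<psi> z)
     = integral (?K5 eps)
      ?I"
    proof (rule integral_cong)
      fix p assume p: "p \<in> ?K5 eps"
      obtain r \<theta> \<phi> \<psi> z where q: "p = (r, \<theta>, \<phi>, \<psi>, z)" by (metis surj_pair)
      have "r > 0" "cos \<theta> > 0" using p eps trig by (auto simp: q cbox_Pair_eq)
      then have "T_density U (coords t (r, \<theta>, \<phi>, \<psi>, z)) = E t r \<theta> \<phi> \<psi> z" for t
        unfolding E_def v_def by (intro T_density_expand) auto
      then show "(\<lambda>(r, \<theta>, \<phi>, \<psi>, z). Ft t1 r \<theta> \<phi> \<psi> z - Ft 0 r \<theta> \<phi> \<psi> z) p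
         = ?I p"
        by (simp add: q Ft_def X_def)
    qed
    ultimately show ?thesis by simp
  qed
  then show ?thesis using C by blast
qed

end

section \<open>From boxes to whole slices: exhaustion, then removal of the cutoff\<close>

type_synonym slice_coords = "real \<times> real \<times> real \<times> real \<times> real"

lemma coords_components:
  "coords t x $ Time = t" "coords t x $ Space Rad = fst x" "coords t x $ Space Theta = fst (snd x)"
  by (cases x; simp)+

lemma continuous_on_coords_tuple:
  assumes "smooth_on UNIV F"
  shows "continuous_on S (\<lambda>x. F (coords t x))"
proof -
  have "continuous_on S (\<lambda>x. F (coords t (fst x, fst (snd x), fst (snd (snd x)),
      fst (snd (snd (snd x))), snd (snd (snd (snd x))))))"
    by (intro continuous_on_coords assms continuous_intros)
  then show ?thesis by simp
qed

lemma const_over_n_tendsto_0: "(\<lambda>n. c / (real n + 1)) \<longlonglongrightarrow> 0"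
  using tendsto_mult_right_zero[OF LIMSEQ_inverse_real_of_nat, of c]
  by (simp add: divide_inverse add.commute)

context two_charge
begin

definition chart_box :: "slice_coords set" where
  "chart_box = {0<..} \<times> {0<..<pi/2} \<times> {0<..<2*pi} \<times> {0<..<2*pi} \<times> {0<..<2*pi*Rz}"

definition T_weighted :: "(real^ix \<Rightarrow> real) \<Rightarrow> real \<Rightarrow> slice_coords \<Rightarrow> real" where
  "T_weighted U t x = wt (fst x) (fst (snd x)) * T_density U (coords t x)"

definition T_energy :: "(real^ix \<Rightarrow> real) \<Rightarrow> real \<Rightarrow> ennreal" where
  "T_energy U t = (\<integral>\<^sup>+ x \<in> chart_box. ennreal (T_weighted U t x) \<partial>lborel)"

lemma measurable_components [measurable]:
  "(\<lambda>x::slice_coords. fst x) \<in> borel_measurable borel"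
  "(\<lambda>x::slice_coords. fst (snd x)) \<in> borel_measurable borel"
  by (intro borel_measurable_continuous_onI continuous_intros)+

lemma measurable_coords:
  "smooth_on UNIV F \<Longrightarrow> (\<lambda>x. F (coords t x)) \<in> borel_measurable borel"
  by (intro borel_measurable_continuous_onI continuous_on_coords_tuple)

lemma measurable_T_weighted:
  assumes "smooth_on UNIV U"
  shows "T_weighted U t \<in> borel_measurable borel"
proof -
  note [measurable] = measurable_coords[OF smooth_partial[OF assms]]
  show ?thesis
    unfolding T_weighted_def[abs_def] T_density_def Let_def coords_components wt_def G_def P_def f_def D_def
    by measurable
qed

lemma chart_box_measurable: "chart_box \<in> sets borel"
  unfolding chart_box_def by (intro borel_open open_Times) auto

lemma wt_nonneg: "r > 0 \<Longrightarrow> \<theta> \<in> {0<..<pi/2} \<Longrightarrow> wt r \<theta> \<ge> 0"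
  by (auto simp: wt_def intro!: mult_nonneg_nonneg sin_ge_zero cos_ge_zero)

lemma continuous_on_T_weighted:
  assumes U: "smooth_on UNIV U" and S: "\<And>x. x \<in> S \<Longrightarrow> fst x > 0 \<and> fst (snd x) \<in> {0<..<pi/2}"
  shows "continuous_on S (T_weighted U t)"
proof -
  have p: "fst x > 0" "sin (fst (snd x)) > 0" "cos (fst (snd x)) > 0" if "x \<in> S" for x
    using S[OF that] by (auto intro!: sin_gt_zero2 cos_gt_zero)
  have D0: "(fst x)\<^sup>2 + qq / Rz\<^sup>2 \<noteq> 0" for x :: "slice_coords"
    using D_pos[of "fst x"] by (simp add: D_def)
  have nz: "\<forall>x\<in>S. (fst x)\<^sup>2 \<noteq> 0" "\<forall>x\<in>S. (cos (fst (snd x)))\<^sup>2 \<noteq> 0"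
    "\<forall>x\<in>S. (fst x)\<^sup>2 + qq / Rz\<^sup>2 \<noteq> 0" "\<forall>x\<in>S. Rz \<noteq> 0" "\<forall>x\<in>S. Rz\<^sup>2 \<noteq> 0"
    "\<forall>x\<in>S. ((fst x)\<^sup>2 + qq / Rz\<^sup>2) * (sin (fst (snd x)))\<^sup>2 \<noteq> 0"
    using p D0 Rz by fastforce+
  show ?thesis
    unfolding T_weighted_def[abs_def] T_density_def Let_def coords_components wt_def G_def P_def f_def D_def
    by (intro continuous_intros continuous_on_coords_tuple smooth_partial[OF U] nz)
qed

lemma AE_angles:
  "AE x :: slice_coords in lborel. fst (snd (snd x)) \<noteq> c \<and> fst (snd (snd (snd x))) \<noteq> c \<and> snd (snd (snd (snd x))) \<noteq> d"
proof -
  have b: "(0, 0, 1, 0, 0) \<in> (Basis :: slice_coords set)"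
    "(0, 0, 0, 1, 0) \<in> (Basis :: slice_coords set)"
    "(0, 0, 0, 0, 1) \<in> (Basis :: slice_coords set)"
    by (auto simp: Basis_prod_def zero_prod_def)
  show ?thesis
    using AE_lborel_inner_neq[OF b(1), of c] AE_lborel_inner_neq[OF b(2), of c] AE_lborel_inner_neq[OF b(3), of d]
    by eventually_elim (auto simp: inner_prod_def)
qed

text \<open>The end points of the angle intervals form a null set. The divergence theorem works on
  closed boxes, whereas the slice integral is defined over open intervals.\<close>

lemma T_energy_closed:
  "T_energy U t = (\<integral>\<^sup>+ x \<in> {0<..} \<times> {0<..<pi/2} \<times> {0..2*pi} \<times> {0..2*pi} \<times> {0..2*pi*Rz}.
      ennreal (T_weighted U t x) \<partial>lborel)"
  unfolding T_energy_def
proof (rule nn_integral_cong_AE)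
  show "AE x in lborel. ennreal (T_weighted U t x) * indicator chart_box x = ennreal (T_weighted U t x) *
      indicator ({0<..} \<times> {0<..<pi/2} \<times> {0..2*pi} \<times> {0..2*pi} \<times> {0..2*pi*Rz}) x"
    using AE_angles[of 0 0] AE_angles[of "2 * pi" "2 * pi * Rz"]
  proof eventually_elim
    case (elim x)
    obtain r \<theta> \<phi> \<psi> z where "x = (r, \<theta>, \<phi>, \<psi>, z)" by (metis surj_pair)
    then show ?case using elim by (auto simp: chart_box_def indicator_def)
  qed
qed

text \<open>The limit \<open>eps\<close> to 0 in \<open>energy_box\<close>. Fatou's lemma handles
  time \<open>t\<close>, while the error \<open>C * eps\<close> tends to 0 for fixed
  \<open>R\<close>.\<close>

lemma T_energy_cutoff_le:
  assumes U: "smooth_on UNIV U" and per: "angle_periodic U"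
    and wave: "\<And>q. q \<in> chart \<Longrightarrow> wave_expr U q = 0" and t: "t \<ge> 0" and R: "R > 0"
  shows "(\<integral>\<^sup>+ x \<in> {0<..} \<times> {0<..<pi/2} \<times> {0..2*pi} \<times> {0..2*pi} \<times> {0..2*pi*Rz}.
      ennreal (cutoff R t (fst x) * T_weighted U t x) \<partial>lborel) \<le> T_energy U 0"
proof -
  define S where "S = {0::real<..} \<times> {0<..<pi/2} \<times> {0..2*pi} \<times> {0..2*pi} \<times> {0..2*pi*Rz}"
  obtain C where C: "C \<ge> 0" and box: "\<And>eps. 0 < eps \<Longrightarrow> eps \<le> R \<Longrightarrow> eps < pi / 4 \<Longrightarrow>
    integral (cbox (eps, eps, 0, 0, 0) (R, pi / 2 - eps, 2 * pi, 2 * pi, 2 * pi * Rz))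
      (\<lambda>(r, \<theta>, \<phi>, \<psi>, z). cutoff R t r * (wt r \<theta> * T_density U (coords t (r, \<theta>, \<phi>, \<psi>, z)))
         - cutoff R 0 r * (wt r \<theta> * T_density U (coords 0 (r, \<theta>, \<phi>, \<psi>, z)))) \<le> C * eps"
    using energy_box[OF U per wave t R] by blast
  \<comment> \<open>The numerator meets both restrictions of \<open>energy_box\<close>: it is at
    most \<open>R\<close>, and 1/2 is less than \<open>pi / 4\<close>.\<close>
  define eps where "eps n = min R (1/2) / (real n + 1)" for n :: nat
  define K where "K n = cbox (eps n, eps n, 0, 0, 0) (R, pi / 2 - eps n, 2 * pi, 2 * pi, 2 * pi * Rz)" for n
  have eps: "0 < eps n" "eps n \<le> R" "eps n < pi / 4" for n
  proof -
    show "0 < eps n" using R by (simp add: eps_def)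
    have "eps n \<le> min R (1/2)"
      unfolding eps_def using divide_left_mono[of 1 "real n + 1" "min R (1/2)"] R by simp
    then show "eps n \<le> R" "eps n < pi / 4" using pi_gt3 by auto
  qed
  have KS: "x \<in> S" if "x \<in> K n" for x n
    using that eps[of n] by (auto simp: K_def S_def cbox_Pair_eq)
  have Kp: "fst x > 0 \<and> fst (snd x) \<in> {0<..<pi/2}" if "x \<in> K n" for x n
    using KS[OF that] by (auto simp: S_def)
  have Tn: "T_weighted U s x \<ge> 0" if "x \<in> S" for s x
    using that wt_nonneg[of "fst x" "fst (snd x)"] T_density_lower(3)[OF refl refl, of U "coords s x"]
    by (auto simp: S_def T_weighted_def)
  have cut01: "0 \<le> cutoff R s r" "r \<ge> 0 \<Longrightarrow> s \<ge> 0 \<Longrightarrow> cutoff R s r \<le> 1" for s r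
  proof -
    show "0 \<le> cutoff R s r" by (simp add: cutoff_def)
    assume "r \<ge> 0" "s \<ge> 0"
    then have "(r + speed * s) / R \<ge> 0" using speed_ge_1 R by simp
    then show "cutoff R s r \<le> 1" by (simp add: cutoff_def power_le_one)
  qed
  have ccut: "continuous_on A (\<lambda>x. cutoff R s (fst x))" for A :: "slice_coords set" and s
    unfolding cutoff_def using R by (intro continuous_intros) auto
  have cont: "continuous_on (K n) (\<lambda>x. cutoff R s (fst x) * T_weighted U s x)" for n s
    by (intro continuous_on_mult ccut continuous_on_T_weighted[OF U] Kp)
  have integ: "(\<lambda>x. cutoff R s (fst x) * T_weighted U s x) integrable_on K n" for n s
    using integrable_continuous[OF cont[of n s, unfolded K_def]] unfolding K_def .
  have step: "(\<integral>\<^sup>+ x \<in> K n. ennreal (cutoff R t (fst x) * T_weighted U t x) \<partial>lborel)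
      \<le> T_energy U 0 + ennreal (C * eps n)" for n
  proof -
    define I where "I s = integral (K n) (\<lambda>x. cutoff R s (fst x) * T_weighted U s x)" for s
    have e: "(\<integral>\<^sup>+ x \<in> K n. ennreal (cutoff R s (fst x) * T_weighted U s x) \<partial>lborel) = ennreal (I s)" for s
      unfolding I_def K_def
      by (rule nn_integral_cbox_continuous[OF cont[of n, unfolded K_def]])
        (use Tn KS cut01(1) in \<open>auto simp: K_def\<close>)
    have "I t - I 0 = integral (K n) (\<lambda>x. cutoff R t (fst x) * T_weighted U t x - cutoff R 0 (fst x) * T_weighted U 0 x)"
      unfolding I_def
      by (rule integral_diff[symmetric]) (rule integ)+
    also have "\<dots> \<le> C * eps n"
      using box[OF eps, of n] by (simp add: K_def T_weighted_def case_prod_unfold)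
    finally have "I t \<le> I 0 + C * eps n" by simp
    moreover have "I 0 \<ge> 0"
      unfolding I_def by (rule integral_nonneg[OF integ]) (use Tn KS cut01(1) in auto)
    ultimately have "ennreal (I t) \<le> ennreal (I 0) + ennreal (C * eps n)"
      using C eps[of n] by (simp add: ennreal_plus[symmetric] del: ennreal_plus)
    \<comment> \<open>At time 0 the cutoff is at most 1 and is dropped, so the bound no longer
      depends on \<open>R\<close> or on the box.\<close>
    also have "ennreal (I 0) \<le> T_energy U 0"
      unfolding e[symmetric] T_energy_closed S_def[symmetric]
    proof (rule nn_integral_mono)
      fix x
      show "ennreal (cutoff R 0 (fst x) * T_weighted U 0 x) * indicator (K n) x
        \<le> ennreal (T_weighted U 0 x) * indicator S x"
      proof (cases "x \<in> K n")
        case True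
        have "cutoff R 0 (fst x) * T_weighted U 0 x \<le> 1 * T_weighted U 0 x"
          using cut01(2)[of "fst x" 0] Kp[OF True] Tn[OF KS[OF True]] by (intro mult_right_mono) auto
        then show ?thesis using True KS[OF True] by (simp add: ennreal_leI)
      qed simp
    qed
    finally show ?thesis by (simp add: e add_mono)
  qed
  have meas: "(\<lambda>x. ennreal (cutoff R t (fst x) * T_weighted U t x) * indicator (K n) x) \<in> borel_measurable lborel" for n
  proof -
    note [measurable] = measurable_T_weighted[OF U]
    have [measurable]: "(\<lambda>x::slice_coords. cutoff R t (fst x)) \<in> borel_measurable borel"
      by (rule borel_measurable_continuous_onI[OF ccut])
    have [measurable]: "K n \<in> sets borel" by (simp add: K_def)
    show ?thesis by measurable
  qed
  have eps_lim: "eps \<longlonglongrightarrow> 0"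
    unfolding eps_def by (rule const_over_n_tendsto_0)
  have "(\<integral>\<^sup>+ x \<in> S. ennreal (cutoff R t (fst x) * T_weighted U t x) \<partial>lborel)
     \<le> (\<integral>\<^sup>+ x. liminf (\<lambda>n. ennreal (cutoff R t (fst x) * T_weighted U t x) * indicator (K n) x) \<partial>lborel)"
  proof (rule nn_integral_mono)
    fix x
    show "ennreal (cutoff R t (fst x) * T_weighted U t x) * indicator S x
      \<le> liminf (\<lambda>n. ennreal (cutoff R t (fst x) * T_weighted U t x) * indicator (K n) x)"
    \<comment> \<open>A point of the slice with r at most \<open>R\<close> lies in all late boxes;
      beyond \<open>R\<close> the cutoff is zero.\<close>
    proof (cases "x \<in> S \<and> fst x \<le> R")
      case True
      obtain r \<theta> \<phi> \<psi> z where x: "x = (r, \<theta>, \<phi>, \<psi>, z)" by (metis surj_pair)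
      have "min r (min \<theta> (pi / 2 - \<theta>)) > 0" using True by (auto simp: x S_def)
      from order_tendstoD(2)[OF eps_lim this]
      have "\<forall>\<^sub>F n in sequentially. x \<in> K n"
        by eventually_elim (use True in \<open>auto simp: x K_def S_def cbox_Pair_eq\<close>)
      then have "\<forall>\<^sub>F n in sequentially. ennreal (cutoff R t (fst x) * T_weighted U t x) * indicator S x
          \<le> ennreal (cutoff R t (fst x) * T_weighted U t x) * indicator (K n) x"
        by eventually_elim (simp add: indicator_def)
      then show ?thesis by (rule Liminf_bounded)
    next
      case False
      have "cutoff R t (fst x) = 0" if "x \<in> S" "\<not> fst x \<le> R"
      proof -
        have "R \<le> fst x + speed * t" using that t speed_ge_1 mult_nonneg_nonneg[of speed t] by linarith
        then have "1 \<le> (fst x + speed * t) / R" using R by simp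
        then show ?thesis by (simp add: cutoff_def)
      qed
      then show ?thesis using False by (auto simp: indicator_def)
    qed
  qed
  also have "\<dots> \<le> liminf (\<lambda>n. \<integral>\<^sup>+ x \<in> K n. ennreal (cutoff R t (fst x) * T_weighted U t x) \<partial>lborel)"
    by (rule nn_integral_liminf) (rule meas)
  also have "\<dots> \<le> liminf (\<lambda>n. T_energy U 0 + ennreal (C * eps n))"
    by (rule Liminf_mono) (simp add: step)
  also have "\<dots> = T_energy U 0"
  proof (rule lim_imp_Liminf)
    have "(\<lambda>n. C * eps n) \<longlonglongrightarrow> C * 0" by (intro tendsto_intros eps_lim)
    then have "(\<lambda>n. T_energy U 0 + ennreal (C * eps n)) \<longlonglongrightarrow> T_energy U 0 + ennreal 0"
      by (intro tendsto_add tendsto_const tendsto_ennrealI) simp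
    then show "(\<lambda>n. T_energy U 0 + ennreal (C * eps n)) \<longlonglongrightarrow> T_energy U 0" by simp
  qed simp
  finally show ?thesis by (simp add: S_def)
qed

text \<open>For fixed \<open>t\<close> the cutoff tends to 1 pointwise as \<open>R\<close> grows,
  and the bound on the cut-off energy is uniform in \<open>R\<close>; Fatou's lemma
  concludes.\<close>

lemma T_energy_le:
  assumes U: "smooth_on UNIV U" and per: "angle_periodic U"
    and wave: "\<And>q. q \<in> chart \<Longrightarrow> wave_expr U q = 0" and t: "t \<ge> 0"
  shows "T_energy U t \<le> T_energy U 0"
proof -
  define S where "S = {0::real<..} \<times> {0<..<pi/2} \<times> {0..2*pi} \<times> {0..2*pi} \<times> {0..2*pi*Rz}"
  define R where "R n = real n + 1" for n :: nat
  have R: "R n > 0" for n by (simp add: R_def)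
  have [measurable]: "S \<in> sets borel"
    unfolding S_def by (intro borel_Times) auto
  have meas: "(\<lambda>x. ennreal (cutoff (R n) t (fst x) * T_weighted U t x) * indicator S x) \<in> borel_measurable lborel" for n
  proof -
    note [measurable] = measurable_T_weighted[OF U]
    have "continuous_on UNIV (\<lambda>x::slice_coords. cutoff (R n) t (fst x))"
      unfolding cutoff_def using R[of n] by (intro continuous_intros) auto
    note [measurable] = borel_measurable_continuous_onI[OF this]
    show ?thesis by measurable
  qed
  have lim: "(\<lambda>n. cutoff (R n) t r) \<longlonglongrightarrow> 1" for r
  proof -
    have "(\<lambda>n. (max 0 (1 - (r + speed * t) / R n))\<^sup>2) \<longlonglongrightarrow> (max 0 (1 - 0))\<^sup>2"
      unfolding R_def by (intro tendsto_power tendsto_max tendsto_const tendsto_diff const_over_n_tendsto_0)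
    then show ?thesis by (simp add: cutoff_def)
  qed
  have "T_energy U t \<le> (\<integral>\<^sup>+ x. liminf (\<lambda>n. ennreal (cutoff (R n) t (fst x) * T_weighted U t x) * indicator S x) \<partial>lborel)"
    unfolding T_energy_closed S_def[symmetric]
  proof (rule nn_integral_mono)
    fix x
    have "(\<lambda>n. cutoff (R n) t (fst x) * T_weighted U t x) \<longlonglongrightarrow> 1 * T_weighted U t x"
      by (intro tendsto_mult lim tendsto_const)
    then have "(\<lambda>n. ennreal (cutoff (R n) t (fst x) * T_weighted U t x)) \<longlonglongrightarrow> ennreal (T_weighted U t x)"
      by (intro tendsto_ennrealI) simp
    then have "(\<lambda>n. ennreal (cutoff (R n) t (fst x) * T_weighted U t x) * indicator S x)
        \<longlonglongrightarrow> ennreal (T_weighted U t x) * indicator S x"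
      by (cases "x \<in> S") auto
    from lim_imp_Liminf[OF _ this]
    show "ennreal (T_weighted U t x) * indicator S x
      \<le> liminf (\<lambda>n. ennreal (cutoff (R n) t (fst x) * T_weighted U t x) * indicator S x)" by simp
  qed
  also have "\<dots> \<le> liminf (\<lambda>n. \<integral>\<^sup>+ x \<in> S. ennreal (cutoff (R n) t (fst x) * T_weighted U t x) \<partial>lborel)"
    by (rule nn_integral_liminf) (rule meas)
  also have "\<dots> \<le> liminf (\<lambda>n. T_energy U 0)"
    unfolding S_def
    by (intro Liminf_mono always_eventually allI T_energy_cutoff_le[OF U per wave t R])
  also have "\<dots> = T_energy U 0" by (simp add: Liminf_const)
  finally show ?thesis .
qed

end

section \<open>The missing derivative\<close>

text \<open>Integrate the derivative of \<open>r\<^sup>2 (1 - r\<^sup>2) v\<^sup>2\<close>.\<close>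

lemma hardy_unit_interval:
  fixes v v' :: "real \<Rightarrow> real"
  assumes d: "\<And>r. r \<in> {0..1} \<Longrightarrow> (v has_real_derivative v' r) (at r within {0..1})"
    and c: "continuous_on {0..1} v'"
  shows "integral {0..1} (\<lambda>r. 2 * r * (v r)\<^sup>2) \<le> integral {0..1} (\<lambda>r. 5 * r^3 * (v r)\<^sup>2 + r * (v' r)\<^sup>2)"
proof -
  have cv: "continuous_on {0..1} v"
    by (rule DERIV_continuous_on) (rule d)
  \<comment> \<open>The core is \<open>r * (r * v r + v' r)\<^sup>2 \<ge> 0\<close>; the factor
    \<open>1 - r\<^sup>2\<close> lies between 0 and 1 and only helps.\<close>
  have sq: "- (2 * r\<^sup>2 * (1 - r\<^sup>2) * v r * v' r) \<le> r^3 * (v r)\<^sup>2 + r * (v' r)\<^sup>2" if "r \<in> {0..1}" for r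
  proof -
    have r: "0 \<le> 1 - r\<^sup>2" "1 - r\<^sup>2 \<le> 1" using that by (auto simp: power_le_one)
    have nn: "0 \<le> r^3 * (v r)\<^sup>2 + r * (v' r)\<^sup>2" using that by simp
    have "- (2 * r\<^sup>2 * v r * v' r) \<le> r^3 * (v r)\<^sup>2 + r * (v' r)\<^sup>2"
    proof -
      have "r^3 * (v r)\<^sup>2 + r * (v' r)\<^sup>2 + 2 * r\<^sup>2 * v r * v' r = r * (r * v r + v' r)\<^sup>2"
        by (simp add: power2_eq_square power3_eq_cube algebra_simps)
      moreover have "r * (r * v r + v' r)\<^sup>2 \<ge> 0" using that by simp
      ultimately show ?thesis by linarith
    qed
    from mult_left_mono[OF this r(1)]
    have "- (2 * r\<^sup>2 * (1 - r\<^sup>2) * v r * v' r) \<le> (1 - r\<^sup>2) * (r^3 * (v r)\<^sup>2 + r * (v' r)\<^sup>2)"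
      by (simp add: algebra_simps)
    also have "\<dots> \<le> 1 * (r^3 * (v r)\<^sup>2 + r * (v' r)\<^sup>2)"
      by (rule mult_right_mono[OF r(2) nn])
    finally show ?thesis by simp
  qed
  define g where "g r = (2 * r - 4 * r^3) * (v r)\<^sup>2 + 2 * r\<^sup>2 * (1 - r\<^sup>2) * v r * v' r" for r
  \<comment> \<open>The factor \<open>r\<^sup>2 - r^4\<close> vanishes at both ends, so
    \<open>g\<close> integrates to zero and no boundary value of \<open>v\<close> appears.\<close>
  have "((\<lambda>r. (r\<^sup>2 - r^4) * (v r)\<^sup>2) has_real_derivative g r) (at r within {0..1})" if "r \<in> {0..1}" for r
    unfolding g_def
    by (rule derivative_eq_intros d[OF that] refl)+ (simp add: power2_eq_square power3_eq_cube power4_eq_xxxx algebra_simps)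
  then have "(g has_integral ((1\<^sup>2 - 1^4) * (v 1)\<^sup>2 - (0\<^sup>2 - 0^4) * (v 0)\<^sup>2)) {0..1}"
    by (intro fundamental_theorem_of_calculus) (auto simp: has_real_derivative_iff_has_vector_derivative)
  then have g: "(g has_integral 0) {0..1}" by simp
  have i: "(\<lambda>r. 2 * r * (v r)\<^sup>2) integrable_on {0..1}"
    "(\<lambda>r. 5 * r^3 * (v r)\<^sup>2 + r * (v' r)\<^sup>2) integrable_on {0..1}"
    by (intro integrable_continuous_real continuous_intros cv c)+
  have "integral {0..1} (\<lambda>r. 2 * r * (v r)\<^sup>2) \<le> integral {0..1} (\<lambda>r. (5 * r^3 * (v r)\<^sup>2 + r * (v' r)\<^sup>2) + g r)"
  proof (rule integral_le[OF i(1)])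
    show "(\<lambda>r. (5 * r^3 * (v r)\<^sup>2 + r * (v' r)\<^sup>2) + g r) integrable_on {0..1}"
      using i(2) g by (auto intro: integrable_add)
    \<comment> \<open>The constant 5 consists of the 4 from differentiating \<open>- r^4\<close> and
      the 1 from \<open>sq\<close>.\<close>
    show "2 * r * (v r)\<^sup>2 \<le> (5 * r^3 * (v r)\<^sup>2 + r * (v' r)\<^sup>2) + g r" if "r \<in> {0..1}" for r
      using sq[OF that] by (simp add: g_def algebra_simps)
  qed
  also have "\<dots> = integral {0..1} (\<lambda>r. 5 * r^3 * (v r)\<^sup>2 + r * (v' r)\<^sup>2)"
  proof -
    have "g integrable_on {0..1}" "integral {0..1} g = 0" using g by (auto simp: integral_unique)
    then show ?thesis by (simp add: integral_add[OF i(2)])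
  qed
  finally show ?thesis .
qed

context two_charge
begin

text \<open>For r above 1 the weight \<open>r\<^sup>2 / D\<close> already dominates
  \<open>1 / D\<close>; below 1 the weights are comparable to those of
  \<open>hardy_unit_interval\<close>. The weight \<open>r\<^sup>2 / D\<close> is the part of the
  degenerate \<phi> coefficient guaranteed by \<open>f \<ge> r\<^sup>2\<close>.\<close>

lemma hardy_weighted:
  "\<exists>C>0. \<forall>v v'. (\<forall>r. (v has_real_derivative v' r) (at r)) \<longrightarrow> continuous_on UNIV v' \<longrightarrow>
     (\<integral>\<^sup>+ r \<in> {0<..}. ennreal (r * ((v r)\<^sup>2 / D r)) \<partial>lborel)
       \<le> ennreal C * (\<integral>\<^sup>+ r \<in> {0<..}. ennreal (r * (r\<^sup>2 / D r * (v r)\<^sup>2 + D r * (v' r)\<^sup>2)) \<partial>lborel)"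
proof -
  define b where "b = qq / Rz\<^sup>2"
  have b: "b > 0" using qq_pos Rz by (simp add: b_def)
  have Db: "D r = r\<^sup>2 + b" for r by (simp add: D_def b_def)
  \<comment> \<open>On the unit interval \<open>b \<le> D \<le> 1 + b\<close>. This yields the
    factors \<open>5 * (1 + b)\<close> and \<open>1 / b\<close>, and the division by
    \<open>b\<close> comes from \<open>1 / D \<le> 1 / b\<close>. The final constant
    \<open>c + 1\<close> allows for the region beyond 1.\<close>
  define c where "c = (5 * (1 + b) + 1 / b) / b"
  have c: "c > 0" using b by (simp add: c_def add_pos_pos)
  have bc: "b * c = 5 * (1 + b) + 1 / b" using b by (simp add: c_def)
  have "(\<integral>\<^sup>+ r \<in> {0<..}. ennreal (r * ((v r)\<^sup>2 / D r)) \<partial>lborel)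
       \<le> ennreal (c + 1) * (\<integral>\<^sup>+ r \<in> {0<..}. ennreal (r * (r\<^sup>2 / D r * (v r)\<^sup>2 + D r * (v' r)\<^sup>2)) \<partial>lborel)"
    if d: "\<And>r. (v has_real_derivative v' r) (at r)" and cv': "continuous_on UNIV v'" for v v'
  proof -
    have cv: "continuous_on UNIV v" using d by (intro DERIV_continuous_on) (auto intro: has_field_derivative_at_within)
    note [measurable] = borel_measurable_continuous_onI[OF cv] borel_measurable_continuous_onI[OF cv']
    have [measurable]: "D \<in> borel_measurable borel" unfolding D_def[abs_def] by measurable
    have sub: "continuous_on {0..1} v" "continuous_on {0..1} v'"
      using cv cv' by (auto intro: continuous_on_subset)
    define J where "J r = r * (r\<^sup>2 / D r * (v r)\<^sup>2 + D r * (v' r)\<^sup>2)" for r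
    have J: "J r \<ge> 0" if "r \<ge> 0" for r using that D_pos[of r] by (simp add: J_def)
    have Jm [measurable]: "J \<in> borel_measurable borel" unfolding J_def[abs_def] by measurable
    have "(\<integral>\<^sup>+ r \<in> cbox 0 1. ennreal (2 * r * (v r)\<^sup>2) \<partial>lborel) = ennreal (integral (cbox 0 1) (\<lambda>r. 2 * r * (v r)\<^sup>2))"
      by (rule nn_integral_cbox_continuous) (auto intro!: continuous_intros sub)
    also have "\<dots> \<le> ennreal (integral (cbox 0 1) (\<lambda>r. 5 * r^3 * (v r)\<^sup>2 + r * (v' r)\<^sup>2))"
      using hardy_unit_interval[OF has_field_derivative_at_within[OF d] sub(2)] by (simp add: ennreal_leI)
    also have "\<dots> = (\<integral>\<^sup>+ r \<in> cbox 0 1. ennreal (5 * r^3 * (v r)\<^sup>2 + r * (v' r)\<^sup>2) \<partial>lborel)"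
      by (rule nn_integral_cbox_continuous[symmetric]) (auto intro!: continuous_intros sub)
    also have "\<dots> \<le> (\<integral>\<^sup>+ r. ennreal (b * c) * (ennreal (J r) * indicator {0<..} r) \<partial>lborel)"
    proof (rule nn_integral_mono)
      fix r :: real
      show "ennreal (5 * r^3 * (v r)\<^sup>2 + r * (v' r)\<^sup>2) * indicator (cbox 0 1) r
        \<le> ennreal (b * c) * (ennreal (J r) * indicator {0<..} r)"
      proof (cases "0 < r \<and> r \<le> 1")
        case True
        have "5 * r^3 * (v r)\<^sup>2 \<le> 5 * (1 + b) * (r * (r\<^sup>2 / D r * (v r)\<^sup>2))"
        proof -
          have "r\<^sup>2 \<le> 1" using True by (simp add: power_le_one)
          then have "D r \<le> 1 + b" by (simp add: Db)
          then have "1 \<le> (1 + b) / D r" using D_pos[of r] by simp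
          from mult_right_mono[OF this, of "5 * r^3 * (v r)\<^sup>2"] show ?thesis
            using True by (simp add: power2_eq_square power3_eq_cube mult_ac)
        qed
        moreover have "r * (v' r)\<^sup>2 \<le> 1 / b * (r * (D r * (v' r)\<^sup>2))"
        proof -
          have "1 \<le> D r / b" using b by (simp add: Db)
          from mult_right_mono[OF this, of "r * (v' r)\<^sup>2"] show ?thesis using True by (simp add: mult_ac)
        qed
        moreover have "5 * (1 + b) * x + 1 / b * y \<le> b * c * (x + y)" if "x \<ge> 0" "y \<ge> 0" for x y
        proof -
          have "b * c * (x + y) = (5 * (1 + b) * x + 1 / b * y) + (5 * (1 + b) * y + 1 / b * x)"
            unfolding bc by (simp add: algebra_simps add_divide_distrib)
          moreover have "0 \<le> 5 * (1 + b) * y + 1 / b * x" using that b by simp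
          ultimately show ?thesis by linarith
        qed
        ultimately have "5 * r^3 * (v r)\<^sup>2 + r * (v' r)\<^sup>2
            \<le> b * c * (r * (r\<^sup>2 / D r * (v r)\<^sup>2) + r * (D r * (v' r)\<^sup>2))"
          using True D_pos[of r] by (smt (verit) divide_nonneg_nonneg mult_nonneg_nonneg zero_le_power2)
        also have "\<dots> = b * c * J r" by (simp add: J_def distrib_left)
        finally show ?thesis
          using True b c J[of r] by (simp add: indicator_def ennreal_mult[symmetric] ennreal_leI del: ennreal_plus)
      next
        case False
        then show ?thesis by (cases "r = 0") (auto simp: indicator_def)
      qed
    qed
    also have "\<dots> = ennreal (b * c) * (\<integral>\<^sup>+ r \<in> {0<..}. ennreal (J r) \<partial>lborel)"
      by (rule nn_integral_cmult) measurable
    finally have near: "(\<integral>\<^sup>+ r \<in> cbox 0 1. ennreal (2 * r * (v r)\<^sup>2) \<partial>lborel)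
       \<le> ennreal (b * c) * (\<integral>\<^sup>+ r \<in> {0<..}. ennreal (J r) \<partial>lborel)" .
    have "(\<integral>\<^sup>+ r \<in> {0<..}. ennreal (r * ((v r)\<^sup>2 / D r)) \<partial>lborel)
      \<le> (\<integral>\<^sup>+ r. ennreal (1 / b) * (ennreal (2 * r * (v r)\<^sup>2) * indicator (cbox 0 1) r) + ennreal (J r) * indicator {0<..} r \<partial>lborel)"
    proof (rule nn_integral_mono)
      fix r :: real
      show "ennreal (r * ((v r)\<^sup>2 / D r)) * indicator {0<..} r
        \<le> ennreal (1 / b) * (ennreal (2 * r * (v r)\<^sup>2) * indicator (cbox 0 1) r) + ennreal (J r) * indicator {0<..} r"
      proof (cases "r > 0")
        case r: True
        show ?thesis
        proof (cases "r \<le> 1")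
          case True
          have "1 / D r \<le> 1 / b * 2"
          proof -
            have "1 / D r \<le> 1 / b" using b by (intro divide_left_mono) (auto simp: Db add_nonneg_pos)
            also have "\<dots> \<le> 1 / b * 2" using divide_right_mono[of 1 2 b] b by simp
            finally show ?thesis .
          qed
          from mult_right_mono[OF this, of "r * (v r)\<^sup>2"]
          have "r * ((v r)\<^sup>2 / D r) \<le> 1 / b * (2 * r * (v r)\<^sup>2)"
            using r by (simp add: mult_ac)
          then have "ennreal (r * ((v r)\<^sup>2 / D r)) \<le> ennreal (1 / b) * ennreal (2 * r * (v r)\<^sup>2)"
            using b r by (simp add: ennreal_mult[symmetric] ennreal_leI)
          then show ?thesis using r True by (simp add: add_increasing2)
        next
          case False
          then have "1 \<le> r\<^sup>2" using r by (simp add: one_le_power)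
          from mult_right_mono[OF this, of "r * ((v r)\<^sup>2 / D r)"]
          have "r * ((v r)\<^sup>2 / D r) \<le> r * (r\<^sup>2 / D r * (v r)\<^sup>2)"
            using r D_pos[of r] by (simp add: mult_ac)
          also have "\<dots> \<le> J r" using r D_pos[of r] by (simp add: J_def distrib_left)
          finally show ?thesis using r False by (simp add: ennreal_leI)
        qed
      qed simp
    qed
    also have "\<dots> = ennreal (1 / b) * (\<integral>\<^sup>+ r \<in> cbox 0 1. ennreal (2 * r * (v r)\<^sup>2) \<partial>lborel)
        + (\<integral>\<^sup>+ r \<in> {0<..}. ennreal (J r) \<partial>lborel)"
      by (subst nn_integral_add, measurable, subst nn_integral_cmult, measurable)
    also have "\<dots> \<le> ennreal (1 / b) * (ennreal (b * c) * (\<integral>\<^sup>+ r \<in> {0<..}. ennreal (J r) \<partial>lborel))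
        + (\<integral>\<^sup>+ r \<in> {0<..}. ennreal (J r) \<partial>lborel)"
      by (intro add_right_mono mult_left_mono near) simp
    also have "\<dots> = ennreal (c + 1) * (\<integral>\<^sup>+ r \<in> {0<..}. ennreal (J r) \<partial>lborel)"
    proof -
      have "ennreal (1 / b) * ennreal (b * c) = ennreal c"
        using b c by (simp add: ennreal_mult[symmetric])
      then show ?thesis
        using c by (simp add: mult.assoc[symmetric] distrib_right)
    qed
    finally show ?thesis by (simp add: J_def)
  qed
  then show ?thesis using c by (intro exI[of _ "c + 1"]) auto
qed

text \<open>By Fubini with r as the inner variable, the Hardy inequality is applied to the \<phi>
  derivative along each ray on which t, \<theta> and the angles are fixed.\<close>

lemma missing_term:
  "\<exists>C>0. \<forall>U t. smooth_on UNIV U \<longrightarrow>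
     (\<integral>\<^sup>+ x \<in> chart_box. ennreal (wt (fst x) (fst (snd x)) * ((partial (Space Phi) U (coords t x))\<^sup>2 / D (fst x))) \<partial>lborel)
       \<le> ennreal C * (T_energy U t + T_energy (partial (Space Phi) U) t)"
proof -
  obtain C where C: "C > 0" and hardy: "\<And>v v'. (\<And>r. (v has_real_derivative v' r) (at r)) \<Longrightarrow> continuous_on UNIV v' \<Longrightarrow>
     (\<integral>\<^sup>+ r \<in> {0<..}. ennreal (r * ((v r)\<^sup>2 / D r)) \<partial>lborel)
       \<le> ennreal C * (\<integral>\<^sup>+ r \<in> {0<..}. ennreal (r * (r\<^sup>2 / D r * (v r)\<^sup>2 + D r * (v' r)\<^sup>2)) \<partial>lborel)"
    using hardy_weighted by blast
  have "(\<integral>\<^sup>+ x \<in> chart_box. ennreal (wt (fst x) (fst (snd x)) * ((partial (Space Phi) U (coords t x))\<^sup>2 / D (fst x))) \<partial>lborel)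
       \<le> ennreal C * (T_energy U t + T_energy (partial (Space Phi) U) t)"
    if U: "smooth_on UNIV U" for U t
  proof -
    define V where "V = partial (Space Phi) U"
    have V: "smooth_on UNIV V" unfolding V_def by (rule smooth_partial[OF U])
    define Y :: "(real \<times> real \<times> real \<times> real) set" where
      "Y = {0<..<pi/2} \<times> {0<..<2*pi} \<times> {0<..<2*pi} \<times> {0<..<2*pi*Rz}"
    have [measurable]: "Y \<in> sets borel" unfolding Y_def by (intro borel_open open_Times) auto
    have box: "chart_box = {0<..} \<times> Y" by (simp add: chart_box_def Y_def)
    note [measurable] = measurable_coords[OF V, where t=t] measurable_coords[OF smooth_partial[OF V], where t=t]
      chart_box_measurable
    have [measurable]: "(\<lambda>x::slice_coords. wt (fst x) (fst (snd x))) \<in> borel_measurable borel"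
      "(\<lambda>x::slice_coords. D (fst x)) \<in> borel_measurable borel"
      unfolding wt_def D_def by measurable
    define A where "A x = wt (fst x) (fst (snd x)) * ((V (coords t x))\<^sup>2 / D (fst x))" for x
    define J where "J x = wt (fst x) (fst (snd x)) * ((fst x)\<^sup>2 / D (fst x) * (V (coords t x))\<^sup>2
       + D (fst x) * (partial (Space Rad) V (coords t x))\<^sup>2)" for x
    have Am [measurable]: "A \<in> borel_measurable borel" unfolding A_def[abs_def] by measurable
    have Jm [measurable]: "J \<in> borel_measurable borel" unfolding J_def[abs_def] by measurable
    have fubini: "(\<integral>\<^sup>+ x \<in> chart_box. ennreal (F x) \<partial>lborel)
       = (\<integral>\<^sup>+ y. (\<integral>\<^sup>+ r. ennreal (F (r, y)) * indicator chart_box (r, y) \<partial>lborel) \<partial>lborel)"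
      if F: "F \<in> borel_measurable borel" for F
    proof -
      have "(\<lambda>x. ennreal (F x) * indicator chart_box x) \<in> borel_measurable (lborel \<Otimes>\<^sub>M lborel)"
        using F unfolding lborel_prod by measurable
      from lborel_pair.nn_integral_snd[OF this] show ?thesis by (simp add: lborel_prod)
    qed
    have "(\<integral>\<^sup>+ x \<in> chart_box. ennreal (A x) \<partial>lborel)
       \<le> (\<integral>\<^sup>+ y. ennreal C * (\<integral>\<^sup>+ r. ennreal (J (r, y)) * indicator chart_box (r, y) \<partial>lborel) \<partial>lborel)"
      unfolding fubini[OF Am]
    proof (rule nn_integral_mono)
      fix y :: "real \<times> real \<times> real \<times> real"
      show "(\<integral>\<^sup>+ r. ennreal (A (r, y)) * indicator chart_box (r, y) \<partial>lborel)
        \<le> ennreal C * (\<integral>\<^sup>+ r. ennreal (J (r, y)) * indicator chart_box (r, y) \<partial>lborel)"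
      proof (cases "y \<in> Y")
        case False
        then show ?thesis by (simp add: box)
      next
        case True
        obtain \<theta> \<phi> \<psi> z where y: "y = (\<theta>, \<phi>, \<psi>, z)" by (metis surj_pair)
        have \<theta>: "\<theta> \<in> {0<..<pi/2}" using True by (simp add: y Y_def)
        \<comment> \<open>The weight \<open>wt\<close> is r times \<open>m\<close>, and
          \<open>m\<close> is constant along the ray.\<close>
        define m where "m = sin \<theta> * cos \<theta>"
        have m: "m \<ge> 0" using wt_nonneg[of 1 \<theta>] \<theta> by (simp add: wt_def m_def)
        define v where "v r = V (coords t (r, \<theta>, \<phi>, \<psi>, z))" for r
        define v' where "v' r = partial (Space Rad) V (coords t (r, \<theta>, \<phi>, \<psi>, z))" for r
        have dv: "(v has_real_derivative v' r) (at r)" for r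
          unfolding v_def v'_def by (rule DERIV_coords[OF V])
        have cv: "continuous_on UNIV v" "continuous_on UNIV v'"
          unfolding v_def v'_def by (intro continuous_on_coords V smooth_partial continuous_intros)+
        note [measurable] = cv[THEN borel_measurable_continuous_onI]
        have [measurable]: "D \<in> borel_measurable borel" unfolding D_def[abs_def] by measurable
        have eA: "ennreal (A (r, y)) * indicator chart_box (r, y)
          = ennreal m * (ennreal (r * ((v r)\<^sup>2 / D r)) * indicator {0<..} r)" for r
        proof -
          have "A (r, y) = m * (r * ((v r)\<^sup>2 / D r))"
            by (simp add: A_def y wt_def m_def v_def mult_ac)
          then have "ennreal (A (r, y)) = ennreal m * ennreal (r * ((v r)\<^sup>2 / D r))"
            by (simp only: ennreal_mult'[OF m])
          then show ?thesis using True by (simp add: box indicator_def)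
        qed
        have eJ: "ennreal (J (r, y)) * indicator chart_box (r, y)
          = ennreal m * (ennreal (r * (r\<^sup>2 / D r * (v r)\<^sup>2 + D r * (v' r)\<^sup>2)) * indicator {0<..} r)" for r
        proof -
          have "J (r, y) = m * (r * (r\<^sup>2 / D r * (v r)\<^sup>2 + D r * (v' r)\<^sup>2))"
            by (simp add: J_def y wt_def m_def v_def v'_def mult_ac)
          then have "ennreal (J (r, y)) = ennreal m * ennreal (r * (r\<^sup>2 / D r * (v r)\<^sup>2 + D r * (v' r)\<^sup>2))"
            by (simp only: ennreal_mult'[OF m])
          then show ?thesis using True by (simp add: box indicator_def)
        qed
        have "(\<integral>\<^sup>+ r. ennreal (A (r, y)) * indicator chart_box (r, y) \<partial>lborel)
          = ennreal m * (\<integral>\<^sup>+ r \<in> {0<..}. ennreal (r * ((v r)\<^sup>2 / D r)) \<partial>lborel)"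
          unfolding eA by (rule nn_integral_cmult) measurable
        also have "\<dots> \<le> ennreal m * (ennreal C * (\<integral>\<^sup>+ r \<in> {0<..}. ennreal (r * (r\<^sup>2 / D r * (v r)\<^sup>2 + D r * (v' r)\<^sup>2)) \<partial>lborel))"
          by (intro mult_left_mono hardy dv cv) simp
        also have "\<dots> = ennreal C * (ennreal m * (\<integral>\<^sup>+ r \<in> {0<..}. ennreal (r * (r\<^sup>2 / D r * (v r)\<^sup>2 + D r * (v' r)\<^sup>2)) \<partial>lborel))"
          by (simp add: mult_ac)
        also have "ennreal m * (\<integral>\<^sup>+ r \<in> {0<..}. ennreal (r * (r\<^sup>2 / D r * (v r)\<^sup>2 + D r * (v' r)\<^sup>2)) \<partial>lborel)
          = (\<integral>\<^sup>+ r. ennreal (J (r, y)) * indicator chart_box (r, y) \<partial>lborel)"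
          unfolding eJ by (rule nn_integral_cmult[symmetric]) measurable
        finally show ?thesis .
      qed
    qed
    also have "\<dots> = ennreal C * (\<integral>\<^sup>+ x \<in> chart_box. ennreal (J x) \<partial>lborel)"
    proof -
      have "(\<lambda>(y, r). ennreal (J (r, y)) * indicator chart_box (r, y)) \<in> borel_measurable (lborel \<Otimes>\<^sub>M lborel)"
        by measurable
      then have "(\<lambda>y. \<integral>\<^sup>+ r. ennreal (J (r, y)) * indicator chart_box (r, y) \<partial>lborel) \<in> borel_measurable lborel"
        by (rule lborel.borel_measurable_nn_integral)
      then show ?thesis unfolding fubini[OF Jm] by (rule nn_integral_cmult)
    qed
    also have "\<dots> \<le> ennreal C * (T_energy U t + T_energy V t)"
    proof (rule mult_left_mono)
      \<comment> \<open>The two terms of \<open>J\<close> are paid by different energies: the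
        undifferentiated one by the \<phi> term of \<open>U\<close>, since
        \<open>f \<ge> r\<^sup>2\<close> and sin is at most 1, and the differentiated one by the
        radial term of \<open>V\<close>.\<close>
      have "(\<integral>\<^sup>+ x \<in> chart_box. ennreal (J x) \<partial>lborel)
         \<le> (\<integral>\<^sup>+ x. ennreal (T_weighted U t x) * indicator chart_box x + ennreal (T_weighted V t x) * indicator chart_box x \<partial>lborel)"
      proof (rule nn_integral_mono)
        fix x :: "slice_coords"
        show "ennreal (J x) * indicator chart_box x
          \<le> ennreal (T_weighted U t x) * indicator chart_box x + ennreal (T_weighted V t x) * indicator chart_box x"
        proof (cases "x \<in> chart_box")
          case True
          define r where "r = fst x"
          define \<theta> where "\<theta> = fst (snd x)"
          have x: "r > 0" "\<theta> \<in> {0<..<pi/2}" using True by (auto simp: chart_box_def r_def \<theta>_def)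
          have w: "wt r \<theta> \<ge> 0" by (rule wt_nonneg[OF x])
          have s: "sin \<theta> > 0" using x(2) by (auto intro!: sin_gt_zero2)
          have q: "coords t x $ Space Rad = r" "coords t x $ Space Theta = \<theta>"
            by (simp_all add: coords_components r_def \<theta>_def)
          have "r\<^sup>2 / D r \<le> f r \<theta> / (D r * (sin \<theta>)\<^sup>2)"
          proof -
            have "r\<^sup>2 * (D r * (sin \<theta>)\<^sup>2) \<le> f r \<theta> * (D r * 1)"
              using D_pos[of r] qq_pos by (intro mult_mono mult_left_mono) (auto simp: f_def abs_square_le_1)
            then show ?thesis using D_pos[of r] s by (simp add: field_simps)
          qed
          from mult_right_mono[OF this, of "(V (coords t x))\<^sup>2"]
          have "r\<^sup>2 / D r * (V (coords t x))\<^sup>2 \<le> T_density U (coords t x)"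
            using T_density_lower(2)[OF q, of U] D_pos[of r] by (simp add: V_def)
              (smt (verit) mult_nonneg_nonneg zero_le_power2)
          moreover have "D r * (partial (Space Rad) V (coords t x))\<^sup>2 \<le> T_density V (coords t x)"
            using T_density_lower(1)[OF q, of V] G_pos[of r \<theta>] by (smt (verit) mult_nonneg_nonneg zero_le_power2)
          ultimately have "J x \<le> T_weighted U t x + T_weighted V t x"
            unfolding J_def T_weighted_def r_def[symmetric] \<theta>_def[symmetric] distrib_left[symmetric]
            using w by (intro mult_left_mono add_mono)
          moreover have "0 \<le> T_weighted U t x" "0 \<le> T_weighted V t x"
            using w T_density_lower(3)[OF q] by (simp_all add: T_weighted_def r_def \<theta>_def)
          ultimately show ?thesis using True by (simp add: ennreal_plus[symmetric] ennreal_leI del: ennreal_plus)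
        qed simp
      qed
      also have "\<dots> = T_energy U t + T_energy V t"
      proof -
        note [measurable] = measurable_T_weighted[OF U] measurable_T_weighted[OF V]
        show ?thesis unfolding T_energy_def by (rule nn_integral_add) measurable
      qed
      finally show "(\<integral>\<^sup>+ x \<in> chart_box. ennreal (J x) \<partial>lborel) \<le> T_energy U t + T_energy V t" .
    qed simp
    finally show ?thesis by (simp add: A_def V_def)
  qed
  then show ?thesis using C by blast
qed

end

section \<open>Combination of the density comparison, the Hardy estimate and the T-energy
  bounds\<close>

theorem theorem4p6:
  fixes Q1 Q2 Rz :: real
  assumes "Q1 > 0" and "Q2 > 0" and "Rz > 0"
  shows "\<exists>C>0. \<forall>g u. two_charge_metric Q1 Q2 Rz g \<longrightarrow>
      smooth_wave_solution g u \<longrightarrow> compactly_supported_data u \<longrightarrow>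
      (\<forall>t\<ge>0.
        slice_integral Q1 Q2 Rz t (energy_density Q1 Q2 Rz (u \<circ> coord_map Rz)) \<le>
        ennreal C * slice_integral Q1 Q2 Rz 0
          (\<lambda>q. energy_density Q1 Q2 Rz (u \<circ> coord_map Rz) q +
               energy_density Q1 Q2 Rz (partial (Space Phi) (u \<circ> coord_map Rz)) q))"
proof -
  interpret two_charge Q1 Q2 Rz using assms by unfold_locales
  let ?ed = "energy_density Q1 Q2 Rz"
  let ?vol = "\<lambda>q. sqrt (det (induced_metric Q1 Q2 Rz q))"
  obtain \<kappa> where \<kappa>: "\<kappa> \<ge> 1" and
    lower: "\<And>U q. U differentiable (at q) \<Longrightarrow> q \<in> chart \<Longrightarrow>
       wt (q $ Space Rad) (q $ Space Theta) * T_density U q \<le> \<kappa> * (?ed U q * ?vol q)" and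
    upper: "\<And>U q. U differentiable (at q) \<Longrightarrow> q \<in> chart \<Longrightarrow>
       ?ed U q * ?vol q \<le> \<kappa> * (wt (q $ Space Rad) (q $ Space Theta)
         * (T_density U q + (partial (Space Phi) U q)\<^sup>2 / D (q $ Space Rad)))"
    using density_comparison by blast
  obtain C where C: "C > 0" and missing: "\<And>U t. smooth_on UNIV U \<Longrightarrow>
     (\<integral>\<^sup>+ x \<in> chart_box. ennreal (wt (fst x) (fst (snd x)) * ((partial (Space Phi) U (coords t x))\<^sup>2 / D (fst x))) \<partial>lborel)
       \<le> ennreal C * (T_energy U t + T_energy (partial (Space Phi) U) t)"
    using missing_term by blast
  have chart: "coords t x \<in> chart" if "x \<in> chart_box" for t x
    using that by (auto simp: chart_def chart_box_def coords_components)
  have slice: "slice_integral Q1 Q2 Rz t F = (\<integral>\<^sup>+ x \<in> chart_box. ennreal (F (coords t x) * ?vol (coords t x)) \<partial>lborel)" for t F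
    by (simp add: slice_integral_def chart_box_def)
  \<comment> \<open>Origin of the constant: one \<kappa> passes from the energy of \<open>U\<close>
    at time \<open>t\<close> to T-energies, \<open>1 + C\<close> pays for the missing term, and the
    other \<kappa> passes back to full energies at time 0.\<close>
  have "slice_integral Q1 Q2 Rz t (?ed U) \<le>
      ennreal (\<kappa> * (1 + C) * \<kappa>) * slice_integral Q1 Q2 Rz 0 (\<lambda>q. ?ed U q + ?ed V q)"
    if g: "two_charge_metric Q1 Q2 Rz g" and u: "smooth_wave_solution g u" and t: "t \<ge> 0"
      and U_def: "U = u \<circ> coord_map Rz" and V_def: "V = partial (Space Phi) U" for g u t U V
  proof -
    have U: "smooth_on UNIV U"
      using u unfolding U_def smooth_wave_solution_def by (blast intro: smooth_comp_coord_map)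
    have V: "smooth_on UNIV V" unfolding V_def by (rule smooth_partial[OF U])
    have perU: "angle_periodic U" unfolding U_def by (rule angle_periodic_comp)
    have perV: "angle_periodic V" unfolding V_def by (rule angle_periodic_partial[OF U perU])
    have wU: "wave_expr U q = 0" if "q \<in> chart" for q
      unfolding U_def by (rule wave_equation[OF g u that])
    have wV: "wave_expr V q = 0" if "q \<in> chart" for q
      unfolding V_def by (rule wave_expr_Phi[OF U wU that])
    note [measurable] = measurable_T_weighted[OF U] measurable_T_weighted[OF V] chart_box_measurable
    have Tn: "T_weighted W s x \<ge> 0" if "x \<in> chart_box" for W s x
      using that wt_nonneg[of "fst x" "fst (snd x)"] T_density_lower(3)[OF refl refl, of W "coords s x"]
      by (auto simp: chart_box_def T_weighted_def)
    define B where "B x = wt (fst x) (fst (snd x)) * ((V (coords t x))\<^sup>2 / D (fst x))" for x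
    have Bm [measurable]: "B \<in> borel_measurable borel"
    proof -
      note [measurable] = measurable_coords[OF V, where t=t]
      show ?thesis unfolding B_def[abs_def] wt_def D_def by measurable
    qed
    have Bn: "B x \<ge> 0" if "x \<in> chart_box" for x
      using that wt_nonneg[of "fst x" "fst (snd x)"] D_pos[of "fst x"] by (auto simp: chart_box_def B_def)
    have "slice_integral Q1 Q2 Rz t (?ed U)
       \<le> (\<integral>\<^sup>+ x. ennreal \<kappa> * (ennreal (T_weighted U t x) * indicator chart_box x + ennreal (B x) * indicator chart_box x) \<partial>lborel)"
      unfolding slice
    proof (rule nn_integral_mono)
      fix x
      show "ennreal (?ed U (coords t x) * ?vol (coords t x)) * indicator chart_box x
        \<le> ennreal \<kappa> * (ennreal (T_weighted U t x) * indicator chart_box x + ennreal (B x) * indicator chart_box x)"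
      proof (cases "x \<in> chart_box")
        case True
        have "?ed U (coords t x) * ?vol (coords t x) \<le> \<kappa> * (T_weighted U t x + B x)"
          using upper[OF smooth_differentiable[OF U] chart[OF True], of t]
          by (simp add: coords_components T_weighted_def B_def V_def distrib_left)
        then show ?thesis
          using True \<kappa> Tn[OF True] Bn[OF True]
          by (simp add: ennreal_plus[symmetric] ennreal_mult[symmetric] ennreal_leI del: ennreal_plus)
      qed simp
    qed
    also have "\<dots> = ennreal \<kappa> * (T_energy U t + (\<integral>\<^sup>+ x \<in> chart_box. ennreal (B x) \<partial>lborel))"
      unfolding T_energy_def by (subst nn_integral_cmult, measurable, subst nn_integral_add, measurable)
    also have "\<dots> \<le> ennreal \<kappa> * (1 * (T_energy U t + T_energy V t) + ennreal C * (T_energy U t + T_energy V t))"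
      using missing[OF U, of t] by (intro mult_left_mono add_mono) (auto simp: B_def V_def add_increasing2)
    also have "\<dots> = ennreal (\<kappa> * (1 + C)) * (T_energy U t + T_energy V t)"
    proof -
      have "1 * x + ennreal C * x = ennreal (1 + C) * x" for x
        using C by (simp add: distrib_right)
      then show ?thesis using \<kappa> C by (simp only: ennreal_mult mult.assoc)
    qed
    also have "\<dots> \<le> ennreal (\<kappa> * (1 + C)) * (T_energy U 0 + T_energy V 0)"
      by (intro mult_left_mono add_mono T_energy_le U V perU perV wU wV t) auto
    also have "T_energy U 0 + T_energy V 0 \<le> ennreal \<kappa> * slice_integral Q1 Q2 Rz 0 (\<lambda>q. ?ed U q + ?ed V q)"
    proof -
      \<comment> \<open>The factor is put as \<open>1 / \<kappa>\<close> on the side of the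
        T-energies, whose integrands are known to be measurable. The energy density is built from a
        chosen frame, and only monotonicity of the integral is applied to it.\<close>
      have "ennreal (1 / \<kappa>) * (T_energy U 0 + T_energy V 0) =
        (\<integral>\<^sup>+ x. ennreal (1 / \<kappa>) * (ennreal (T_weighted U 0 x) * indicator chart_box x + ennreal (T_weighted V 0 x) * indicator chart_box x) \<partial>lborel)"
        unfolding T_energy_def by (subst nn_integral_cmult, measurable, subst nn_integral_add, measurable)
      also have "\<dots> \<le> slice_integral Q1 Q2 Rz 0 (\<lambda>q. ?ed U q + ?ed V q)"
        unfolding slice
      proof (rule nn_integral_mono)
        fix x
        show "ennreal (1 / \<kappa>) * (ennreal (T_weighted U 0 x) * indicator chart_box x + ennreal (T_weighted V 0 x) * indicator chart_box x)
          \<le> ennreal ((?ed U (coords 0 x) + ?ed V (coords 0 x)) * ?vol (coords 0 x)) * indicator chart_box x"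
        proof (cases "x \<in> chart_box")
          case True
          have "T_weighted U 0 x + T_weighted V 0 x
             \<le> \<kappa> * ((?ed U (coords 0 x) + ?ed V (coords 0 x)) * ?vol (coords 0 x))"
            using lower[OF smooth_differentiable[OF U] chart[OF True], of 0]
              lower[OF smooth_differentiable[OF V] chart[OF True], of 0]
            by (simp add: coords_components T_weighted_def algebra_simps)
          then have "1 / \<kappa> * (T_weighted U 0 x + T_weighted V 0 x)
             \<le> (?ed U (coords 0 x) + ?ed V (coords 0 x)) * ?vol (coords 0 x)"
            using \<kappa> by (simp add: pos_divide_le_eq mult.commute)
          then show ?thesis
            using True \<kappa> Tn[OF True]
            by (simp add: ennreal_plus[symmetric] ennreal_mult[symmetric] ennreal_leI del: ennreal_plus)
        qed simp
      qed
      finally have "ennreal \<kappa> * (ennreal (1 / \<kappa>) * (T_energy U 0 + T_energy V 0))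
         \<le> ennreal \<kappa> * slice_integral Q1 Q2 Rz 0 (\<lambda>q. ?ed U q + ?ed V q)"
        by (rule mult_left_mono) simp
      moreover have "ennreal \<kappa> * ennreal (1 / \<kappa>) = 1"
        using \<kappa> by (simp add: ennreal_mult[symmetric])
      ultimately show ?thesis by (simp add: mult.assoc[symmetric])
    qed
    finally have "slice_integral Q1 Q2 Rz t (?ed U) \<le> ennreal (\<kappa> * (1 + C)) *
        (ennreal \<kappa> * slice_integral Q1 Q2 Rz 0 (\<lambda>q. ?ed U q + ?ed V q))"
      by (simp add: mult_left_mono)
    then show ?thesis using \<kappa> C by (simp add: ennreal_mult mult.assoc)
  qed
  then show ?thesis using \<kappa> C by (intro exI[of _ "\<kappa> * (1 + C) * \<kappa>"]) auto
qed

end
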